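(* Let $G$ be a non-elementary hyperbolic group with finite generating set $\Sigma$, whose Cayley graph $X=\Gamma(G,\Sigma)$ is $\delta$-hyperbolic, with base point $o=e$. Let $S\subseteq G$ be an $(\varepsilon,C,D)$-Schottky set with $\varepsilon\le 1/100$ and $D>100C+100\delta+1$, let $\mu_S$ be the uniform probability measure on $S$, let $\kappa$ be any probability measure on $G$, and let $\theta=\kappa*\mu_S^{*2}$. Suppose $\theta$ has finite entropy. Then for the random walk driven by $\theta$, $$\lim_{n\to\infty}\frac{H_{\partial G}(\mathcal{A}_n)}{n}=0.$$
   Context: For $x,y,z\in X$, the Gromov product is $(x,y)_z=\frac12(d(x,z)+d(y,z)-d(x,y))$. A finite set $S$ of isometries is $(\varepsilon,C,D)$-Schottky if (1) for all $x,y\in X$, $\#\{s\in S:(x,sy)_o\le C\}\ge(1-\varepsilon)\#S$; (2) for all $x,y\in X$, $\#\{s\in S:(x,s^{-1}y)_o\le C\}\ge(1-\varepsilon)\#S$; (3) $d(o,so)\ge D$ for all $s\in S$. The random walk is $w_n=g_1\cdots g_n$ with $g_i$ i.i.d. of law $\theta$ on the path space $(\Omega,\mathbb{P})$; it converges almost surely to a point of $\partial G$, with hitting measure $\lambda$, and $\mathbb{P}=\int_{\partial G}\mathbb{P}^\xi\,d\lambda(\xi)$ is the disintegration into conditional measures given the limit point $\xi$. $\mathcal{A}_n$ is the partition of $\Omega$ according to the value of $w_n$. For a countable partition $\rho=(\rho_i)$, $H_\xi(\rho)=-\sum_i\mathbb{P}^\xi(\rho_i)\log\mathbb{P}^\xi(\rho_i)$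 and $H_{\partial G}(\rho)=\int_{\partial G}H_\xi(\rho)\,d\lambda(\xi)$. *)

theory Defs
  imports "HOL-Probability.Probability"
begin

text \<open>The group G is a type 'g of class group_add, written additively but NOT assumed
commutative: x + y is the group product, -x the inverse, 0 the identity.\<close>

definition gens :: "'g::group_add set \<Rightarrow> 'g set" where
  "gens \<Sigma> = \<Sigma> \<union> uminus ` \<Sigma>"

definition generates :: "'g::group_add set \<Rightarrow> bool" where
  "generates \<Sigma> \<longleftrightarrow> (\<forall>g. \<exists>l. set l \<subseteq> gens \<Sigma> \<and> sum_list l = g)"

definition wordlen :: "'g::group_add set \<Rightarrow> 'g \<Rightarrow> nat" where
  "wordlen \<Sigma> g = (LEAST n. \<exists>l. length l = n \<and> set l \<subseteq> gens \<Sigma> \<and> sum_list l = g)"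

definition dG :: "'g::group_add set \<Rightarrow> 'g \<Rightarrow> 'g \<Rightarrow> real" where
  "dG \<Sigma> a b = real (wordlen \<Sigma> (- a + b))"

definition zmul :: "'g::group_add \<Rightarrow> int \<Rightarrow> 'g" where
  "zmul a k = (if k \<ge> 0 then ((+) a ^^ nat k) 0 else - (((+) a ^^ nat (- k)) 0))"

definition cyclic_subgroup :: "'g::group_add \<Rightarrow> 'g set" where
  "cyclic_subgroup a = range (zmul a)"

definition virtually_cyclic :: "'g::group_add itself \<Rightarrow> bool" where
  "virtually_cyclic _ \<longleftrightarrow>
     (\<exists>a::'g. finite {(\<lambda>h. g + h) ` cyclic_subgroup a | g. True})"

definition non_elementary :: "'g::group_add itself \<Rightarrow> bool" where
  "non_elementary T \<longleftrightarrow> \<not> virtually_cyclic T"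

text \<open>A point (g, s, t) with s \<in> \<Sigma>, 0 \<le> t \<le> 1 lies on the edge from vertex g to vertex g + s,
at distance t from g.\<close>

definition cayX :: "'g::group_add set \<Rightarrow> ('g \<times> 'g \<times> real) set" where
  "cayX \<Sigma> = {(g, s, t). s \<in> \<Sigma> \<and> 0 \<le> t \<and> t \<le> 1}"

definition cdist :: "'g::group_add set \<Rightarrow> ('g \<times> 'g \<times> real) \<Rightarrow> ('g \<times> 'g \<times> real) \<Rightarrow> real" where
  "cdist \<Sigma> p q = (case p of (g, s, t) \<Rightarrow> case q of (h, r, u) \<Rightarrow>
     (let via = min (min (t + dG \<Sigma> g h + u) (t + dG \<Sigma> g (h + r) + (1 - u)))
                    (min ((1 - t) + dG \<Sigma> (g + s) h + u) ((1 - t) + dG \<Sigma> (g + s) (h + r) + (1 - u)))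
      in if g = h \<and> s = r then min \<bar>t - u\<bar> via else via))"

definition vert :: "'g::group_add set \<Rightarrow> 'g \<Rightarrow> 'g \<times> 'g \<times> real" where
  "vert \<Sigma> a = (a, SOME s. s \<in> \<Sigma>, 0)"

definition act :: "'g::group_add \<Rightarrow> 'g \<times> 'g \<times> real \<Rightarrow> 'g \<times> 'g \<times> real" where
  "act a p = (case p of (g, s, t) \<Rightarrow> (a + g, s, t))"

definition gprod :: "'g::group_add set \<Rightarrow> ('g \<times> 'g \<times> real) \<Rightarrow> ('g \<times> 'g \<times> real) \<Rightarrow> real" where
  "gprod \<Sigma> x y = (cdist \<Sigma> x (vert \<Sigma> 0) + cdist \<Sigma> y (vert \<Sigma> 0) - cdist \<Sigma> x y) / 2"

definition gprod_at :: "'g::group_add set \<Rightarrow> ('g \<times> 'g \<times> real) \<Rightarrow> ('g \<times> 'g \<times> real)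
     \<Rightarrow> ('g \<times> 'g \<times> real) \<Rightarrow> real" where
  "gprod_at \<Sigma> x y w = (cdist \<Sigma> x w + cdist \<Sigma> y w - cdist \<Sigma> x y) / 2"

definition delta_hyperbolic :: "'g::group_add set \<Rightarrow> real \<Rightarrow> bool" where
  "delta_hyperbolic \<Sigma> \<delta> \<longleftrightarrow> (\<forall>x\<in>cayX \<Sigma>. \<forall>y\<in>cayX \<Sigma>. \<forall>z\<in>cayX \<Sigma>. \<forall>w\<in>cayX \<Sigma>.
      gprod_at \<Sigma> x y w \<ge> min (gprod_at \<Sigma> x z w) (gprod_at \<Sigma> z y w) - \<delta>)"

definition schottky :: "'g::group_add set \<Rightarrow> 'g set \<Rightarrow> real \<Rightarrow> real \<Rightarrow> real \<Rightarrow> bool" where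
  "schottky \<Sigma> S \<epsilon> C D \<longleftrightarrow> finite S \<and>
     (\<forall>x\<in>cayX \<Sigma>. \<forall>y\<in>cayX \<Sigma>.
        real (card {s\<in>S. gprod \<Sigma> x (act s y) \<le> C}) \<ge> (1 - \<epsilon>) * real (card S)) \<and>
     (\<forall>x\<in>cayX \<Sigma>. \<forall>y\<in>cayX \<Sigma>.
        real (card {s\<in>S. gprod \<Sigma> x (act (- s) y) \<le> C}) \<ge> (1 - \<epsilon>) * real (card S)) \<and>
     (\<forall>s\<in>S. cdist \<Sigma> (vert \<Sigma> 0) (act s (vert \<Sigma> 0)) \<ge> D)"

definition gprodG :: "'g::group_add set \<Rightarrow> 'g \<Rightarrow> 'g \<Rightarrow> real" where
  "gprodG \<Sigma> a b = (dG \<Sigma> a 0 + dG \<Sigma> b 0 - dG \<Sigma> a b) / 2"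

definition conv_infty :: "'g::group_add set \<Rightarrow> (nat \<Rightarrow> 'g) \<Rightarrow> bool" where
  "conv_infty \<Sigma> x \<longleftrightarrow> (\<forall>R. \<exists>N. \<forall>i\<ge>N. \<forall>j\<ge>N. gprodG \<Sigma> (x i) (x j) \<ge> R)"

definition seq_equiv :: "'g::group_add set \<Rightarrow> (nat \<Rightarrow> 'g) \<Rightarrow> (nat \<Rightarrow> 'g) \<Rightarrow> bool" where
  "seq_equiv \<Sigma> x y \<longleftrightarrow> (\<forall>R. \<exists>N. \<forall>i\<ge>N. \<forall>j\<ge>N. gprodG \<Sigma> (x i) (y j) \<ge> R)"

definition bndry :: "'g::group_add set \<Rightarrow> (nat \<Rightarrow> 'g) set set" where
  "bndry \<Sigma> = {{y. conv_infty \<Sigma> y \<and> seq_equiv \<Sigma> x y} | x. conv_infty \<Sigma> x}"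

definition gprodB :: "'g::group_add set \<Rightarrow> (nat \<Rightarrow> 'g) set \<Rightarrow> (nat \<Rightarrow> 'g) set \<Rightarrow> ereal" where
  "gprodB \<Sigma> \<xi> \<eta> = (SUP x\<in>\<xi>. SUP y\<in>\<eta>. SUP n. INF i\<in>{n..}. INF j\<in>{n..}. ereal (gprodG \<Sigma> (x i) (y j)))"

definition bndry_open :: "'g::group_add set \<Rightarrow> (nat \<Rightarrow> 'g) set set set" where
  "bndry_open \<Sigma> = {U. U \<subseteq> bndry \<Sigma> \<and>
      (\<forall>\<xi>\<in>U. \<exists>R::real. {\<eta>\<in>bndry \<Sigma>. gprodB \<Sigma> \<xi> \<eta> > ereal R} \<subseteq> U)}"

definition Bnd :: "'g::group_add set \<Rightarrow> (nat \<Rightarrow> 'g) set measure" where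
  "Bnd \<Sigma> = sigma (bndry \<Sigma>) (bndry_open \<Sigma>)"

definition conv_pmf :: "'g::group_add pmf \<Rightarrow> 'g pmf \<Rightarrow> 'g pmf" where
  "conv_pmf p q = bind_pmf p (\<lambda>a. map_pmf (\<lambda>b. a + b) q)"

definition entropy_pmf :: "'g pmf \<Rightarrow> ennreal" where
  "entropy_pmf p = (\<integral>\<^sup>+ g. ennreal (- pmf p g * ln (pmf p g)) \<partial>count_space UNIV)"

definition pathsp :: "'g pmf \<Rightarrow> 'g stream measure" where
  "pathsp \<theta> = stream_space (measure_pmf \<theta>)"

definition walk :: "nat \<Rightarrow> 'g::group_add stream \<Rightarrow> 'g" where
  "walk n \<omega> = sum_list (stake n \<omega>)"

text \<open>the limit point of the walk (an arbitrary boundary point if there is none)\<close>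
definition bnd_lim :: "'g::group_add set \<Rightarrow> 'g stream \<Rightarrow> (nat \<Rightarrow> 'g) set" where
  "bnd_lim \<Sigma> \<omega> = (if \<exists>\<xi>\<in>bndry \<Sigma>. (\<lambda>n. walk n \<omega>) \<in> \<xi>
      then SOME \<xi>. \<xi> \<in> bndry \<Sigma> \<and> (\<lambda>n. walk n \<omega>) \<in> \<xi>
      else SOME \<xi>. \<xi> \<in> bndry \<Sigma>)"

definition hitting :: "'g::group_add set \<Rightarrow> 'g pmf \<Rightarrow> (nat \<Rightarrow> 'g) set measure" where
  "hitting \<Sigma> \<theta> = distr (pathsp \<theta>) (Bnd \<Sigma>) (bnd_lim \<Sigma>)"

definition is_disintegration ::
  "'g::group_add set \<Rightarrow> 'g pmf \<Rightarrow> ((nat \<Rightarrow> 'g) set \<Rightarrow> 'g stream measure) \<Rightarrow> bool" where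
  "is_disintegration \<Sigma> \<theta> Pc \<longleftrightarrow>
     (\<forall>\<xi>\<in>bndry \<Sigma>. prob_space (Pc \<xi>) \<and> sets (Pc \<xi>) = sets (pathsp \<theta>)) \<and>
     (\<forall>A\<in>sets (pathsp \<theta>). (\<lambda>\<xi>. emeasure (Pc \<xi>) A) \<in> borel_measurable (Bnd \<Sigma>)) \<and>
     (\<forall>A\<in>sets (pathsp \<theta>). \<forall>B\<in>sets (Bnd \<Sigma>).
        emeasure (pathsp \<theta>) (A \<inter> bnd_lim \<Sigma> -` B) =
        (\<integral>\<^sup>+ \<xi>. emeasure (Pc \<xi>) A * indicator B \<xi> \<partial>hitting \<Sigma> \<theta>))"

definition H_xi :: "'g::group_add pmf \<Rightarrow> ((nat \<Rightarrow> 'g) set \<Rightarrow> 'g stream measure)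
     \<Rightarrow> (nat \<Rightarrow> 'g) set \<Rightarrow> nat \<Rightarrow> ennreal" where
  "H_xi \<theta> Pc \<xi> n = (\<integral>\<^sup>+ g. ennreal
       (let p = measure (Pc \<xi>) {\<omega> \<in> space (pathsp \<theta>). walk n \<omega> = g} in - p * ln p)
     \<partial>count_space UNIV)"

definition H_bnd :: "'g::group_add set \<Rightarrow> 'g pmf \<Rightarrow> ((nat \<Rightarrow> 'g) set \<Rightarrow> 'g stream measure)
     \<Rightarrow> nat \<Rightarrow> ennreal" where
  "H_bnd \<Sigma> \<theta> Pc n = (\<integral>\<^sup>+ \<xi>. H_xi \<theta> Pc \<xi> n \<partial>hitting \<Sigma> \<theta>)"

end

theory Submission
  imports Defs
begin

text \<open>Call a time \<open>k\<close> good if \<open>(e, w\<^sub>j)\<close> based at \<open>w\<^sub>k\<close> is at most \<open>R\<close> for all \<open>j \<ge> k\<close>. If \<open>R\<close> is large,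
each time is good with probability close to 1. Record the increments except those of bounded length
between two good times: by finite entropy, the recording costs at most \<open>e n\<close> nats. It determines
the length of the walk at the last good time up to an error linear in \<open>n\<close>, since lengths are additive
along good times up to an error \<open>2R\<close>. Given the limit point, a good position is determined by its length up to boundedly
many choices, as it lies in a bounded neighbourhood of a ray. So the conditional entropy of \<open>w\<^sub>n\<close> is at most
\<open>e n + O(log n)\<close>.

The probability that a time is good is estimated with Gouezel's pivots. A time \<open>m\<close> which is not a usable
pivot for the target \<open>w\<^sub>n\<close> is blocked either by the past (its first Schottky increment points back) or
by the future (the target lies behind it), and both have small conditional probability. If no time in
a window of length \<open>l\<close> is usable, one of the two reasons applies to half of the window, so a union
bound over the \<open>2\<^sup>l\<close> assignments of reasons gives exponential decay.\<close>

section \<open>Word metrics and hyperbolicity\<close>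

text \<open>Finite entropy of \<open>\<theta>\<close> gives no moment for word length: increments
  can be so long that the length of \<open>w_n\<close> has far more than polynomially many plausible
  values. This is why long increments are recorded as group elements and paid for with entropy; what
  the recording leaves open is then only a linear range of lengths, whose logarithm is negligible
  against \<open>n\<close>.

  Being good is an event of the whole future, so whether an increment is recorded is not independent
  of its value. The cost of recording cannot be written as a probability times an entropy. It is
  bounded through uniform integrability of the information \<open>- ln (pmf \<theta> g)\<close>: an
  event of small probability carries little information, however it depends on the increment.

  The Gromov product estimates hold for an arbitrary reference point \<open>y\<close>, with
  constants independent of \<open>y\<close> and of the time horizon. Seen from \<open>w_k\<close>,
  the origin is such a point, independent of the increments after time \<open>k\<close>; this makes
  one estimate serve all times at once.\<close>

locale hyperbolic_group =
  fixes \<Sigma> :: "'g::group_add set" and \<delta> :: real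
  assumes finite_gens: "finite \<Sigma>" and generates: "generates \<Sigma>" and nonempty: "\<Sigma> \<noteq> {}"
    and hyperbolic: "delta_hyperbolic \<Sigma> \<delta>"
begin

abbreviation len :: "'g \<Rightarrow> nat" where "len \<equiv> wordlen \<Sigma>"
abbreviation d :: "'g \<Rightarrow> 'g \<Rightarrow> real" where "d \<equiv> dG \<Sigma>"

definition gp :: "'g \<Rightarrow> 'g \<Rightarrow> 'g \<Rightarrow> real" where
  "gp w x y = (d x w + d y w - d x y) / 2"

lemma len_le: "set l \<subseteq> gens \<Sigma> \<Longrightarrow> len (sum_list l) \<le> length l"
  unfolding wordlen_def by (rule Least_le) auto

lemma len_word: "\<exists>l. length l = len g \<and> set l \<subseteq> gens \<Sigma> \<and> sum_list l = g"
proof -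
  obtain l where "set l \<subseteq> gens \<Sigma>" "sum_list l = g"
    using generates unfolding generates_def by blast
  then have "\<exists>n l. length l = n \<and> set l \<subseteq> gens \<Sigma> \<and> sum_list l = g" by blast
  then show ?thesis unfolding wordlen_def by (rule LeastI_ex)
qed

lemma len_zero [simp]: "len 0 = 0"
  using len_le[of "[]"] by simp

lemma len_add: "len (g + h) \<le> len g + len h"
proof -
  obtain l l' where "length l = len g" "set l \<subseteq> gens \<Sigma>" "sum_list l = g"
    "length l' = len h" "set l' \<subseteq> gens \<Sigma>" "sum_list l' = h"
    using len_word by meson
  then show ?thesis using len_le[of "l @ l'"] by simp
qed

lemma sum_list_rev_uminus: "sum_list (rev (map uminus l)) = - sum_list (l :: 'a::group_add list)"
  by (induction l) (simp_all add: minus_add)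

lemma len_uminus_le: "len (- g) \<le> len g"
proof -
  obtain l where l: "length l = len g" "set l \<subseteq> gens \<Sigma>" "sum_list l = g"
    using len_word by meson
  have "set (rev (map uminus l)) \<subseteq> gens \<Sigma>"
    using l(2) by (force simp: gens_def)
  then show ?thesis using len_le[of "rev (map uminus l)"] l
    by (simp add: sum_list_rev_uminus)
qed

lemma len_uminus [simp]: "len (- g) = len g"
  using len_uminus_le[of g] len_uminus_le[of "- g"] by simp

lemma finite_ball: "finite {g. len g \<le> n}"
proof -
  have "{g. len g \<le> n} \<subseteq> sum_list ` {l. set l \<subseteq> gens \<Sigma> \<and> length l \<le> n}"
  proof
    fix g assume "g \<in> {g. len g \<le> n}"
    then show "g \<in> sum_list ` {l. set l \<subseteq> gens \<Sigma> \<and> length l \<le> n}"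
      using len_word[of g] by force
  qed
  moreover have "finite (gens \<Sigma>)" using finite_gens by (simp add: gens_def)
  ultimately show ?thesis
    using finite_lists_length_le finite_surj by blast
qed

lemma countable_group: "countable (UNIV :: 'g set)"
proof -
  have "UNIV = (\<Union>n. {g. len g \<le> n})" by auto
  then show ?thesis
    using finite_ball by (metis countable_UN countable_finite countableI_type)
qed

lemma d_self [simp]: "d a a = 0" by (simp add: dG_def)

lemma d_nonneg [simp]: "0 \<le> d a b" by (simp add: dG_def)

lemma d_commute: "d a b = d b a"
proof -
  have "- a + b = - (- b + a)" by (simp add: minus_add)
  then show ?thesis by (metis dG_def len_uminus)
qed

lemma d_triangle: "d a c \<le> d a b + d b c"
proof -
  have "- a + c = (- a + b) + (- b + c)" by (simp add: add.assoc)
  then show ?thesis using len_add[of "- a + b" "- b + c"] by (simp add: dG_def)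
qed

lemma d_left [simp]: "d (g + a) (g + b) = d a b"
  unfolding dG_def by (simp only: minus_add add.assoc minus_add_cancel)

lemma d_zero_left [simp]: "d 0 b = len b" by (simp add: dG_def)

lemma d_zero_right [simp]: "d b 0 = len b" by (simp add: dG_def)

lemma gp_commute: "gp w x y = gp w y x" by (simp add: gp_def d_commute)

lemma gp_left [simp]: "gp (g + w) (g + x) (g + y) = gp w x y" by (simp add: gp_def)

lemma gp_translate: "gp w x y = gp 0 (- w + x) (- w + y)"
  using gp_left[of "- w" w x y] by simp

lemma gp_nonneg: "0 \<le> gp w x y"
  unfolding gp_def using d_triangle[of x y w] d_commute[of w y] by simp

lemma gp_le: "gp w x y \<le> d x w"
  unfolding gp_def using d_triangle[of y w x] d_commute[of x y] by simp

lemma gp_le_right: "gp w x y \<le> d y w"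
  using gp_le[of w y x] by (simp add: gp_commute)

text \<open>The products at the two ends of a side add up to its length. Throughout, this turns a
  small product at one end of a long side into a large product at the other end.\<close>

lemma gp_swap: "gp w x y = d w x - gp x w y"
  unfolding gp_def using d_commute[of x w] d_commute[of y w] d_commute[of y x] by (simp add: field_simps)

lemma gp_base_change: "gp w x y \<le> gp v x y + d w v"
  unfolding gp_def using d_triangle[of x w v] d_triangle[of y w v] d_commute[of v w] by (simp add: field_simps)

lemma gprodG_eq: "gprodG \<Sigma> x y = gp 0 x y" by (simp add: gprodG_def gp_def)

lemma vert_in [simp]: "vert \<Sigma> a \<in> cayX \<Sigma>"
  using nonempty by (simp add: cayX_def vert_def some_in_eq)

lemma act_vert [simp]: "act g (vert \<Sigma> a) = vert \<Sigma> (g + a)"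
  by (simp add: act_def vert_def)

lemma d_gen: "s \<in> \<Sigma> \<Longrightarrow> d a (a + s) \<le> 1"
  using len_le[of "[s]"] by (simp add: dG_def gens_def)

lemma cdist_vert [simp]: "cdist \<Sigma> (vert \<Sigma> a) (vert \<Sigma> b) = d a b"
proof -
  define s where "s = (SOME s. s \<in> \<Sigma>)"
  have s: "s \<in> \<Sigma>" using nonempty by (simp add: s_def some_in_eq)
  \<comment> \<open>Both vertices are the starting points of edges with the same label
    \<open>s\<close>. The other three routes in \<open>cdist\<close> pass through the far end of at
    least one of these edges and are no shorter.\<close>
  have 1: "d a b \<le> d a (b + s) + 1"
    using d_triangle[of a b "b + s"] d_gen[OF s, of b] d_commute[of b "b + s"] by simp
  have 2: "d a b \<le> 1 + d (a + s) b"
    using d_triangle[of a b "a + s"] d_gen[OF s, of a] by simp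
  have 3: "d a b \<le> 1 + d (a + s) (b + s) + 1"
    using d_triangle[of a "b + s" "a + s"] d_gen[OF s, of a] 1 by simp
  show ?thesis
    unfolding cdist_def vert_def s_def[symmetric] using 1 2 3
    by (auto simp: Let_def min_def)
qed

lemma gprod_at_vert: "gprod_at \<Sigma> (vert \<Sigma> x) (vert \<Sigma> y) (vert \<Sigma> w) = gp w x y"
  by (simp add: gprod_at_def gp_def)

lemma gprod_vert: "gprod \<Sigma> (vert \<Sigma> x) (vert \<Sigma> y) = gp 0 x y"
  by (simp add: gprod_def gp_def)

lemma gp_hyp: "gp w x y \<ge> min (gp w x z) (gp w z y) - \<delta>"
  using hyperbolic vert_in unfolding delta_hyperbolic_def
  by (metis gprod_at_vert)

lemma delta_nonneg: "0 \<le> \<delta>"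
  using gp_hyp[of 0 0 0 0] by (simp add: gp_def)

text \<open>By hyperbolicity \<open>gp q p t\<close> is at least the minimum of
  \<open>gp q p z\<close> and \<open>gp q t z\<close>, up to \<open>\<delta>\<close>; the second is
  too large to be that minimum, so the first is bounded.\<close>

lemma gp_propagate:
  assumes "gp q p t \<le> C" and "gp q t z > C + \<delta>"
  shows "gp q p z \<le> C + \<delta>"
  using gp_hyp[where w=q and x=p and y=t and z=z] assms by (simp add: gp_commute min_def split: if_splits)

end

section \<open>A union bound over past and future\<close>

lemma prob_bind_pmf_le:
  assumes "\<And>x. x \<in> set_pmf M \<Longrightarrow> measure_pmf.prob (f x) X \<le> c * indicator Y x" and "0 \<le> c"
  shows "measure_pmf.prob (bind_pmf M f) X \<le> c * measure_pmf.prob M Y"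
proof -
  have "emeasure (measure_pmf (bind_pmf M f)) X = (\<integral>\<^sup>+x. emeasure (measure_pmf (f x)) X \<partial>measure_pmf M)"
    by (rule emeasure_bind_pmf)
  also have "\<dots> \<le> (\<integral>\<^sup>+x. ennreal c * indicator Y x \<partial>measure_pmf M)"
  proof (rule nn_integral_mono_AE, rule AE_pmfI)
    fix x assume "x \<in> set_pmf M"
    from assms(1)[OF this] show "emeasure (measure_pmf (f x)) X \<le> ennreal c * indicator Y x"
      by (cases "x \<in> Y")
        (auto simp: measure_pmf.emeasure_eq_measure intro: ennreal_leI order_antisym measure_nonneg)
  qed
  also have "\<dots> = ennreal c * emeasure (measure_pmf M) Y"
    by (simp add: nn_integral_cmult_indicator)
  also have "\<dots> = ennreal (c * measure_pmf.prob M Y)"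
    using assms(2) by (simp add: measure_pmf.emeasure_eq_measure ennreal_mult)
  finally show ?thesis
    using assms(2) by (simp add: measure_pmf.emeasure_eq_measure)
qed

text \<open>Exposes the last coordinate given all earlier ones; \<open>replicate_pmf_Cons\<close>
  exposes the first given all later ones. These are the two conditionings for events that depend on
  the past and on the future.\<close>

lemma replicate_pmf_snoc:
  "replicate_pmf (Suc n) p = bind_pmf (replicate_pmf n p) (\<lambda>xs. map_pmf (\<lambda>x. xs @ [x]) p)"
  using replicate_pmf_distrib[of n 1 p]
  by (simp add: replicate_pmf_1 map_pmf_def bind_assoc_pmf bind_return_pmf)

lemma replicate_pmf_Cons:
  "replicate_pmf (Suc n) p = bind_pmf (replicate_pmf n p) (\<lambda>xs. map_pmf (\<lambda>x. x # xs) p)"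
  by (simp add: map_pmf_def) (rule bind_commute_pmf)

lemma length_replicate_pmf: "xs \<in> set_pmf (replicate_pmf n p) \<Longrightarrow> length xs = n"
  by (simp add: set_replicate_pmf)

text \<open>The events need not be independent, but each has probability at most \<open>q\<close>
  conditionally on the coordinates before it, so exposing the coordinates from left to right
  multiplies the bounds.\<close>

lemma prob_replicate_prefix:
  assumes A: "\<And>m ys. measure_pmf.prob p {x. A m ys x} \<le> q" and "T \<subseteq> {..<n}"
  shows "measure_pmf.prob (replicate_pmf n p) {xs. \<forall>m\<in>T. A m (take m xs) (xs ! m)} \<le> q ^ card T"
  using assms(2)
proof (induction n arbitrary: T)
  case 0
  then show ?case by simp
next
  case (Suc n)
  have q: "0 \<le> q" by (rule order_trans[OF measure_nonneg A[of 0 "[]"]])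
  have fin: "finite T" using Suc.prems finite_subset by blast
  define T' where "T' = T - {n}"
  have T': "T' \<subseteq> {..<n}" using Suc.prems by (auto simp: T'_def)
  define c where "c = (if n \<in> T then q else 1)"
  have "measure_pmf.prob (replicate_pmf (Suc n) p) {xs. \<forall>m\<in>T. A m (take m xs) (xs ! m)}
    \<le> c * measure_pmf.prob (replicate_pmf n p) {xs. \<forall>m\<in>T'. A m (take m xs) (xs ! m)}"
    unfolding replicate_pmf_snoc
  proof (rule prob_bind_pmf_le)
    fix xs assume "xs \<in> set_pmf (replicate_pmf n p)"
    then have len: "length xs = n" by (rule length_replicate_pmf)
    have *: "A m (take m (xs @ [x])) ((xs @ [x]) ! m) = A m (take m xs) (xs ! m)" if "m \<in> T'" for m x
      using that T' len by (auto simp: nth_append)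
    show "measure_pmf.prob (map_pmf (\<lambda>x. xs @ [x]) p) {xs. \<forall>m\<in>T. A m (take m xs) (xs ! m)}
      \<le> c * indicator {xs. \<forall>m\<in>T'. A m (take m xs) (xs ! m)} xs"
    proof (cases "\<forall>m\<in>T'. A m (take m xs) (xs ! m)")
      case False
      then have v: "(\<lambda>x. xs @ [x]) -` {xs. \<forall>m\<in>T. A m (take m xs) (xs ! m)} = {}"
        using * by (auto simp: T'_def)
      show ?thesis unfolding measure_map_pmf v using q by (simp add: c_def)
    next
      case True
      have "measure_pmf.prob p ((\<lambda>x. xs @ [x]) -` {xs. \<forall>m\<in>T. A m (take m xs) (xs ! m)}) \<le> c"
      proof (cases "n \<in> T")
        case True
        have "measure_pmf.prob p ((\<lambda>x. xs @ [x]) -` {xs. \<forall>m\<in>T. A m (take m xs) (xs ! m)})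
          \<le> measure_pmf.prob p {x. A n xs x}"
          by (rule measure_pmf.finite_measure_mono) (use True len in \<open>auto simp: nth_append\<close>)
        then show ?thesis using True A[of n xs] by (simp add: c_def)
      qed (simp add: c_def)
      then show ?thesis unfolding measure_map_pmf using True by simp
    qed
  qed (use q in \<open>simp add: c_def\<close>)
  also have "\<dots> \<le> c * q ^ card T'"
    using Suc.IH[OF T'] q by (intro mult_left_mono) (simp_all add: c_def)
  also have "\<dots> = q ^ card T"
  proof (cases "n \<in> T")
    case True
    then have "card T = Suc (card T')" unfolding T'_def by (rule card.remove[OF fin])
    then show ?thesis using True by (simp add: c_def)
  qed (simp add: c_def T'_def)
  finally show ?case .
qed

text \<open>The mirror image: coordinates are exposed from right to left. Removing the first
  coordinate shifts all indices by one, so \<open>T\<close> and the family \<open>B\<close> both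
  vary in the induction.\<close>

lemma prob_replicate_suffix:
  assumes B: "\<And>m ys. measure_pmf.prob p {x. B m ys x} \<le> q" and "T \<subseteq> {..<n}"
  shows "measure_pmf.prob (replicate_pmf n p) {xs. \<forall>m\<in>T. B m (drop (Suc m) xs) (xs ! m)} \<le> q ^ card T"
  using assms
proof (induction n arbitrary: T B)
  case 0
  then show ?case by simp
next
  case (Suc n)
  have q: "0 \<le> q" by (rule order_trans[OF measure_nonneg Suc.prems(1)[of 0 "[]"]])
  have fin: "finite T" using Suc.prems finite_subset by blast
  define T' where "T' = {m. Suc m \<in> T}"
  have T': "T' \<subseteq> {..<n}" using Suc.prems by (auto simp: T'_def)
  have T: "T - {0} = Suc ` T'"
  proof (rule set_eqI)
    show "m \<in> T - {0} \<longleftrightarrow> m \<in> Suc ` T'" for m by (cases m) (auto simp: T'_def)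
  qed
  define B' where "B' = (\<lambda>m. B (Suc m))"
  define c where "c = (if 0 \<in> T then q else 1)"
  have "measure_pmf.prob (replicate_pmf (Suc n) p) {xs. \<forall>m\<in>T. B m (drop (Suc m) xs) (xs ! m)}
    \<le> c * measure_pmf.prob (replicate_pmf n p) {xs. \<forall>m\<in>T'. B' m (drop (Suc m) xs) (xs ! m)}"
    unfolding replicate_pmf_Cons
  proof (rule prob_bind_pmf_le)
    fix xs assume "xs \<in> set_pmf (replicate_pmf n p)"
    have *: "(\<forall>m\<in>T. B m (drop (Suc m) (x # xs)) ((x # xs) ! m)) \<longleftrightarrow>
       (0 \<in> T \<longrightarrow> B 0 xs x) \<and> (\<forall>m\<in>T'. B' m (drop (Suc m) xs) (xs ! m))" (is "?L \<longleftrightarrow> ?R") for x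
    proof
      assume L: ?L
      have "B' m (drop (Suc m) xs) (xs ! m)" if "m \<in> T'" for m
        using that bspec[OF L, of "Suc m"] by (simp add: T'_def B'_def)
      moreover have "B 0 xs x" if "0 \<in> T" using bspec[OF L that] by simp
      ultimately show ?R by blast
    next
      assume R: ?R
      show ?L
      proof
        fix m assume "m \<in> T"
        then show "B m (drop (Suc m) (x # xs)) ((x # xs) ! m)"
          using R by (cases m) (simp_all add: T'_def B'_def)
      qed
    qed
    show "measure_pmf.prob (map_pmf (\<lambda>x. x # xs) p) {xs. \<forall>m\<in>T. B m (drop (Suc m) xs) (xs ! m)}
      \<le> c * indicator {xs. \<forall>m\<in>T'. B' m (drop (Suc m) xs) (xs ! m)} xs"
    proof (cases "\<forall>m\<in>T'. B' m (drop (Suc m) xs) (xs ! m)")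
      case False
      then have v: "(\<lambda>x. x # xs) -` {xs. \<forall>m\<in>T. B m (drop (Suc m) xs) (xs ! m)} = {}"
        using * by auto
      show ?thesis unfolding measure_map_pmf v using q by (simp add: c_def)
    next
      case True
      then have v: "(\<lambda>x. x # xs) -` {xs. \<forall>m\<in>T. B m (drop (Suc m) xs) (xs ! m)} = {x. 0 \<in> T \<longrightarrow> B 0 xs x}"
        using * by auto
      show ?thesis unfolding measure_map_pmf v using True Suc.prems(1)[of 0 xs] by (auto simp: c_def)
    qed
  qed (use q in \<open>simp add: c_def\<close>)
  also have "\<dots> \<le> c * q ^ card T'"
    using T' q by (intro mult_left_mono Suc.IH) (simp_all add: c_def B'_def Suc.prems(1))
  also have "card T' = card (T - {0})" unfolding T by (simp add: card_image)
  also have "c * q ^ card (T - {0}) = q ^ card T"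
  proof (cases "0 \<in> T")
    case True
    then have "card T = Suc (card (T - {0}))" by (rule card.remove[OF fin])
    then show ?thesis using True unfolding c_def by (metis power_Suc)
  qed (simp add: c_def)
  finally show ?case .
qed

text \<open>Each index is blocked by the past or by the future; for a fixed assignment of reasons, only
one of the two families of events is used, namely the larger one.\<close>

lemma prob_prefix_or_suffix:
  assumes A: "\<And>m ys. measure_pmf.prob p {x. A m ys x} \<le> 1/49"
    and B: "\<And>m ys. measure_pmf.prob p {x. B m ys x} \<le> 1/49"
    and I: "I \<subseteq> {..<n}"
  shows "measure_pmf.prob (replicate_pmf n p)
    {xs. \<forall>m\<in>I. A m (take m xs) (xs ! m) \<or> B m (drop (Suc m) xs) (xs ! m)} \<le> (2/7) ^ card I"
proof -
  let ?M = "measure_pmf (replicate_pmf n p)"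
  let ?E = "\<lambda>T. {xs. (\<forall>m\<in>T. A m (take m xs) (xs ! m)) \<and> (\<forall>m\<in>I-T. B m (drop (Suc m) xs) (xs ! m))}"
  have fin: "finite I" using I finite_subset by blast
  have E: "measure ?M (?E T) \<le> (1/7) ^ card I" if "T \<subseteq> I" for T
  proof -
    \<comment> \<open>The larger family covers at least half of \<open>I\<close>, which leaves the
      square root 1/7 of the bound per index. With two possible reasons per index the total rate is
      2/7 < 1; this is the purpose of 1/49.\<close>
    have pow: "(1/49 :: real) ^ k \<le> (1/7) ^ card I" if "card I \<le> 2 * k" for k
    proof -
      have "(1/49 :: real) ^ k = (1/7) ^ (2 * k)" by (simp add: power_mult power2_eq_square)
      also have "\<dots> \<le> (1/7) ^ card I" using that by (intro power_decreasing) auto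
      finally show ?thesis .
    qed
    have card: "card I = card T + card (I - T)"
      using that fin card_mono[OF fin that] by (simp add: card_Diff_subset finite_subset[OF that fin])
    have "measure ?M (?E T) \<le> measure ?M {xs. \<forall>m\<in>T. A m (take m xs) (xs ! m)}"
      by (rule measure_pmf.finite_measure_mono) auto
    also have "\<dots> \<le> (1/49) ^ card T"
      using that I by (intro prob_replicate_prefix[where A=A and q="1/49"] A) auto
    finally have 1: "measure ?M (?E T) \<le> (1/49) ^ card T" .
    have "measure ?M (?E T) \<le> measure ?M {xs. \<forall>m\<in>I-T. B m (drop (Suc m) xs) (xs ! m)}"
      by (rule measure_pmf.finite_measure_mono) auto
    also have "\<dots> \<le> (1/49) ^ card (I-T)"
      using that I by (intro prob_replicate_suffix[where B=B and q="1/49"] B) auto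
    finally have 2: "measure ?M (?E T) \<le> (1/49) ^ card (I-T)" .
    show ?thesis
    proof (cases "card I \<le> 2 * card T")
      case True then show ?thesis using 1 pow[of "card T"] by linarith
    next
      case False
      then have "card I \<le> 2 * card (I-T)" using card by linarith
      then show ?thesis using 2 pow[of "card (I-T)"] by linarith
    qed
  qed
  have "measure ?M {xs. \<forall>m\<in>I. A m (take m xs) (xs ! m) \<or> B m (drop (Suc m) xs) (xs ! m)}
      \<le> measure ?M (\<Union>T\<in>Pow I. ?E T)"
  proof (rule measure_pmf.finite_measure_mono)
    show "{xs. \<forall>m\<in>I. A m (take m xs) (xs ! m) \<or> B m (drop (Suc m) xs) (xs ! m)} \<subseteq> (\<Union>T\<in>Pow I. ?E T)"
    proof
      fix xs assume "xs \<in> {xs. \<forall>m\<in>I. A m (take m xs) (xs ! m) \<or> B m (drop (Suc m) xs) (xs ! m)}"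
      then have "xs \<in> ?E {m\<in>I. A m (take m xs) (xs ! m)}" by auto
      then show "xs \<in> (\<Union>T\<in>Pow I. ?E T)" by (rule UN_I[rotated]) auto
    qed
  qed simp
  also have "\<dots> \<le> (\<Sum>T\<in>Pow I. measure ?M (?E T))"
    using fin by (intro measure_pmf.finite_measure_subadditive_finite) auto
  also have "\<dots> \<le> (\<Sum>T\<in>Pow I. (1/7) ^ card I)"
    by (intro sum_mono E) auto
  also have "\<dots> = (2/7) ^ card I"
    using fin by (simp add: card_Pow power_mult_distrib[symmetric])
  finally show ?thesis .
qed

section \<open>Pivots of random products of Schottky elements\<close>

text \<open>The Schottky conditions taken at vertices, with the base point as second point; 99/100
  stands for \<open>1 - \<epsilon>\<close>, and \<open>len_S\<close> for the lower bound on
  \<open>D\<close>.\<close>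

locale schottky_group = hyperbolic_group +
  fixes S :: "'a set" and C :: real
  assumes finite_S: "finite S" and S_nonempty: "S \<noteq> {}" and C_nonneg: "0 \<le> C"
    and len_S: "s \<in> S \<Longrightarrow> 100 * C + 100 * \<delta> + 1 \<le> real (len s)"
    and schottky_left: "99/100 * real (card S) \<le> real (card {s\<in>S. gp 0 x s \<le> C})"
    and schottky_right: "99/100 * real (card S) \<le> real (card {s\<in>S. gp 0 x (- s) \<le> C})"

text \<open>A triple consists of a \<open>\<kappa>\<close>-increment followed by two Schottky
  elements. Keeping the triple instead of its product retains the intermediate positions
  \<open>pre\<close> and \<open>mid\<close>: the first Schottky element leads from
  \<open>pre\<close> to \<open>mid\<close>, the second from \<open>mid\<close> to the next
  \<open>pos\<close>.\<close>

definition step :: "'g::group_add \<times> 'g \<times> 'g \<Rightarrow> 'g" where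
  "step x = fst x + (fst (snd x) + snd (snd x))"

definition pos :: "('g::group_add \<times> 'g \<times> 'g) list \<Rightarrow> nat \<Rightarrow> 'g" where
  "pos xs n = sum_list (map step (take n xs))"

definition pre :: "('g::group_add \<times> 'g \<times> 'g) list \<Rightarrow> nat \<Rightarrow> 'g" where
  "pre xs n = pos xs n + fst (xs ! n)"

definition mid :: "('g::group_add \<times> 'g \<times> 'g) list \<Rightarrow> nat \<Rightarrow> 'g" where
  "mid xs n = pre xs n + fst (snd (xs ! n))"

lemma pos_Suc: "n < length xs \<Longrightarrow> pos xs (Suc n) = mid xs n + snd (snd (xs ! n))"
  by (simp add: pos_def mid_def pre_def step_def take_Suc_conv_app_nth add.assoc)

lemma pos_take: "n \<le> m \<Longrightarrow> pos (take m xs) n = pos xs n"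
  by (simp add: pos_def min_def)

lemma pre_take: "n < m \<Longrightarrow> pre (take m xs) n = pre xs n"
  by (simp add: pre_def pos_take)

lemma mid_take: "n < m \<Longrightarrow> mid (take m xs) n = mid xs n"
  by (simp add: mid_def pre_take)

lemma pos_drop: "m \<le> n \<Longrightarrow> pos xs n = pos xs m + pos (drop m xs) (n - m)"
proof -
  assume "m \<le> n"
  then have "take n xs = take m xs @ take (n - m) (drop m xs)"
    by (metis le_add_diff_inverse take_add)
  then show ?thesis by (simp add: pos_def)
qed

context hyperbolic_group
begin

text \<open>Seen from \<open>mid\<close> the target points back to \<open>pre\<close>, or seen from
  the end of the step it points back to \<open>mid\<close>. Absence of the second keeps the target
  far from \<open>mid\<close>; absence of the first lets a bound pass through \<open>mid\<close> to
  another target.\<close>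

definition killed :: "real \<Rightarrow> ('g \<times> 'g \<times> 'g) list \<Rightarrow> nat \<Rightarrow> 'g \<Rightarrow> bool" where
  "killed C xs m z \<longleftrightarrow> C < gp (mid xs m) (pre xs m) z \<or> C < gp (pos xs (Suc m)) (mid xs m) z"

text \<open>The last pivot usable for the target \<open>z\<close>, and otherwise the root
  \<open>y\<close>, which plays the role of the second point in the Gromov product to be
  bounded.\<close>

definition anchor :: "real \<Rightarrow> 'g \<Rightarrow> ('g \<times> 'g \<times> 'g) list \<Rightarrow> nat set \<Rightarrow> 'g \<Rightarrow> 'g" where
  "anchor C y xs A z = (let B = {m\<in>A. \<not> killed C xs m z} in if B = {} then y else mid xs (Max B))"

text \<open>Unlike in Gouezel's construction, pivots are never removed: a pivot that is killed for the current
target is ignored, and it may be usable again for a later one.\<close>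

primrec pivots :: "real \<Rightarrow> 'g \<Rightarrow> ('g \<times> 'g \<times> 'g) list \<Rightarrow> nat \<Rightarrow> nat set" where
  "pivots C y xs 0 = {}"
| "pivots C y xs (Suc n) = (if gp (pre xs n) (anchor C y xs (pivots C y xs n) (pre xs n)) (mid xs n) \<le> C
     then insert n (pivots C y xs n) else pivots C y xs n)"

definition live :: "real \<Rightarrow> 'g \<Rightarrow> ('g \<times> 'g \<times> 'g) list \<Rightarrow> nat \<Rightarrow> 'g \<Rightarrow> nat set" where
  "live C y xs n z = {m \<in> pivots C y xs n. \<not> killed C xs m z}"

lemma pivots_iff: "m \<in> pivots C y xs n \<longleftrightarrow>
  m < n \<and> gp (pre xs m) (anchor C y xs (pivots C y xs m) (pre xs m)) (mid xs m) \<le> C"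
  by (induction n) (auto simp: less_Suc_eq)

lemma pivots_less: "pivots C y xs n \<subseteq> {..<n}"
  by (auto simp: pivots_iff)

lemma finite_live: "finite (live C y xs n z)"
  using finite_subset[OF pivots_less] by (simp add: live_def)

lemma anchor_live: "anchor C y xs (pivots C y xs n) z =
    (if live C y xs n z = {} then y else mid xs (Max (live C y xs n z)))"
  unfolding anchor_def live_def Let_def ..

lemma killed_take: "i < m \<Longrightarrow> killed C (take m xs) i z = killed C xs i z"
  by (simp add: killed_def mid_take pre_take pos_take)

lemma anchor_take:
  assumes "A \<subseteq> {..<m}"
  shows "anchor C y (take m xs) A z = anchor C y xs A z"
proof -
  have B: "{i\<in>A. \<not> killed C (take m xs) i z} = {i\<in>A. \<not> killed C xs i z}"
    using assms by (auto simp: killed_take)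
  have "mid (take m xs) (Max {i\<in>A. \<not> killed C xs i z}) = mid xs (Max {i\<in>A. \<not> killed C xs i z})"
    if "{i\<in>A. \<not> killed C xs i z} \<noteq> {}"
  proof -
    have "finite A" using assms finite_subset by blast
    then have "finite {i\<in>A. \<not> killed C xs i z}" by simp
    then have "Max {i\<in>A. \<not> killed C xs i z} \<in> A" using Max_in that by blast
    then show ?thesis using assms by (intro mid_take) auto
  qed
  then show ?thesis unfolding anchor_def B Let_def by (intro if_cong refl) blast
qed

text \<open>Being a pivot depends only on the past. This puts the event of not being a pivot into
  the form required by \<open>prob_replicate_prefix\<close>.\<close>

lemma pivots_take: "n \<le> m \<Longrightarrow> pivots C y (take m xs) n = pivots C y xs n"
proof (induction n)
  case (Suc n)
  then have "pivots C y xs n \<subseteq> {..<m}" using pivots_less[of C y xs n] by auto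
  then show ?case using Suc by (simp add: pre_take mid_take anchor_take)
qed simp

end

context schottky_group
begin

section \<open>The probability that a window contains no usable pivot\<close>

definition triple_pmf :: "'a pmf \<Rightarrow> ('a \<times> 'a \<times> 'a) pmf" where
  "triple_pmf \<kappa> = pair_pmf \<kappa> (pair_pmf (pmf_of_set S) (pmf_of_set S))"

lemma prob_not_le:
  assumes "99/100 * real (card S) \<le> real (card {s\<in>S. P s})"
  shows "measure_pmf.prob (pmf_of_set S) {s. \<not> P s} \<le> 1/100"
proof -
  have "S \<inter> {s. \<not> P s} = S - {s\<in>S. P s}" by auto
  moreover have "card (S - {s\<in>S. P s}) = card S - card {s\<in>S. P s}"
    using finite_S by (intro card_Diff_subset) auto
  moreover have "card {s\<in>S. P s} \<le> card S" using finite_S by (intro card_mono) auto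
  moreover have "0 < card S" using finite_S S_nonempty by (simp add: card_gt_0_iff)
  ultimately show ?thesis
    using assms finite_S S_nonempty by (simp add: measure_pmf_of_set divide_simps)
qed

lemma prob_left: "measure_pmf.prob (pmf_of_set S) {s. C < gp 0 x s} \<le> 1/100"
  using prob_not_le[OF schottky_left] by (simp add: not_le)

lemma prob_right: "measure_pmf.prob (pmf_of_set S) {s. C < gp 0 x (- s)} \<le> 1/100"
  using prob_not_le[OF schottky_right] by (simp add: not_le)

lemma prob_right': "measure_pmf.prob (pmf_of_set S) {s. C < gp 0 (- s) x} \<le> 1/100"
  using prob_right by (simp add: gp_commute)

text \<open>Here the middle letter is sampled last, so that it is uniform on \<open>S\<close> given
  the other two; \<open>triple_pmf_alt'\<close> does the same for the last letter.\<close>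

lemma triple_pmf_alt: "triple_pmf \<kappa> = bind_pmf \<kappa> (\<lambda>k. bind_pmf (pmf_of_set S) (\<lambda>b.
    map_pmf (\<lambda>a. (k, a, b)) (pmf_of_set S)))"
proof -
  have "triple_pmf \<kappa> = bind_pmf \<kappa> (\<lambda>k. bind_pmf (pmf_of_set S) (\<lambda>a. bind_pmf (pmf_of_set S) (\<lambda>b. return_pmf (k, a, b))))"
    by (simp add: triple_pmf_def pair_pmf_def bind_assoc_pmf bind_return_pmf)
  also have "\<dots> = bind_pmf \<kappa> (\<lambda>k. bind_pmf (pmf_of_set S) (\<lambda>b. bind_pmf (pmf_of_set S) (\<lambda>a. return_pmf (k, a, b))))"
    by (subst bind_commute_pmf) simp
  finally show ?thesis by (simp add: map_pmf_def)
qed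

lemma triple_pmf_alt': "triple_pmf \<kappa> = bind_pmf \<kappa> (\<lambda>k. bind_pmf (pmf_of_set S) (\<lambda>a.
    map_pmf (\<lambda>b. (k, a, b)) (pmf_of_set S)))"
  by (simp add: triple_pmf_def pair_pmf_def bind_assoc_pmf bind_return_pmf map_pmf_def)

lemma prob_triple_mid:
  assumes "\<And>k b. measure_pmf.prob (pmf_of_set S) {a. (k, a, b) \<in> E} \<le> q" "0 \<le> q"
  shows "measure_pmf.prob (triple_pmf \<kappa>) E \<le> q"
proof -
  have "measure_pmf.prob (triple_pmf \<kappa>) E \<le> q * measure_pmf.prob \<kappa> UNIV"
    unfolding triple_pmf_alt
  proof (rule prob_bind_pmf_le)
    fix k
    have "measure_pmf.prob (bind_pmf (pmf_of_set S) (\<lambda>b. map_pmf (\<lambda>a. (k, a, b)) (pmf_of_set S))) E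
      \<le> q * measure_pmf.prob (pmf_of_set S) UNIV"
      by (rule prob_bind_pmf_le) (use assms in \<open>simp_all add: vimage_def\<close>)
    then show "measure_pmf.prob (bind_pmf (pmf_of_set S) (\<lambda>b. map_pmf (\<lambda>a. (k, a, b)) (pmf_of_set S))) E
      \<le> q * indicator UNIV k" by simp
  qed fact
  then show ?thesis by simp
qed

lemma prob_triple_last:
  assumes "\<And>k a. measure_pmf.prob (pmf_of_set S) {b. (k, a, b) \<in> E} \<le> q" "0 \<le> q"
  shows "measure_pmf.prob (triple_pmf \<kappa>) E \<le> q"
proof -
  have "measure_pmf.prob (triple_pmf \<kappa>) E \<le> q * measure_pmf.prob \<kappa> UNIV"
    unfolding triple_pmf_alt'
  proof (rule prob_bind_pmf_le)
    fix k
    have "measure_pmf.prob (bind_pmf (pmf_of_set S) (\<lambda>a. map_pmf (\<lambda>b. (k, a, b)) (pmf_of_set S))) E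
      \<le> q * measure_pmf.prob (pmf_of_set S) UNIV"
      by (rule prob_bind_pmf_le) (use assms in \<open>simp_all add: vimage_def\<close>)
    then show "measure_pmf.prob (bind_pmf (pmf_of_set S) (\<lambda>a. map_pmf (\<lambda>b. (k, a, b)) (pmf_of_set S))) E
      \<le> q * indicator UNIV k" by simp
  qed fact
  then show ?thesis by simp
qed

lemma set_triple_pmf: "(k, a, b) \<in> set_pmf (triple_pmf \<kappa>) \<Longrightarrow> a \<in> S \<and> b \<in> S"
  using finite_S S_nonempty by (simp add: triple_pmf_def)

lemma set_replicate_triple:
  assumes "xs \<in> set_pmf (replicate_pmf n (triple_pmf \<kappa>))" "m < n"
  shows "fst (snd (xs ! m)) \<in> S" "snd (snd (xs ! m)) \<in> S"
proof -
  have "xs ! m \<in> set_pmf (triple_pmf \<kappa>)" using assms by (auto simp: set_replicate_pmf)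
  then show "fst (snd (xs ! m)) \<in> S" "snd (snd (xs ! m)) \<in> S"
    using set_triple_pmf by (metis prod.collapse)+
qed

text \<open>A non-pivot has an increment pointing back at its anchor, an event of small probability given
the past; a killed pivot has an increment opposite to the direction of the target, an event of
small probability given the future.\<close>

lemma prob_no_live:
  assumes target: "\<And>m xs. m < j \<Longrightarrow> length xs = N \<Longrightarrow> z xs = pos xs (Suc m) + \<phi> m (drop (Suc m) xs)"
    and "j \<le> N" and "l \<le> j"
  shows "measure_pmf.prob (replicate_pmf N (triple_pmf \<kappa>))
    {xs. \<forall>m\<in>{j-l..<j}. m \<notin> live C y xs j (z xs)} \<le> (2/7) ^ l"
proof -
  \<comment> \<open>\<open>u\<close> is \<open>pre\<close> computed from the past, and
    \<open>A\<close> says that \<open>m\<close> fails the pivot condition. The target is reached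
    from \<open>pos xs (Suc m)\<close> by a displacement \<open>\<phi>\<close> that depends only on
    later triples, so that \<open>B\<close>, which says that \<open>m\<close> is killed, is an event
    for the future.\<close>
  define u where "u = (\<lambda>m ys (x :: 'a \<times> 'a \<times> 'a). pos ys m + fst x)"
  define A where "A = (\<lambda>m ys (x :: 'a \<times> 'a \<times> 'a).
    C < gp (u m ys x) (anchor C y ys (pivots C y ys m) (u m ys x)) (u m ys x + fst (snd x)))"
  define B where "B = (\<lambda>m ys (x :: 'a \<times> 'a \<times> 'a).
    C < gp 0 (- fst (snd x)) (snd (snd x) + \<phi> m ys) \<or> C < gp 0 (- snd (snd x)) (\<phi> m ys))"
  have A: "measure_pmf.prob (triple_pmf \<kappa>) {x. A m ys x} \<le> 1/49" for m ys
  proof -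
    have "measure_pmf.prob (triple_pmf \<kappa>) {x. A m ys x} \<le> 1/100"
    proof (rule prob_triple_mid)
      fix k b :: 'a
      let ?v = "pos ys m + k"
      have "gp ?v (anchor C y ys (pivots C y ys m) ?v) (?v + a) =
          gp 0 (- ?v + anchor C y ys (pivots C y ys m) ?v) a" for a
        by (subst gp_translate) simp
      then show "measure_pmf.prob (pmf_of_set S) {a. (k, a, b) \<in> {x. A m ys x}} \<le> 1/100"
        using prob_left by (simp add: A_def u_def)
    qed simp
    then show ?thesis by simp
  qed
  \<comment> \<open>The first alternative is small because of the first Schottky letter, given the
    second one and the future; the other because of the second letter, given the future. Together
    1/100 + 1/100 is at most 1/49.\<close>
  have B: "measure_pmf.prob (triple_pmf \<kappa>) {x. B m ys x} \<le> 1/49" for m ys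
  proof -
    let ?B1 = "{x. C < gp 0 (- fst (snd x)) (snd (snd x) + \<phi> m ys)}"
    let ?B2 = "{x. C < gp 0 (- snd (snd x)) (\<phi> m ys)}"
    have "measure_pmf.prob (triple_pmf \<kappa>) ?B1 \<le> 1/100"
      by (rule prob_triple_mid) (use prob_right' in simp_all)
    moreover have "measure_pmf.prob (triple_pmf \<kappa>) ?B2 \<le> 1/100"
      by (rule prob_triple_last) (use prob_right' in simp_all)
    moreover have "measure_pmf.prob (triple_pmf \<kappa>) {x. B m ys x}
      \<le> measure_pmf.prob (triple_pmf \<kappa>) ?B1 + measure_pmf.prob (triple_pmf \<kappa>) ?B2"
    proof -
      have "{x. B m ys x} = ?B1 \<union> ?B2" by (auto simp: B_def)
      then show ?thesis by (simp add: measure_Un_le)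
    qed
    ultimately show ?thesis by linarith
  qed
  have "measure_pmf.prob (replicate_pmf N (triple_pmf \<kappa>))
      {xs. \<forall>m\<in>{j-l..<j}. m \<notin> live C y xs j (z xs)}
    \<le> measure_pmf.prob (replicate_pmf N (triple_pmf \<kappa>))
      {xs. \<forall>m\<in>{j-l..<j}. A m (take m xs) (xs ! m) \<or> B m (drop (Suc m) xs) (xs ! m)}"
  proof (rule measure_pmf.finite_measure_mono_AE, rule AE_pmfI)
    fix xs assume "xs \<in> set_pmf (replicate_pmf N (triple_pmf \<kappa>))"
    then have len: "length xs = N" by (rule length_replicate_pmf)
    have "A m (take m xs) (xs ! m) \<or> B m (drop (Suc m) xs) (xs ! m)"
      if m: "m < j" and notin: "m \<notin> live C y xs j (z xs)" for m
    proof (cases "m \<in> pivots C y xs j")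
      case False
      have "u m (take m xs) (xs ! m) = pre xs m" by (simp add: u_def pre_def pos_take)
      moreover have "anchor C y (take m xs) (pivots C y (take m xs) m) v = anchor C y xs (pivots C y xs m) v" for v
        using anchor_take[OF pivots_less] pivots_take[of m m] by simp
      ultimately have "A m (take m xs) (xs ! m)"
        using False m by (simp add: A_def pivots_iff mid_def not_le)
      then show ?thesis ..
    next
      case True
      then have "killed C xs m (z xs)" using notin by (simp add: live_def)
      moreover have mid: "pos xs (Suc m) = mid xs m + snd (snd (xs ! m))"
        using m \<open>j \<le> N\<close> len by (intro pos_Suc) simp
      have pre: "pre xs m = mid xs m + - fst (snd (xs ! m))" by (simp add: mid_def)
      let ?h = "\<phi> m (drop (Suc m) xs)"
      have z: "z xs = pos xs (Suc m) + ?h" using target m len by simp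
      have "gp (mid xs m) (pre xs m) (z xs) = gp 0 (- fst (snd (xs ! m))) (snd (snd (xs ! m)) + ?h)"
        using gp_left[of "mid xs m" 0 "- fst (snd (xs ! m))" "snd (snd (xs ! m)) + ?h"]
        by (simp add: z mid pre add.assoc)
      moreover have "gp (pos xs (Suc m)) (mid xs m) (z xs) = gp 0 (- snd (snd (xs ! m))) ?h"
        using gp_left[of "pos xs (Suc m)" 0 "- snd (snd (xs ! m))" ?h]
        by (simp add: z mid)
      ultimately show ?thesis by (simp add: killed_def B_def)
    qed
    then show "xs \<in> {xs. \<forall>m\<in>{j-l..<j}. m \<notin> live C y xs j (z xs)} \<longrightarrow>
      xs \<in> {xs. \<forall>m\<in>{j-l..<j}. A m (take m xs) (xs ! m) \<or> B m (drop (Suc m) xs) (xs ! m)}" by auto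
  qed simp
  also have "\<dots> \<le> (2/7) ^ card {j-l..<j}"
    using \<open>j \<le> N\<close> by (intro prob_prefix_or_suffix A B) auto
  finally show ?thesis using \<open>l \<le> j\<close> by simp
qed

lemma prob_no_live_pos:
  assumes "j \<le> N" and "l \<le> j"
  shows "measure_pmf.prob (replicate_pmf N (triple_pmf \<kappa>))
    {xs. \<forall>m\<in>{j-l..<j}. m \<notin> live C y xs j (pos xs j)} \<le> (2/7) ^ l"
  by (rule prob_no_live[where \<phi>="\<lambda>m ys. pos ys (j - Suc m)"]) (use assms in \<open>simp_all add: pos_drop[of "Suc _" j]\<close>)

lemma prob_no_live_pre:
  assumes "j < N" and "l \<le> j"
  shows "measure_pmf.prob (replicate_pmf N (triple_pmf \<kappa>))
    {xs. \<forall>m\<in>{j-l..<j}. m \<notin> live C y xs j (pre xs j)} \<le> (2/7) ^ l"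
\<comment> \<open>After the first \<open>Suc m\<close> entries are dropped, time \<open>j\<close>
  has index \<open>j - Suc m\<close>. The target also contains the first letter of the triple at
  \<open>j\<close>, hence the strict bound \<open>j < N\<close>.\<close>
proof (rule prob_no_live[where \<phi>="\<lambda>m ys. pos ys (j - Suc m) + fst (ys ! (j - Suc m))"])
  fix m and xs :: "('a \<times> 'a \<times> 'a) list"
  assume "m < j" "length xs = N"
  moreover from this have "fst (drop (Suc m) xs ! (j - Suc m)) = fst (xs ! j)" using \<open>j < N\<close> by simp
  ultimately show "pre xs j = pos xs (Suc m) + (pos (drop (Suc m) xs) (j - Suc m) + fst (drop (Suc m) xs ! (j - Suc m)))"
    unfolding pre_def using pos_drop[of "Suc m" j xs] by (metis Suc_leI add.assoc)
qed (use assms in simp_all)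

section \<open>Geometry along chains of anchors\<close>

definition in_S :: "('a \<times> 'a \<times> 'a) list \<Rightarrow> bool" where
  "in_S xs \<longleftrightarrow> (\<forall>m<length xs. fst (snd (xs ! m)) \<in> S \<and> snd (snd (xs ! m)) \<in> S)"

text \<open>The second Schottky segment has length at least
  \<open>100 * C + 100 * \<delta> + 1\<close>, and going on from its end to \<open>z\<close>
  backtracks by at most \<open>C\<close>, which costs \<open>2 * C\<close>.\<close>

lemma live_far:
  assumes "in_S xs" "n \<le> length xs" "m \<in> live C y xs n z"
  shows "98 * C + 100 * \<delta> + 1 \<le> d (mid xs m) z"
proof -
  have m: "m < length xs" and k: "\<not> killed C xs m z" using assms by (auto simp: live_def pivots_iff)
  have "d (mid xs m) (pos xs (Suc m)) = len (snd (snd (xs ! m)))"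
    by (simp add: pos_Suc[OF m] dG_def)
  then have "100 * C + 100 * \<delta> + 1 \<le> d (mid xs m) (pos xs (Suc m))"
    using len_S m assms(1) by (simp add: in_S_def)
  moreover have "gp (pos xs (Suc m)) (mid xs m) z \<le> C" using k by (simp add: killed_def)
  moreover have "0 \<le> d z (pos xs (Suc m))" by simp
  ultimately show ?thesis unfolding gp_def by argo
qed

lemma pivot_far:
  assumes "in_S xs" "m < length xs"
  shows "100 * C + 100 * \<delta> + 1 \<le> d (pre xs m) (mid xs m)"
  using assms len_S by (simp add: in_S_def mid_def dG_def)

text \<open>The target \<open>z\<close> is kept fixed while walking down the chain of anchors from a pivot to the root
\<open>y\<close>, so that the bounds on the Gromov products do not deteriorate along the chain.\<close>

lemma pivot_step:
  assumes S: "in_S xs" "m < length xs" and p: "m \<in> pivots C y xs n"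
    and g: "gp (mid xs m) (pre xs m) z \<le> C + \<delta>"
  shows "live C y xs m (pre xs m) = {} \<Longrightarrow> gp (pre xs m) y z \<le> C + \<delta>"
    and "live C y xs m (pre xs m) = {} \<Longrightarrow> d (mid xs m) z + 1 \<le> d y z + 2 * (C + \<delta>)"
    and "live C y xs m (pre xs m) \<noteq> {} \<Longrightarrow> i = Max (live C y xs m (pre xs m)) \<Longrightarrow>
      i < m \<and> i \<in> pivots C y xs m \<and> gp (mid xs i) (pre xs i) z \<le> C + \<delta> \<and> d (mid xs m) z + 1 \<le> d (mid xs i) z"
proof -
  let ?x = "anchor C y xs (pivots C y xs m) (pre xs m)"
  \<comment> \<open>The product at \<open>mid\<close> is small and the segment from
    \<open>pre\<close> to \<open>mid\<close> is long, so from \<open>pre\<close> the point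
    \<open>z\<close> lies in the direction of \<open>mid\<close>; the pivot condition on the anchor
    therefore passes from \<open>mid\<close> to \<open>z\<close>.\<close>
  have "gp (pre xs m) (mid xs m) z = d (pre xs m) (mid xs m) - gp (mid xs m) (pre xs m) z"
    by (rule gp_swap)
  then have "C + \<delta> < gp (pre xs m) (mid xs m) z"
    using g pivot_far[OF S] C_nonneg delta_nonneg by linarith
  moreover have "gp (pre xs m) ?x (mid xs m) \<le> C" using p by (simp add: pivots_iff)
  ultimately have x: "gp (pre xs m) ?x z \<le> C + \<delta>" using gp_propagate by blast
  \<comment> \<open>One link back moves away from \<open>z\<close>: the length of the Schottky
    segment is gained, minus twice the product at \<open>mid\<close>.\<close>
  have far: "d (mid xs m) z + 98 * C + 98 * \<delta> + 1 \<le> d (pre xs m) z"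
    using g pivot_far[OF S] unfolding gp_def using d_commute[of z "mid xs m"] d_commute[of z "pre xs m"]
    by argo
  {
    assume "live C y xs m (pre xs m) = {}"
    then have y: "?x = y" by (simp add: anchor_live)
    then show "gp (pre xs m) y z \<le> C + \<delta>" using x by simp
    show "d (mid xs m) z + 1 \<le> d y z + 2 * (C + \<delta>)"
      using x[unfolded y] far C_nonneg delta_nonneg d_commute[of z "pre xs m"] d_nonneg[of y "pre xs m"]
      unfolding gp_def by argo
  }
  assume "live C y xs m (pre xs m) \<noteq> {}" and i: "i = Max (live C y xs m (pre xs m))"
  then have li: "i \<in> live C y xs m (pre xs m)" using Max_in[OF finite_live] by blast
  have xi: "?x = mid xs i" using \<open>live C y xs m (pre xs m) \<noteq> {}\<close> i by (simp add: anchor_live)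
  have pi: "i \<in> pivots C y xs m" "i < m" using li by (simp_all add: live_def pivots_iff)
  \<comment> \<open>The same turn at \<open>mid xs i\<close>: from there \<open>z\<close> lies in
    the direction of \<open>pre xs m\<close>, the target for which \<open>i\<close> is usable. The
    bound starts again from the exact \<open>C\<close> of usability, so the loss stays a single
    \<open>\<delta>\<close> at every link.\<close>
  have "gp (mid xs i) (pre xs m) z = d (mid xs i) (pre xs m) - gp (pre xs m) (mid xs i) z"
    by (rule gp_swap)
  moreover have fi: "98 * C + 100 * \<delta> + 1 \<le> d (mid xs i) (pre xs m)"
    using live_far[OF S(1) _ li] S(2) by simp
  ultimately have "C + \<delta> < gp (mid xs i) (pre xs m) z"
    using x[unfolded xi] C_nonneg delta_nonneg by linarith
  moreover have "gp (mid xs i) (pre xs i) (pre xs m) \<le> C" using li by (simp add: live_def killed_def)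
  ultimately have "gp (mid xs i) (pre xs i) z \<le> C + \<delta>" using gp_propagate by blast
  moreover have "d (mid xs m) z + 1 \<le> d (mid xs i) z"
    using x[unfolded xi] far fi C_nonneg delta_nonneg d_commute[of z "pre xs m"]
    unfolding gp_def by argo
  ultimately show "i < m \<and> i \<in> pivots C y xs m \<and> gp (mid xs i) (pre xs i) z \<le> C + \<delta> \<and> d (mid xs m) z + 1 \<le> d (mid xs i) z"
    using pi by blast
qed

text \<open>Passing from a pivot to its anchor lowers the time, so the chain ends, namely at a time
  \<open>r\<close> whose anchor is \<open>y\<close> itself.\<close>

lemma chain_root:
  assumes "in_S xs" "m < length xs" "m \<in> pivots C y xs n" "gp (mid xs m) (pre xs m) z \<le> C + \<delta>"
  shows "\<exists>r\<le>m. live C y xs r (pre xs r) = {} \<and> gp (pre xs r) y z \<le> C + \<delta>"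
  using assms(2-)
proof (induction m arbitrary: n rule: less_induct)
  case (less m)
  show ?case
  proof (cases "live C y xs m (pre xs m) = {}")
    case True
    then show ?thesis using pivot_step(1)[OF assms(1) less.prems] by blast
  next
    case False
    define i where "i = Max (live C y xs m (pre xs m))"
    have i: "i < m" "i \<in> pivots C y xs m" "gp (mid xs i) (pre xs i) z \<le> C + \<delta>"
      using pivot_step(3)[OF assms(1) less.prems False i_def] by auto
    then obtain r where "r \<le> i" "live C y xs r (pre xs r) = {}" "gp (pre xs r) y z \<le> C + \<delta>"
      using less.IH[of i m] less.prems(1) by auto
    then show ?thesis using \<open>i < m\<close> by (metis le_trans less_imp_le)
  qed
qed

text \<open>Every link spans at most \<open>L\<close> time units and adds at least 1 to the distance
  from \<open>z\<close>; the last one, at a time below \<open>L\<close>, ends at \<open>y\<close>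
  and loses at most \<open>2 * (C + \<delta>)\<close>.\<close>

lemma chain_length:
  assumes S: "in_S xs" and L: "0 < L"
    and gap: "\<And>j. j < length xs \<Longrightarrow> L \<le> j \<Longrightarrow> \<exists>i\<in>{j-L..<j}. i \<in> live C y xs j (pre xs j)"
    and "m < length xs" "m \<in> pivots C y xs n" "gp (mid xs m) (pre xs m) z \<le> C + \<delta>"
  shows "d (mid xs m) z + real (Suc m) / real L \<le> d y z + 2 * (C + \<delta>)"
  using assms(4-)
proof (induction m arbitrary: n rule: less_induct)
  case (less m)
  show ?case
  proof (cases "live C y xs m (pre xs m) = {}")
    case True
    then have "\<not> L \<le> m" using gap[OF less.prems(1)] by auto
    then have "real (Suc m) / real L \<le> 1" using L by simp
    then show ?thesis using pivot_step(2)[OF S less.prems True] by linarith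
  next
    case False
    define i where "i = Max (live C y xs m (pre xs m))"
    have i: "i < m" "i \<in> pivots C y xs m" "gp (mid xs i) (pre xs i) z \<le> C + \<delta>"
      and far: "d (mid xs m) z + 1 \<le> d (mid xs i) z"
      using pivot_step(3)[OF S less.prems False i_def] by auto
    have "m \<le> i + L"
    proof (cases "L \<le> m")
      case True
      then obtain j where "j \<in> {m-L..<m}" "j \<in> live C y xs m (pre xs m)" using gap less.prems(1) by blast
      moreover from this have "j \<le> i" unfolding i_def using Max_ge[OF finite_live] by blast
      ultimately show ?thesis by auto
    qed simp
    then have "real (Suc m) \<le> real (Suc i) + real L" by linarith
    then have "real (Suc m) / real L \<le> (real (Suc i) + real L) / real L"
      by (intro divide_right_mono) auto
    also have "\<dots> = real (Suc i) / real L + 1" using L by (simp add: field_simps)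
    finally show ?thesis using far less.IH[of i m] i less.prems(1) by fastforce
  qed
qed

lemma live_gp: "m \<in> live C y xs n z \<Longrightarrow> gp (mid xs m) (pre xs m) z \<le> C + \<delta>"
  using delta_nonneg by (simp add: live_def killed_def)

text \<open>The root of the chain is a time without usable pivots, hence earlier than
  \<open>L\<close>. The walk is still within \<open>R\<close> of the origin there, and moving the
  base point to 0 costs at most this distance. For \<open>n < L\<close> the product is bounded by
  the length itself.\<close>

lemma gp_bounded:
  assumes S: "in_S xs" and n: "n \<le> length xs"
    and pre: "\<And>j. j < length xs \<Longrightarrow> L \<le> j \<Longrightarrow> live C y xs j (pre xs j) \<noteq> {}"
    and pos: "L \<le> n \<Longrightarrow> live C y xs n (pos xs n) \<noteq> {}"
    and bound: "\<And>j. j < length xs \<Longrightarrow> j < L \<Longrightarrow> real (len (pre xs j)) \<le> R"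
      "n < L \<Longrightarrow> real (len (pos xs n)) \<le> R"
  shows "gp 0 y (pos xs n) \<le> C + \<delta> + R"
proof (cases "L \<le> n")
  case False
  then have "real (len (pos xs n)) \<le> R" using bound(2) by simp
  then show ?thesis
    using gp_le_right[of 0 y "pos xs n"] C_nonneg delta_nonneg by simp
next
  case True
  then obtain m where m: "m \<in> live C y xs n (pos xs n)" using pos by blast
  then have mp: "m \<in> pivots C y xs n" "m < length xs" using n by (simp_all add: live_def pivots_iff)
  obtain r where r: "r \<le> m" "live C y xs r (pre xs r) = {}" "gp (pre xs r) y (pos xs n) \<le> C + \<delta>"
    using chain_root[OF S mp(2,1) live_gp[OF m]] by blast
  then have "r < length xs" "r < L" using mp(2) pre[of r] by (simp, meson le_less_trans not_le)
  then have "real (len (pre xs r)) \<le> R" using bound(1) by blast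
  then show ?thesis using gp_base_change[of 0 y "pos xs n" "pre xs r"] r(3) by simp
qed

text \<open>The chain starts at a pivot in the last window, so at most \<open>L\<close> time units,
  that is one link, are lost at its end.\<close>

lemma pos_far:
  assumes S: "in_S xs" and n: "n \<le> length xs" and L: "0 < L" "L \<le> n"
    and pre: "\<And>j. j < length xs \<Longrightarrow> L \<le> j \<Longrightarrow> \<exists>i\<in>{j-L..<j}. i \<in> live C y xs j (pre xs j)"
    and pos: "\<exists>i\<in>{n-L..<n}. i \<in> live C y xs n (pos xs n)"
  shows "real n / real L \<le> d y (pos xs n) + 2 * (C + \<delta>) + 1"
proof -
  obtain m where m: "m \<in> {n-L..<n}" "m \<in> live C y xs n (pos xs n)" using pos by blast
  then have mp: "m \<in> pivots C y xs n" "m < length xs" using n by (simp_all add: live_def pivots_iff)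
  have "real (Suc m) / real L \<le> d y (pos xs n) + 2 * (C + \<delta>)"
    using chain_length[OF S L(1) pre mp(2,1) live_gp[OF m(2)]] d_nonneg[of "mid xs m" "pos xs n"] by linarith
  moreover have "real n \<le> real (Suc m) + real L" using m(1) by auto
  then have "real n / real L \<le> (real (Suc m) + real L) / real L" by (intro divide_right_mono) auto
  moreover have "(real (Suc m) + real L) / real L = real (Suc m) / real L + 1" using L by (simp add: field_simps)
  ultimately show ?thesis by linarith
qed

end

section \<open>Tightness of Gromov products and growth of the length\<close>

lemma map_replicate_pmf: "replicate_pmf n (map_pmf f p) = map_pmf (map f) (replicate_pmf n p)"
  by (induction n) (simp_all add: map_bind_pmf bind_map_pmf)

lemma prob_UN_le:
  assumes "finite I" "\<And>i. i \<in> I \<Longrightarrow> measure_pmf.prob M (A i) \<le> b i"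
  shows "measure_pmf.prob M (\<Union>i\<in>I. A i) \<le> (\<Sum>i\<in>I. b i)"
proof -
  have "measure_pmf.prob M (\<Union>i\<in>I. A i) \<le> (\<Sum>i\<in>I. measure_pmf.prob M (A i))"
    using assms(1) by (intro measure_pmf.finite_measure_subadditive_finite) auto
  also have "\<dots> \<le> (\<Sum>i\<in>I. b i)" by (intro sum_mono assms(2))
  finally show ?thesis .
qed

lemma prob_mono_support:
  assumes "\<And>x. x \<in> set_pmf p \<Longrightarrow> x \<in> A \<Longrightarrow> x \<in> B"
  shows "measure_pmf.prob p A \<le> measure_pmf.prob p B"
  by (rule measure_pmf.finite_measure_mono_AE) (use assms in \<open>auto intro: AE_pmfI\<close>)

lemma pmf_tail_small:
  fixes f :: "'b \<Rightarrow> nat"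
  assumes "0 < e"
  shows "\<exists>M. measure_pmf.prob p {x. M < f x} \<le> e"
proof -
  have "(\<lambda>M. measure_pmf.prob p {x. M < f x}) \<longlonglongrightarrow> measure_pmf.prob p (\<Inter>M. {x. M < f x})"
    by (rule measure_pmf.finite_Lim_measure_decseq) (auto simp: decseq_def)
  moreover have "(\<Inter>M. {x. M < f x}) = {}" by auto
  ultimately have "(\<lambda>M. measure_pmf.prob p {x. M < f x}) \<longlonglongrightarrow> 0" by simp
  then have "eventually (\<lambda>M. measure_pmf.prob p {x. M < f x} < e) sequentially"
    using assms by (rule order_tendstoD)
  then obtain M where "measure_pmf.prob p {x. M < f x} < e"
    unfolding eventually_sequentially by blast
  then show ?thesis by (auto intro: less_imp_le)
qed

lemma prob_replicate_nth:
  assumes "i < N"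
  shows "measure_pmf.prob (replicate_pmf N p) {xs. xs ! i \<in> E} \<le> measure_pmf.prob p E"
  using prob_replicate_prefix[where A="\<lambda>m ys x. x \<in> E" and T="{i}" and n=N and p=p and q="measure_pmf.prob p E"] assms
  by simp

lemma sum_geometric_le: "(\<Sum>j\<in>{L..N}. (2/7) ^ j) \<le> 7/5 * (2/7 :: real) ^ L"
proof (cases "L \<le> N")
  case True
  have "(\<Sum>j\<in>{L..N}. (2/7) ^ j) = 7/5 * ((2/7) ^ L - (2/7 :: real) ^ Suc N)"
    using True by (subst sum_gp) (simp add: field_simps)
  then show ?thesis by simp
qed simp

context schottky_group
begin

definition triple_len :: "'a \<times> 'a \<times> 'a \<Rightarrow> nat" where
  "triple_len x = len (fst x) + (len (fst (snd x)) + len (snd (snd x)))"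

lemma len_step: "len (step x) \<le> triple_len x"
  unfolding step_def triple_len_def
  using len_add[of "fst x" "fst (snd x) + snd (snd x)"] len_add[of "fst (snd x)" "snd (snd x)"] by linarith

lemma len_pos:
  assumes "n \<le> length xs" "\<And>i. i < n \<Longrightarrow> triple_len (xs ! i) \<le> M"
  shows "len (pos xs n) \<le> n * M"
  using assms
proof (induction n)
  case 0
  then show ?case by (simp add: pos_def)
next
  case (Suc n)
  have "pos xs (Suc n) = pos xs n + step (xs ! n)"
    using Suc.prems(1) by (simp add: pos_def take_Suc_conv_app_nth)
  moreover have "len (pos xs n) \<le> n * M" using Suc by simp
  moreover have "len (step (xs ! n)) \<le> M" using len_step[of "xs ! n"] Suc.prems(2)[of n] by simp
  ultimately show ?case using len_add[of "pos xs n" "step (xs ! n)"] by simp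
qed

lemma len_pre:
  assumes "n < length xs" "\<And>i. i \<le> n \<Longrightarrow> triple_len (xs ! i) \<le> M"
  shows "len (pre xs n) \<le> Suc n * M"
proof -
  have "len (pos xs n) \<le> n * M" using assms by (intro len_pos) auto
  moreover have "len (fst (xs ! n)) \<le> M" using assms(2)[of n] by (simp add: triple_len_def)
  ultimately show ?thesis unfolding pre_def using len_add[of "pos xs n" "fst (xs ! n)"] by simp
qed

lemma in_S_replicate: "xs \<in> set_pmf (replicate_pmf N (triple_pmf \<kappa>)) \<Longrightarrow> in_S xs"
  using set_replicate_triple length_replicate_pmf unfolding in_S_def by metis

text \<open>The window is written \<open>{j-j..<j}\<close> so that it matches
  \<open>prob_no_live\<close> with \<open>l = j\<close>: no pivot of the whole past is
  usable.\<close>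

lemma live_empty_iff: "live C y xs j z = {} \<longleftrightarrow> (\<forall>m\<in>{j-j..<j}. m \<notin> live C y xs j z)"
  using pivots_less[of C y xs j] by (auto simp: live_def)

text \<open>The probabilities that no pivot at all is usable at time \<open>j\<close> are summable,
  so outside a small event this happens only before some \<open>L\<close>; the finitely many
  increments up to \<open>L\<close> are bounded with high probability. Neither \<open>L\<close> nor
  the bound depends on \<open>y\<close> or \<open>N\<close>.\<close>

lemma triple_tight:
  assumes "0 < \<eta>"
  shows "\<exists>R\<ge>0. \<forall>y N. measure_pmf.prob (replicate_pmf N (triple_pmf \<kappa>)) {xs. \<exists>n\<le>N. R < gp 0 y (pos xs n)} \<le> \<eta>"
proof -
  \<comment> \<open>The factor 14/5 is twice 7/5, the two geometric tails being those for the
    targets \<open>pre\<close> and \<open>pos\<close>; the other half of \<open>\<eta>\<close> is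
    shared by the first \<open>L\<close> increments.\<close>
  have "(\<lambda>L. 14/5 * (2/7 :: real) ^ L) \<longlonglongrightarrow> 14/5 * 0"
    by (intro tendsto_mult tendsto_const LIMSEQ_power_zero) simp
  then have "eventually (\<lambda>L. 14/5 * (2/7 :: real) ^ L < \<eta> / 2) sequentially"
    by (rule order_tendstoD(2)) (use assms in simp)
  then obtain L where L: "14/5 * (2/7 :: real) ^ L \<le> \<eta> / 2"
    unfolding eventually_sequentially using less_imp_le by blast
  obtain M where M: "measure_pmf.prob (triple_pmf \<kappa>) {x. M < triple_len x} \<le> \<eta> / (2 * (real L + 1))"
    using pmf_tail_small[of "\<eta> / (2 * (real L + 1))"] assms by fastforce
  define R where "R = C + \<delta> + real (L * M)"
  have "measure_pmf.prob (replicate_pmf N (triple_pmf \<kappa>)) {xs. \<exists>n\<le>N. R < gp 0 y (pos xs n)} \<le> \<eta>" for y N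
  proof -
    let ?M = "replicate_pmf N (triple_pmf \<kappa>)"
    let ?A = "\<lambda>j. {xs. \<forall>m\<in>{j-j..<j}. m \<notin> live C y xs j (pre xs j)}"
    let ?B = "\<lambda>j. {xs. \<forall>m\<in>{j-j..<j}. m \<notin> live C y xs j (pos xs j)}"
    let ?E = "\<lambda>i. {xs. xs ! i \<in> {x. M < triple_len x}}"
    have "measure_pmf.prob ?M {xs. \<exists>n\<le>N. R < gp 0 y (pos xs n)}
      \<le> measure_pmf.prob ?M ((\<Union>j\<in>{L..<N}. ?A j) \<union> ((\<Union>j\<in>{L..N}. ?B j) \<union> (\<Union>i\<in>{..<min L N}. ?E i)))"
    proof (rule prob_mono_support)
      fix xs assume xs: "xs \<in> set_pmf ?M" and "xs \<in> {xs. \<exists>n\<le>N. R < gp 0 y (pos xs n)}"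
      then obtain n where n: "n \<le> N" "R < gp 0 y (pos xs n)" by blast
      have len: "length xs = N" using xs by (rule length_replicate_pmf)
      show "xs \<in> (\<Union>j\<in>{L..<N}. ?A j) \<union> ((\<Union>j\<in>{L..N}. ?B j) \<union> (\<Union>i\<in>{..<min L N}. ?E i))"
      proof (rule ccontr)
        assume neg: "\<not> ?thesis"
        have small: "triple_len (xs ! i) \<le> M" if "i < L" "i < N" for i
          using neg that by (auto simp: not_less)
        have "gp 0 y (pos xs n) \<le> C + \<delta> + real (L * M)"
        proof (rule gp_bounded[where L=L])
          show "in_S xs" using xs by (rule in_S_replicate)
          show "n \<le> length xs" using n len by simp
          show "live C y xs j (pre xs j) \<noteq> {}" if "j < length xs" "L \<le> j" for j
          proof -
            have "xs \<notin> ?A j" using neg that len by auto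
            then show ?thesis unfolding live_empty_iff by blast
          qed
          show "live C y xs n (pos xs n) \<noteq> {}" if "L \<le> n"
          proof -
            have "xs \<notin> ?B n" using neg that n by auto
            then show ?thesis unfolding live_empty_iff by blast
          qed
          show "real (len (pre xs j)) \<le> real (L * M)" if "j < length xs" "j < L" for j
          proof -
            have "len (pre xs j) \<le> Suc j * M" using small that len by (intro len_pre) auto
            also have "\<dots> \<le> L * M" using that by (intro mult_right_mono) auto
            finally show ?thesis by (rule of_nat_mono)
          qed
          show "real (len (pos xs n)) \<le> real (L * M)" if "n < L"
          proof -
            have "len (pos xs n) \<le> n * M" using small that len n by (intro len_pos) auto
            also have "\<dots> \<le> L * M" using that by (intro mult_right_mono) auto
            finally show ?thesis by (rule of_nat_mono)
          qed
        qed
        then show False using n(2) by (simp add: R_def)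
      qed
    qed
    also have "\<dots> \<le> measure_pmf.prob ?M (\<Union>j\<in>{L..<N}. ?A j) +
        (measure_pmf.prob ?M (\<Union>j\<in>{L..N}. ?B j) + measure_pmf.prob ?M (\<Union>i\<in>{..<min L N}. ?E i))"
      by (rule order_trans[OF measure_Un_le]) (simp_all add: measure_Un_le)
    also have "\<dots> \<le> (\<Sum>j\<in>{L..<N}. (2/7) ^ j) + ((\<Sum>j\<in>{L..N}. (2/7) ^ j) +
        (\<Sum>i\<in>{..<min L N}. \<eta> / (2 * (real L + 1))))"
    proof (intro add_mono prob_UN_le)
      show "measure_pmf.prob ?M (?A j) \<le> (2/7) ^ j" if "j \<in> {L..<N}" for j
        using that by (intro prob_no_live_pre) auto
      show "measure_pmf.prob ?M (?B j) \<le> (2/7) ^ j" if "j \<in> {L..N}" for j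
        using that by (intro prob_no_live_pos) auto
      show "measure_pmf.prob ?M (?E i) \<le> \<eta> / (2 * (real L + 1))" if "i \<in> {..<min L N}" for i
        using that by (intro order_trans[OF prob_replicate_nth M]) auto
    qed auto
    also have "\<dots> \<le> 7/5 * (2/7) ^ L + (7/5 * (2/7) ^ L + \<eta> / 2)"
    proof (intro add_mono sum_geometric_le)
      have "(\<Sum>j\<in>{L..<N}. (2/7) ^ j) \<le> (\<Sum>j\<in>{L..N}. (2/7 :: real) ^ j)"
        by (intro sum_mono2) auto
      then show "(\<Sum>j\<in>{L..<N}. (2/7) ^ j) \<le> 7/5 * (2/7 :: real) ^ L"
        using sum_geometric_le order_trans by blast
      have "real (min L N) * (\<eta> / (2 * (real L + 1))) \<le> (real L + 1) * (\<eta> / (2 * (real L + 1)))"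
        using assms by (intro mult_right_mono) auto
      also have "\<dots> = \<eta> / 2" by (simp add: field_simps)
      finally show "(\<Sum>i\<in>{..<min L N}. \<eta> / (2 * (real L + 1))) \<le> \<eta> / 2" by simp
    qed
    also have "\<dots> \<le> \<eta>" using L by linarith
    finally show ?thesis .
  qed
  moreover have "0 \<le> R" using C_nonneg delta_nonneg by (simp add: R_def)
  ultimately show ?thesis by blast
qed

text \<open>Windows of length about \<open>n / q\<close> are used. All of them contain usable pivots
  except with probability about \<open>n * (2/7) ^ (n div q)\<close>, which tends to 0, and then the
  chain has about \<open>q\<close> links, enough to exceed \<open>M\<close>.\<close>

lemma triple_growth:
  assumes "0 < \<eta>"
  shows "\<exists>n0. \<forall>n\<ge>n0. measure_pmf.prob (replicate_pmf n (triple_pmf \<kappa>)) {xs. real (len (pos xs n)) \<le> M} \<le> \<eta>"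
proof -
  \<comment> \<open>The number of links needed: \<open>pos_far\<close> loses
    \<open>2 * (C + \<delta>) + 1\<close>.\<close>
  define q where "q = nat \<lceil>M + 2 * (C + \<delta>) + 1\<rceil> + 1"
  have q: "M + 2 * (C + \<delta>) + 1 < real q" unfolding q_def by linarith
  have "0 < q" by (simp add: q_def)
  have "(\<lambda>L. real q * (real L * (2/7) ^ L + (2/7) ^ L)) \<longlonglongrightarrow> real q * (0 + 0)"
    by (intro tendsto_intros powser_times_n_limit_0 LIMSEQ_power_zero) simp_all
  then have "eventually (\<lambda>L. real q * (real L * (2/7) ^ L + (2/7) ^ L) < \<eta>) sequentially"
    using assms by (intro order_tendstoD) auto
  then obtain L0 where L0: "\<And>L. L0 \<le> L \<Longrightarrow> real q * (real L * (2/7) ^ L + (2/7) ^ L) < \<eta>"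
    unfolding eventually_sequentially by blast
  have "measure_pmf.prob (replicate_pmf n (triple_pmf \<kappa>)) {xs. real (len (pos xs n)) \<le> M} \<le> \<eta>"
    if n: "q * (L0 + 1) \<le> n" for n
  proof -
    let ?M = "replicate_pmf n (triple_pmf \<kappa>)"
    define L where "L = n div q"
    have "(q * (L0 + 1)) div q \<le> L" unfolding L_def using n by (rule div_le_mono)
    then have L: "L0 + 1 \<le> L" using \<open>0 < q\<close> by (metis nonzero_mult_div_cancel_left not_gr_zero)
    have Lq: "L * q \<le> n" "n < (L + 1) * q" using \<open>0 < q\<close>
      unfolding L_def by (simp_all add: dividend_less_times_div mult.commute[of _ q])
    have "L * 1 \<le> L * q" using \<open>0 < q\<close> by (intro mult_left_mono) auto
    then have Ln: "0 < L" "L \<le> n" using order_trans[OF _ Lq(1)] L by auto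
    let ?A = "\<lambda>j. {xs. \<forall>m\<in>{j-L..<j}. m \<notin> live C 0 xs j (pre xs j)}"
    let ?B = "{xs. \<forall>m\<in>{n-L..<n}. m \<notin> live C 0 xs n (pos xs n)}"
    have "measure_pmf.prob ?M {xs. real (len (pos xs n)) \<le> M} \<le> measure_pmf.prob ?M ((\<Union>j\<in>{L..<n}. ?A j) \<union> ?B)"
    proof (rule prob_mono_support)
      fix xs assume xs: "xs \<in> set_pmf ?M" and "xs \<in> {xs. real (len (pos xs n)) \<le> M}"
      then have M: "real (len (pos xs n)) \<le> M" by simp
      have len: "length xs = n" using xs by (rule length_replicate_pmf)
      show "xs \<in> (\<Union>j\<in>{L..<n}. ?A j) \<union> ?B"
      proof (rule ccontr)
        assume neg: "\<not> ?thesis"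
        have "real n / real L \<le> d 0 (pos xs n) + 2 * (C + \<delta>) + 1"
        proof (rule pos_far)
          show "in_S xs" using xs by (rule in_S_replicate)
          show "\<exists>i\<in>{j-L..<j}. i \<in> live C 0 xs j (pre xs j)" if "j < length xs" "L \<le> j" for j
            using neg that len by auto
          show "\<exists>i\<in>{n-L..<n}. i \<in> live C 0 xs n (pos xs n)"
            using neg by auto
        qed (use Ln len in auto)
        moreover have "real q \<le> real n / real L"
          using Lq(1) Ln(1) by (simp add: field_simps flip: of_nat_mult)
        ultimately show False using M q by simp
      qed
    qed
    also have "\<dots> \<le> measure_pmf.prob ?M (\<Union>j\<in>{L..<n}. ?A j) + measure_pmf.prob ?M ?B"
      by (rule measure_Un_le) auto
    also have "\<dots> \<le> (\<Sum>j\<in>{L..<n}. (2/7) ^ L) + (2/7) ^ L"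
    proof (intro add_mono prob_UN_le)
      show "measure_pmf.prob ?M (?A j) \<le> (2/7) ^ L" if "j \<in> {L..<n}" for j
        using that by (intro prob_no_live_pre) auto
      show "measure_pmf.prob ?M ?B \<le> (2/7) ^ L"
        using Ln by (intro prob_no_live_pos) auto
    qed auto
    also have "\<dots> = (real (n - L) + 1) * (2/7) ^ L" by (simp add: algebra_simps)
    also have "\<dots> \<le> (real q * (real L + 1)) * (2/7) ^ L"
    proof (rule mult_right_mono)
      have "n - L + 1 \<le> (L + 1) * q" using Lq(2) Ln by linarith
      then have "real (n - L + 1) \<le> real ((L + 1) * q)" by (rule of_nat_mono)
      then show "real (n - L) + 1 \<le> real q * (real L + 1)" by (simp add: algebra_simps)
    qed simp
    also have "\<dots> \<le> \<eta>" using L0[of L] L by (simp add: algebra_simps)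
    finally show ?thesis .
  qed
  then show ?thesis by blast
qed

definition step_pmf :: "'a pmf \<Rightarrow> 'a pmf" where
  "step_pmf \<kappa> = map_pmf step (triple_pmf \<kappa>)"

lemma step_pmf_eq: "step_pmf \<kappa> = conv_pmf \<kappa> (conv_pmf (pmf_of_set S) (pmf_of_set S))"
  by (simp add: step_pmf_def triple_pmf_def step_def conv_pmf_def pair_pmf_def map_pmf_def
      bind_assoc_pmf bind_return_pmf)

lemma replicate_step_pmf:
  "measure_pmf.prob (replicate_pmf N (step_pmf \<kappa>)) {gs. P gs} =
   measure_pmf.prob (replicate_pmf N (triple_pmf \<kappa>)) {xs. P (map step xs)}"
  by (simp add: step_pmf_def map_replicate_pmf vimage_def)

lemma walk_tight:
  assumes "0 < \<eta>"
  shows "\<exists>R\<ge>0. \<forall>y N. measure_pmf.prob (replicate_pmf N (step_pmf \<kappa>))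
    {gs. \<exists>n\<le>N. R < gp 0 y (sum_list (take n gs))} \<le> \<eta>"
  using triple_tight[OF assms] by (simp add: replicate_step_pmf pos_def take_map)

lemma walk_growth:
  assumes "0 < \<eta>"
  shows "\<exists>n0. \<forall>n\<ge>n0. measure_pmf.prob (replicate_pmf n (step_pmf \<kappa>)) {gs. real (len (sum_list gs)) \<le> M} \<le> \<eta>"
proof -
  have "measure_pmf.prob (replicate_pmf n (step_pmf \<kappa>)) {gs. real (len (sum_list gs)) \<le> M}
    \<le> measure_pmf.prob (replicate_pmf n (triple_pmf \<kappa>)) {xs. real (len (pos xs n)) \<le> M}" for n
    unfolding replicate_step_pmf
    by (rule prob_mono_support) (auto simp: pos_def dest: length_replicate_pmf)
  then show ?thesis using triple_growth[OF assms] order_trans by meson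
qed

end

section \<open>Convergence to the boundary\<close>

text \<open>The two outcomes of the pivot argument, isolated as the interface to the entropy
  argument.\<close>

locale tight_walk = hyperbolic_group +
  fixes \<theta> :: "'a pmf"
  assumes tight: "0 < \<eta> \<Longrightarrow> \<exists>R\<ge>0. \<forall>y N. measure_pmf.prob (replicate_pmf N \<theta>)
      {gs. \<exists>n\<le>N. R < gp 0 y (sum_list (take n gs))} \<le> \<eta>"
    and growth: "0 < \<eta> \<Longrightarrow> \<exists>n0. \<forall>n\<ge>n0. measure_pmf.prob (replicate_pmf n \<theta>)
      {gs. real (len (sum_list gs)) \<le> M} \<le> \<eta>"

sublocale tight_walk \<subseteq> path: prob_space "pathsp \<theta>"
  unfolding pathsp_def by (rule prob_space.prob_space_stream_space[OF prob_space_measure_pmf])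

context tight_walk
begin

section \<open>Events and laws on the path space\<close>

lemma space_pathsp [simp]: "space (pathsp \<theta>) = UNIV"
  by (simp add: pathsp_def space_stream_space streams_UNIV)

lemma UNIV_sets [simp]: "UNIV \<in> sets (pathsp \<theta>)"
  using sets.top[of "pathsp \<theta>"] by simp

lemma Compl_sets: "A \<in> sets (pathsp \<theta>) \<Longrightarrow> - A \<in> sets (pathsp \<theta>)"
  using sets.compl_sets[of A "pathsp \<theta>"] by (simp add: Compl_eq_Diff_UNIV)

lemma sets_snth: "{\<omega>. \<omega> !! i \<in> A} \<in> sets (pathsp \<theta>)"
proof -
  have "(\<lambda>\<omega>. \<omega> !! i) \<in> measurable (pathsp \<theta>) (measure_pmf \<theta>)"
    unfolding pathsp_def by (rule measurable_snth)
  then have "(\<lambda>\<omega>. \<omega> !! i) -` A \<inter> space (pathsp \<theta>) \<in> sets (pathsp \<theta>)"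
    by (rule measurable_sets) simp
  then show ?thesis by (simp add: vimage_def)
qed

text \<open>The group is countable, so any event on the first \<open>n\<close> increments is a
  countable union of cylinders.\<close>

lemma sets_stake: "{\<omega>. P (stake n \<omega>)} \<in> sets (pathsp \<theta>)"
proof -
  have "{\<omega>. P (stake n \<omega>)} = (\<Union>l\<in>{l. length l = n \<and> P l}. {\<omega>. \<forall>i<n. \<omega> !! i \<in> {l ! i}})"
    by (auto simp: list_eq_iff_nth_eq)
       (metis length_stake nth_equalityI stake_nth)+
  moreover have "countable {l :: 'a list. length l = n \<and> P l}"
    using countable_lists[OF countable_group] countable_subset by (metis lists_UNIV subset_UNIV)
  moreover have "{\<omega>. \<forall>i<n. \<omega> !! i \<in> {l ! i}} \<in> sets (pathsp \<theta>)" for l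
  proof -
    have "{\<omega>. \<forall>i<n. \<omega> !! i \<in> {l ! i}} = (\<Inter>i\<in>{..<n}. {\<omega>. \<omega> !! i \<in> {l ! i}})"
      by auto
    also have "\<dots> \<in> sets (pathsp \<theta>)"
      by (intro sets.countable_INT'' sets_snth UNIV_sets) simp
    finally show ?thesis .
  qed
  ultimately show ?thesis by (simp add: sets.countable_UN'')
qed

lemma emeasure_stake: "emeasure (pathsp \<theta>) {\<omega>. P (stake n \<omega>)} = emeasure (measure_pmf (replicate_pmf n \<theta>)) {l. P l}"
proof (induction n arbitrary: P)
  case 0
  show ?case
  proof (cases "P []")
    case True
    then show ?thesis using path.emeasure_space_1 by simp
  qed simp
next
  case (Suc n)
  have "emeasure (pathsp \<theta>) {\<omega>. P (stake (Suc n) \<omega>)} =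
    (\<integral>\<^sup>+ t. emeasure (pathsp \<theta>) {x \<in> space (pathsp \<theta>). t ## x \<in> {\<omega>. P (stake (Suc n) \<omega>)}} \<partial>measure_pmf \<theta>)"
    using sets_stake[of P "Suc n"] unfolding pathsp_def by (rule prob_space.emeasure_stream_space[OF prob_space_measure_pmf])
  also have "\<dots> = (\<integral>\<^sup>+ t. emeasure (measure_pmf (replicate_pmf n \<theta>)) {l. P (t # l)} \<partial>measure_pmf \<theta>)"
  proof (rule nn_integral_cong)
    fix t
    show "emeasure (pathsp \<theta>) {x \<in> space (pathsp \<theta>). t ## x \<in> {\<omega>. P (stake (Suc n) \<omega>)}} =
      emeasure (measure_pmf (replicate_pmf n \<theta>)) {l. P (t # l)}"
      using Suc.IH[of "\<lambda>l. P (t # l)"] by simp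
  qed
  also have "\<dots> = emeasure (measure_pmf (replicate_pmf (Suc n) \<theta>)) {l. P l}"
    by (simp add: emeasure_bind_pmf map_pmf_def[symmetric] vimage_def)
  finally show ?case .
qed

lemma measure_stake: "measure (pathsp \<theta>) {\<omega>. P (stake n \<omega>)} = measure_pmf.prob (replicate_pmf n \<theta>) {l. P l}"
  by (simp add: measure_def emeasure_stake)

definition good :: "real \<Rightarrow> nat \<Rightarrow> 'a stream \<Rightarrow> bool" where
  "good R k \<omega> \<longleftrightarrow> (\<forall>j\<ge>k. gp (walk k \<omega>) 0 (walk j \<omega>) \<le> R)"

lemma sets_good: "{\<omega>. good R k \<omega>} \<in> sets (pathsp \<theta>)"
proof -
  have "{\<omega>. good R k \<omega>} = (\<Inter>j\<in>{k..}. {\<omega>. (\<lambda>l. gp (sum_list (take k l)) 0 (sum_list l) \<le> R) (stake j \<omega>)})"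
    by (auto simp: good_def walk_def take_stake min_def)
  also have "\<dots> \<in> sets (pathsp \<theta>)"
    by (intro sets.countable_INT'' sets_stake) auto
  finally show ?thesis .
qed

text \<open>Given the first \<open>k\<close> increments, translation by the inverse of
  \<open>w_k\<close> turns the later positions into a fresh walk from 0 and the origin into the
  fixed point \<open>- walk k \<omega>\<close>. Uniformity of \<open>tight\<close> in
  \<open>y\<close> gives the bound for all \<open>k\<close>, and uniformity in \<open>N\<close>
  gives it for the infinite future.\<close>

lemma prob_not_good:
  assumes "0 < \<eta>"
  shows "\<exists>R\<ge>0. \<forall>k. measure (pathsp \<theta>) {\<omega>. \<not> good R k \<omega>} \<le> \<eta>"
proof -
  obtain R where "0 \<le> R" and R: "\<And>y N. measure_pmf.prob (replicate_pmf N \<theta>)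
      {gs. \<exists>n\<le>N. R < gp 0 y (sum_list (take n gs))} \<le> \<eta>"
    using tight[OF assms] by blast
  have "measure (pathsp \<theta>) {\<omega>. \<not> good R k \<omega>} \<le> \<eta>" for k
  proof -
    define Q where "Q = (\<lambda>N gs. \<exists>n\<le>N. R < gp (sum_list (take k gs)) 0 (sum_list (take (k + n) gs)))"
    define E where "E = (\<lambda>N. {\<omega>. Q N (stake (k + N) \<omega>)})"
    have E: "E N = {\<omega>. \<exists>n\<le>N. R < gp (walk k \<omega>) 0 (walk (k + n) \<omega>)}" for N
      by (auto simp: E_def Q_def walk_def take_stake min_def)
    have bound: "measure (pathsp \<theta>) (E N) \<le> \<eta>" for N
    proof -
      have "measure (pathsp \<theta>) (E N) = measure_pmf.prob (replicate_pmf (k + N) \<theta>) {l. Q N l}"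
        unfolding E_def by (rule measure_stake)
      also have "\<dots> \<le> \<eta> * measure_pmf.prob (replicate_pmf k \<theta>) UNIV"
        unfolding replicate_pmf_distrib
      proof (rule prob_bind_pmf_le)
        fix xs assume "xs \<in> set_pmf (replicate_pmf k \<theta>)"
        then have len: "length xs = k" by (rule length_replicate_pmf)
        have "gp (sum_list xs) 0 (sum_list xs + z) = gp 0 (- sum_list xs) z" for z
          using gp_left[of "sum_list xs" 0 "- sum_list xs" z] by simp
        then have "(\<lambda>ys. xs @ ys) -` {l. Q N l} = {gs. \<exists>n\<le>N. R < gp 0 (- sum_list xs) (sum_list (take n gs))}"
          by (auto simp: Q_def len)
        then show "measure_pmf.prob (bind_pmf (replicate_pmf N \<theta>) (\<lambda>ys. return_pmf (xs @ ys))) {l. Q N l}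
          \<le> \<eta> * indicator UNIV xs"
          unfolding map_pmf_def[symmetric] measure_map_pmf using R by simp
      qed (use assms in simp)
      finally show ?thesis by simp
    qed
    have "(\<lambda>N. measure (pathsp \<theta>) (E N)) \<longlonglongrightarrow> measure (pathsp \<theta>) (\<Union>N. E N)"
    proof (rule path.finite_Lim_measure_incseq)
      show "range E \<subseteq> sets (pathsp \<theta>)" unfolding E_def using sets_stake by auto
      show "incseq E" unfolding E incseq_def by (auto intro: le_trans)
    qed
    moreover have "\<not> good R k \<omega> \<longleftrightarrow> (\<exists>n. R < gp (walk k \<omega>) 0 (walk (k + n) \<omega>))" for \<omega>
      unfolding good_def by (auto simp: not_le le_iff_add)
    then have "(\<Union>N. E N) = {\<omega>. \<not> good R k \<omega>}" unfolding E by blast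
    ultimately have "(\<lambda>N. measure (pathsp \<theta>) (E N)) \<longlonglongrightarrow> measure (pathsp \<theta>) {\<omega>. \<not> good R k \<omega>}" by simp
    then show ?thesis by (rule LIMSEQ_le_const2) (use bound in blast)
  qed
  then show ?thesis using \<open>0 \<le> R\<close> by blast
qed

lemma good_gp:
  assumes "good R k \<omega>" "k \<le> j"
  shows "real (len (walk k \<omega>)) - R \<le> gp 0 (walk k \<omega>) (walk j \<omega>)"
  using assms gp_swap[of 0 "walk k \<omega>" "walk j \<omega>"] by (simp add: good_def)

text \<open>One good time \<open>k\<close> with \<open>w_k\<close> far from the origin suffices: all
  later positions have a large product with \<open>w_k\<close>, hence with each other. Such a
  \<open>k\<close> works with probability arbitrarily close to 1, so the exceptional set lies in
  events of arbitrarily small probability.\<close>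

lemma AE_gp_large: "AE \<omega> in pathsp \<theta>. \<exists>N. \<forall>i\<ge>N. \<forall>j\<ge>N. M \<le> gp 0 (walk i \<omega>) (walk j \<omega>)"
proof -
  have "\<exists>F\<in>sets (pathsp \<theta>). measure (pathsp \<theta>) (- F) \<le> 1 / real (Suc m) \<and>
      (\<forall>\<omega>\<in>F. \<exists>N. \<forall>i\<ge>N. \<forall>j\<ge>N. M \<le> gp 0 (walk i \<omega>) (walk j \<omega>))" for m
  proof -
    define \<eta> where "\<eta> = 1 / (2 * real (Suc m))"
    have \<eta>: "0 < \<eta>" by (simp add: \<eta>_def)
    obtain R where R: "\<And>k. measure (pathsp \<theta>) {\<omega>. \<not> good R k \<omega>} \<le> \<eta>"
      using prob_not_good[OF \<eta>] by blast
    \<comment> \<open>In the threshold, \<open>R\<close> is lost to goodness of \<open>k\<close> and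
      \<open>\<delta>\<close> to the comparison of two later positions through
      \<open>w_k\<close>.\<close>
    obtain k where k: "measure_pmf.prob (replicate_pmf k \<theta>) {gs. real (len (sum_list gs)) \<le> M + R + \<delta>} \<le> \<eta>"
      using growth[OF \<eta>] by blast
    let ?B = "{\<omega>. (\<lambda>gs. real (len (sum_list gs)) \<le> M + R + \<delta>) (stake k \<omega>)}"
    have B: "measure (pathsp \<theta>) ?B \<le> \<eta>" using measure_stake[of "\<lambda>gs. real (len (sum_list gs)) \<le> M + R + \<delta>" k] k by simp
    have setsB: "?B \<in> sets (pathsp \<theta>)" by (rule sets_stake)
    have setsG: "{\<omega>. \<not> good R k \<omega>} \<in> sets (pathsp \<theta>)"
      using Compl_sets[OF sets_good[of R k]] by (simp add: Collect_neg_eq)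
    define F where "F = - ({\<omega>. \<not> good R k \<omega>} \<union> ?B)"
    have "F \<in> sets (pathsp \<theta>)"
      unfolding F_def by (intro Compl_sets sets.Un setsG setsB)
    moreover have "measure (pathsp \<theta>) (- F) \<le> 1 / real (Suc m)"
    proof -
      have "measure (pathsp \<theta>) (- F) \<le> measure (pathsp \<theta>) {\<omega>. \<not> good R k \<omega>} + measure (pathsp \<theta>) ?B"
        unfolding F_def double_compl by (rule measure_Un_le[OF setsG setsB])
      also have "\<dots> \<le> 2 * \<eta>" using R[of k] B by simp
      also have "\<dots> = 1 / real (Suc m)" by (simp add: \<eta>_def field_simps)
      finally show ?thesis .
    qed
    moreover have "\<exists>N. \<forall>i\<ge>N. \<forall>j\<ge>N. M \<le> gp 0 (walk i \<omega>) (walk j \<omega>)" if "\<omega> \<in> F" for \<omega>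
    proof (intro exI allI impI)
      fix i j assume ij: "k \<le> i" "k \<le> j"
      have g: "good R k \<omega>" and l: "M + R + \<delta> < real (len (walk k \<omega>))"
        using that by (auto simp: F_def walk_def)
      show "M \<le> gp 0 (walk i \<omega>) (walk j \<omega>)"
        using gp_hyp[where w=0 and x="walk i \<omega>" and y="walk j \<omega>" and z="walk k \<omega>"]
          good_gp[OF g ij(1)] good_gp[OF g ij(2)] l
        by (simp add: gp_commute[of 0 "walk i \<omega>" "walk k \<omega>"] min_def split: if_splits)
    qed
    ultimately show ?thesis by blast
  qed
  then obtain F where F: "\<And>m. F m \<in> sets (pathsp \<theta>)" "\<And>m. measure (pathsp \<theta>) (- F m) \<le> 1 / real (Suc m)"
    "\<And>m \<omega>. \<omega> \<in> F m \<Longrightarrow> \<exists>N. \<forall>i\<ge>N. \<forall>j\<ge>N. M \<le> gp 0 (walk i \<omega>) (walk j \<omega>)"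
    by metis
  define Z where "Z = (\<Inter>m. - F m)"
  have cF: "- F m \<in> sets (pathsp \<theta>)" for m
    by (intro Compl_sets F)
  have Z: "Z \<in> sets (pathsp \<theta>)" unfolding Z_def using cF by (intro sets.countable_INT'') auto
  have "measure (pathsp \<theta>) Z \<le> 1 / real (Suc m)" for m
    by (rule order_trans[OF path.finite_measure_mono F(2)[of m]]) (use cF in \<open>auto simp: Z_def\<close>)
  then have "measure (pathsp \<theta>) Z \<le> 0"
    using LIMSEQ_le_const[OF LIMSEQ_inverse_real_of_nat, of "measure (pathsp \<theta>) Z"] by (simp add: inverse_eq_divide)
  then have "emeasure (pathsp \<theta>) Z = 0"
    by (simp add: path.emeasure_eq_measure measure_le_0_iff)
  moreover have "\<omega> \<in> Z" if "\<not> (\<exists>N. \<forall>i\<ge>N. \<forall>j\<ge>N. M \<le> gp 0 (walk i \<omega>) (walk j \<omega>))" for \<omega>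
    using that F(3)[of \<omega>] unfolding Z_def by blast
  ultimately show ?thesis using Z by (intro AE_I[where N=Z]) blast+
qed

lemma AE_conv_infty: "AE \<omega> in pathsp \<theta>. conv_infty \<Sigma> (\<lambda>n. walk n \<omega>)"
proof -
  have "AE \<omega> in pathsp \<theta>. \<forall>M::nat. \<exists>N. \<forall>i\<ge>N. \<forall>j\<ge>N. real M \<le> gp 0 (walk i \<omega>) (walk j \<omega>)"
    unfolding AE_all_countable using AE_gp_large by blast
  then show ?thesis
  proof (rule AE_mp, intro AE_I2 impI)
    fix \<omega> assume *: "\<forall>M::nat. \<exists>N. \<forall>i\<ge>N. \<forall>j\<ge>N. real M \<le> gp 0 (walk i \<omega>) (walk j \<omega>)"
    show "conv_infty \<Sigma> (\<lambda>n. walk n \<omega>)"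
      unfolding conv_infty_def gprodG_eq
    proof
      fix R :: real
      obtain M :: nat where "R \<le> real M" using real_arch_simple by blast
      then show "\<exists>N. \<forall>i\<ge>N. \<forall>j\<ge>N. R \<le> gp 0 (walk i \<omega>) (walk j \<omega>)"
        using * order_trans by meson
    qed
  qed
qed

end

section \<open>Shadows\<close>

context hyperbolic_group
begin

lemma gp_hyp2:
  assumes "K \<le> gp w x y" "K \<le> gp w y z"
  shows "K - \<delta> \<le> gp w x z"
  using gp_hyp[where w=w and x=x and y=z and z=y] assms by (simp add: min_def split: if_splits)

text \<open>Both sequences are equivalent to the representative \<open>x0\<close> that defines the
  class, and are compared through one late term of it.\<close>

lemma bndry_equiv:
  assumes "\<xi> \<in> bndry \<Sigma>" "x \<in> \<xi>" "y \<in> \<xi>"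
  shows "\<exists>N. \<forall>i\<ge>N. \<forall>j\<ge>N. K \<le> gp 0 (x i) (y j)"
proof -
  obtain x0 where x0: "\<xi> = {y. conv_infty \<Sigma> y \<and> seq_equiv \<Sigma> x0 y}"
    using assms(1) by (auto simp: bndry_def)
  have "\<exists>N. \<forall>i\<ge>N. \<forall>j\<ge>N. K + \<delta> \<le> gp 0 (x0 i) (x j)" "\<exists>N. \<forall>i\<ge>N. \<forall>j\<ge>N. K + \<delta> \<le> gp 0 (x0 i) (y j)"
    using assms(2,3) unfolding x0 seq_equiv_def gprodG_eq by blast+
  then obtain N N' where N: "\<And>i j. N \<le> i \<Longrightarrow> N \<le> j \<Longrightarrow> K + \<delta> \<le> gp 0 (x0 i) (x j)"
    and N': "\<And>i j. N' \<le> i \<Longrightarrow> N' \<le> j \<Longrightarrow> K + \<delta> \<le> gp 0 (x0 i) (y j)" by blast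
  have "K \<le> gp 0 (x i) (y j)" if "max N N' \<le> i" "max N N' \<le> j" for i j
    using gp_hyp2[of "K + \<delta>" 0 "x i" "x0 (max N N')" "y j"] N[of "max N N'" i] N'[of "max N N'" j] that
    by (simp add: gp_commute[of 0 "x i"])
  then show ?thesis by blast
qed

lemma bndry_nonempty: "\<xi> \<in> bndry \<Sigma> \<Longrightarrow> \<exists>x. x \<in> \<xi>"
  by (auto simp: bndry_def conv_infty_def seq_equiv_def)

lemma bnd_lim_conv:
  assumes "conv_infty \<Sigma> (\<lambda>n. walk n \<omega>)"
  shows "bnd_lim \<Sigma> \<omega> \<in> bndry \<Sigma>" "(\<lambda>n. walk n \<omega>) \<in> bnd_lim \<Sigma> \<omega>"
proof -
  let ?x = "\<lambda>n. walk n \<omega>"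
  have "?x \<in> {y. conv_infty \<Sigma> y \<and> seq_equiv \<Sigma> ?x y}"
    using assms by (simp add: conv_infty_def seq_equiv_def)
  moreover have "{y. conv_infty \<Sigma> y \<and> seq_equiv \<Sigma> ?x y} \<in> bndry \<Sigma>"
    using assms unfolding bndry_def by blast
  ultimately have ex: "\<exists>\<xi>. \<xi> \<in> bndry \<Sigma> \<and> ?x \<in> \<xi>" by blast
  then have "bnd_lim \<Sigma> \<omega> = (SOME \<xi>. \<xi> \<in> bndry \<Sigma> \<and> ?x \<in> \<xi>)" unfolding bnd_lim_def by auto
  then show "bnd_lim \<Sigma> \<omega> \<in> bndry \<Sigma>" "?x \<in> bnd_lim \<Sigma> \<omega>" using someI_ex[OF ex] by auto
qed

lemma gprodB_gtD:
  assumes "ereal R < gprodB \<Sigma> \<xi> \<eta>"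
  shows "\<exists>x\<in>\<xi>. \<exists>y\<in>\<eta>. \<exists>n. \<forall>i\<ge>n. \<forall>j\<ge>n. R \<le> gp 0 (x i) (y j)"
proof -
  obtain x y n where xy: "x \<in> \<xi>" "y \<in> \<eta>"
    "ereal R < (INF i\<in>{n..}. INF j\<in>{n..}. ereal (gp 0 (x i) (y j)))"
    using assms unfolding gprodB_def less_SUP_iff gprodG_eq by blast
  have "ereal R \<le> ereal (gp 0 (x i) (y j))" if "n \<le> i" "n \<le> j" for i j
  proof -
    have "ereal R \<le> (INF i\<in>{n..}. INF j\<in>{n..}. ereal (gp 0 (x i) (y j)))" using xy(3) by simp
    also have "\<dots> \<le> (INF j\<in>{n..}. ereal (gp 0 (x i) (y j)))" using that by (intro INF_lower) simp
    also have "\<dots> \<le> ereal (gp 0 (x i) (y j))" using that by (intro INF_lower) simp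
    finally show ?thesis .
  qed
  then have "\<forall>i\<ge>n. \<forall>j\<ge>n. R \<le> gp 0 (x i) (y j)" by simp
  then show ?thesis using xy(1,2) by blast
qed

lemma gprodB_gtI:
  assumes "x \<in> \<xi>" "y \<in> \<eta>" "\<And>i j. n \<le> i \<Longrightarrow> n \<le> j \<Longrightarrow> K \<le> gp 0 (x i) (y j)" "R < K"
  shows "ereal R < gprodB \<Sigma> \<xi> \<eta>"
proof -
  have "ereal R < ereal K" using assms(4) by simp
  also have "\<dots> \<le> (INF i\<in>{n..}. INF j\<in>{n..}. ereal (gprodG \<Sigma> (x i) (y j)))"
    using assms(3) by (intro INF_greatest) (simp add: gprodG_eq)
  also have "\<dots> \<le> gprodB \<Sigma> \<xi> \<eta>"
    unfolding gprodB_def using assms(1,2) by (intro SUP_upper2[of x] SUP_upper2[of y] SUP_upper2[of n]) auto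
  finally show ?thesis .
qed

text \<open>The boundary points whose rays from the origin pass \<open>g\<close> at distance about
  \<open>r\<close>, expressed through a single representing sequence.\<close>

definition shadow :: "'g \<Rightarrow> real \<Rightarrow> (nat \<Rightarrow> 'g) set set" where
  "shadow g r = {\<xi>\<in>bndry \<Sigma>. \<exists>x\<in>\<xi>. \<exists>N. \<forall>j\<ge>N. gp g 0 (x j) \<le> r}"

text \<open>Points having a neighbourhood inside the shadow. The sigma-algebra of the boundary is
  generated by open sets, so this version is Borel; it lies between shadows whose parameters differ
  by \<open>\<delta>\<close>.\<close>

definition open_shadow :: "'g \<Rightarrow> real \<Rightarrow> (nat \<Rightarrow> 'g) set set" where
  "open_shadow g r = {\<xi>\<in>bndry \<Sigma>. \<exists>R::real. {\<eta>\<in>bndry \<Sigma>. gprodB \<Sigma> \<xi> \<eta> > ereal R} \<subseteq> shadow g r}"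

text \<open>By \<open>gp_swap\<close>, a product at most \<open>r\<close> at \<open>g\<close> means
  that \<open>g\<close> has product at least \<open>K\<close> with the sequence from the origin.
  Passing to a boundary point close to \<open>\<xi>\<close> lowers this to
  \<open>K - \<delta>\<close>, which is a shadow of parameter \<open>r + \<delta>\<close>.\<close>

lemma shadow_subset_open_shadow: "shadow g r \<subseteq> open_shadow g (r + \<delta>)"
proof
  fix \<xi> assume "\<xi> \<in> shadow g r"
  then obtain x N where \<xi>: "\<xi> \<in> bndry \<Sigma>" "x \<in> \<xi>" and N: "\<And>j. N \<le> j \<Longrightarrow> gp g 0 (x j) \<le> r"
    unfolding shadow_def by blast
  define K where "K = real (len g) - r"
  have "\<eta> \<in> shadow g (r + \<delta>)" if \<eta>: "\<eta> \<in> bndry \<Sigma>" "ereal (K + \<delta>) < gprodB \<Sigma> \<xi> \<eta>" for \<eta>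
  proof -
    obtain x' y n where xy: "x' \<in> \<xi>" "y \<in> \<eta>" and n: "\<And>i j. n \<le> i \<Longrightarrow> n \<le> j \<Longrightarrow> K + \<delta> \<le> gp 0 (x' i) (y j)"
      using gprodB_gtD[OF \<eta>(2)] by blast
    obtain n' where n': "\<And>i j. n' \<le> i \<Longrightarrow> n' \<le> j \<Longrightarrow> K + \<delta> \<le> gp 0 (x i) (x' j)"
      using bndry_equiv[OF \<xi> xy(1)] by blast
    define m where "m = max N (max n n')"
    have "gp g 0 (y j) \<le> r + \<delta>" if "m \<le> j" for j
    proof -
      have "K + \<delta> - \<delta> \<le> gp 0 (x m) (y j)"
        by (rule gp_hyp2[OF n' n]) (use that in \<open>auto simp: m_def\<close>)
      moreover have "K \<le> gp 0 g (x m)"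
        using N[of m] gp_swap[of 0 g "x m"] by (simp add: m_def K_def)
      ultimately have "K - \<delta> \<le> gp 0 g (y j)" using gp_hyp2[of K 0 g "x m" "y j"] by simp
      then show ?thesis using gp_swap[of 0 g "y j"] by (simp add: K_def)
    qed
    then show ?thesis using xy(2) \<eta>(1) by (auto simp: shadow_def)
  qed
  then show "\<xi> \<in> open_shadow g (r + \<delta>)" using \<xi>(1) unfolding open_shadow_def by blast
qed

text \<open>The product of \<open>\<xi>\<close> with itself exceeds every real, so
  \<open>\<xi>\<close> belongs to each of its own neighbourhoods.\<close>

lemma open_shadow_subset: "open_shadow g r \<subseteq> shadow g r"
proof
  fix \<xi> assume "\<xi> \<in> open_shadow g r"
  then obtain R where R: "\<xi> \<in> bndry \<Sigma>" "{\<eta>\<in>bndry \<Sigma>. gprodB \<Sigma> \<xi> \<eta> > ereal R} \<subseteq> shadow g r"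
    unfolding open_shadow_def by blast
  obtain x where x: "x \<in> \<xi>" using bndry_nonempty R(1) by blast
  obtain N where "\<And>i j. N \<le> i \<Longrightarrow> N \<le> j \<Longrightarrow> R + 1 \<le> gp 0 (x i) (x j)"
    using bndry_equiv[OF R(1) x x] by blast
  then have "ereal R < gprodB \<Sigma> \<xi> \<xi>" using gprodB_gtI[OF x x, of N "R + 1" R] by simp
  then show "\<xi> \<in> shadow g r" using R by blast
qed

lemma open_shadow_open: "open_shadow g r \<in> bndry_open \<Sigma>"
proof -
  have "\<exists>R::real. {\<eta>\<in>bndry \<Sigma>. gprodB \<Sigma> \<xi> \<eta> > ereal R} \<subseteq> open_shadow g r" if "\<xi> \<in> open_shadow g r" for \<xi>
  proof -
    obtain R where R: "\<xi> \<in> bndry \<Sigma>" "{\<eta>\<in>bndry \<Sigma>. gprodB \<Sigma> \<xi> \<eta> > ereal R} \<subseteq> shadow g r"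
      using \<open>\<xi> \<in> open_shadow g r\<close> unfolding open_shadow_def by blast
    \<comment> \<open>Neighbourhoods of \<open>\<xi>\<close> and of \<open>\<eta>\<close> are
      composed: \<open>2 * \<delta>\<close> pays for two uses of hyperbolicity, and the 1 keeps the
      final inequality strict.\<close>
    define K where "K = R + 1 + 2 * \<delta>"
    have "\<zeta> \<in> shadow g r" if \<eta>: "\<eta> \<in> bndry \<Sigma>" "ereal K < gprodB \<Sigma> \<xi> \<eta>"
      and \<zeta>: "\<zeta> \<in> bndry \<Sigma>" "ereal K < gprodB \<Sigma> \<eta> \<zeta>" for \<eta> \<zeta>
    proof -
      obtain x y n where xy: "x \<in> \<xi>" "y \<in> \<eta>" and n: "\<And>i j. n \<le> i \<Longrightarrow> n \<le> j \<Longrightarrow> K \<le> gp 0 (x i) (y j)"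
        using gprodB_gtD[OF \<eta>(2)] by blast
      obtain y' z n' where yz: "y' \<in> \<eta>" "z \<in> \<zeta>" and n': "\<And>i j. n' \<le> i \<Longrightarrow> n' \<le> j \<Longrightarrow> K \<le> gp 0 (y' i) (z j)"
        using gprodB_gtD[OF \<zeta>(2)] by blast
      obtain n'' where n'': "\<And>i j. n'' \<le> i \<Longrightarrow> n'' \<le> j \<Longrightarrow> K \<le> gp 0 (y i) (y' j)"
        using bndry_equiv[OF \<eta>(1) xy(2) yz(1)] by blast
      define m where "m = max n (max n' n'')"
      have "R + 1 \<le> gp 0 (x i) (z j)" if "m \<le> i" "m \<le> j" for i j
      proof -
        have "K - \<delta> \<le> gp 0 (x i) (y' m)"
          by (rule gp_hyp2[OF n n'']) (use that in \<open>auto simp: m_def\<close>)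
        moreover have "K - \<delta> \<le> gp 0 (y' m) (z j)"
          using n'[of m j] that delta_nonneg unfolding m_def by fastforce
        ultimately have "K - \<delta> - \<delta> \<le> gp 0 (x i) (z j)" by (rule gp_hyp2)
        then show ?thesis by (simp add: K_def)
      qed
      then have "ereal R < gprodB \<Sigma> \<xi> \<zeta>" using gprodB_gtI[OF xy(1) yz(2), of m "R + 1" R] by simp
      then show ?thesis using R(2) \<zeta>(1) by blast
    qed
    then show ?thesis unfolding open_shadow_def by blast
  qed
  then show ?thesis unfolding bndry_open_def by (auto simp: open_shadow_def)
qed

lemma space_Bnd [simp]: "space (Bnd \<Sigma>) = bndry \<Sigma>"
  by (simp add: Bnd_def space_measure_of_conv)

lemma sets_open_shadow: "open_shadow g r \<in> sets (Bnd \<Sigma>)"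
proof -
  have "bndry_open \<Sigma> \<subseteq> Pow (bndry \<Sigma>)" by (auto simp: bndry_open_def)
  then show ?thesis using open_shadow_open by (simp add: Bnd_def)
qed

text \<open>Both \<open>g\<close> and \<open>h\<close> have product at least \<open>K\<close> with
  the ray to \<open>\<xi>\<close>, hence at least \<open>K - 2 * \<delta>\<close> with each other.
  Points of equal length \<open>K + r\<close> with such a product are close.\<close>

lemma shadow_near:
  assumes "\<xi> \<in> shadow g r" "\<xi> \<in> shadow h r" "len g = len h"
  shows "d g h \<le> 2 * r + 4 * \<delta>"
proof -
  define K where "K = real (len g) - r"
  obtain x N where \<xi>: "\<xi> \<in> bndry \<Sigma>" "x \<in> \<xi>" and N: "\<And>j. N \<le> j \<Longrightarrow> gp g 0 (x j) \<le> r"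
    using assms(1) unfolding shadow_def by blast
  obtain y N' where y: "y \<in> \<xi>" and N': "\<And>j. N' \<le> j \<Longrightarrow> gp h 0 (y j) \<le> r"
    using assms(2) unfolding shadow_def by blast
  obtain n where n: "\<And>i j. n \<le> i \<Longrightarrow> n \<le> j \<Longrightarrow> K \<le> gp 0 (x i) (y j)"
    using bndry_equiv[OF \<xi> y] by blast
  define m where "m = max n (max N N')"
  have "K \<le> gp 0 g (x m)" using N[of m] gp_swap[of 0 g "x m"] by (simp add: m_def K_def)
  moreover have "K \<le> gp 0 (x m) (y m)" using n by (simp add: m_def)
  ultimately have 1: "K - \<delta> \<le> gp 0 g (y m)" by (rule gp_hyp2)
  have "K \<le> gp 0 (y m) h"
    using N'[of m] gp_swap[of 0 h "y m"] gp_commute[of 0 h "y m"] assms(3) unfolding m_def K_def by fastforce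
  then have "K - \<delta> \<le> gp 0 (y m) h" using delta_nonneg by simp
  with 1 have "K - \<delta> - \<delta> \<le> gp 0 g h" by (rule gp_hyp2)
  then show ?thesis unfolding gp_def K_def using assms(3) by simp
qed

text \<open>Translating one such point to the origin places all the others in a ball, whose size
  depends neither on \<open>l\<close> nor on \<open>\<xi>\<close>.\<close>

lemma shadow_count:
  defines "b \<equiv> \<lambda>r. {h. len h \<le> nat \<lfloor>2 * r + 4 * \<delta>\<rfloor>}"
  shows "finite {g. len g = l \<and> \<xi> \<in> shadow g r} \<and> card {g. len g = l \<and> \<xi> \<in> shadow g r} \<le> card (b r)"
proof (cases "{g. len g = l \<and> \<xi> \<in> shadow g r} = {}")
  case False
  let ?G = "{g. len g = l \<and> \<xi> \<in> shadow g r}"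
  obtain g0 where g0: "g0 \<in> ?G" using False by blast
  have "(\<lambda>g. - g0 + g) ` ?G \<subseteq> b r"
  proof
    fix h assume "h \<in> (\<lambda>g. - g0 + g) ` ?G"
    then obtain g where "h = - g0 + g" "g \<in> ?G" by blast
    then have "real (len h) \<le> 2 * r + 4 * \<delta>"
      using shadow_near[of \<xi> g0 r g] g0 by (simp add: dG_def)
    then show "h \<in> b r" unfolding b_def by (simp add: le_nat_iff le_floor_iff nat_le_iff)
  qed
  moreover have "inj_on (\<lambda>g. - g0 + g) ?G" by (auto simp: inj_on_def)
  moreover have "finite (b r)" unfolding b_def by (rule finite_ball)
  ultimately show ?thesis
    using card_inj_on_le inj_on_finite by meson
next
  case True
  then show ?thesis by (simp only: finite.emptyI card.empty le0 simp_thms)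
qed

end

section \<open>Entropy and codes\<close>

text \<open>An enumeration of the countable type turns the inner integral into a series, and the
  interchange becomes monotone convergence for an arbitrary measure \<open>M\<close>.\<close>

lemma nn_integral_count_space_swap:
  fixes f :: "'x \<Rightarrow> 'w \<Rightarrow> ennreal"
  assumes c: "countable (UNIV :: 'x set)" and f: "\<And>x. f x \<in> borel_measurable M"
  shows "(\<integral>\<^sup>+ w. (\<integral>\<^sup>+ x. f x w \<partial>count_space UNIV) \<partial>M) = (\<integral>\<^sup>+ x. (\<integral>\<^sup>+ w. f x w \<partial>M) \<partial>count_space UNIV)"
proof -
  \<comment> \<open>The codes actually used: the type may be finite, and the series runs over all
    naturals.\<close>
  define A where "A = to_nat_on (UNIV :: 'x set) ` UNIV"
  have inj: "inj_on (from_nat_into (UNIV :: 'x set)) A"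
    using c by (auto simp: A_def inj_on_def)
  have img: "from_nat_into (UNIV :: 'x set) ` A = UNIV"
    using c by (auto simp: A_def image_image)
  have *: "(\<integral>\<^sup>+ x. h x \<partial>count_space UNIV) = (\<Sum>i. h (from_nat_into UNIV i) * indicator A i)" for h :: "'x \<Rightarrow> ennreal"
  proof -
    have "(\<integral>\<^sup>+ x. h x \<partial>count_space UNIV) = (\<integral>\<^sup>+ i. h (from_nat_into UNIV i) \<partial>count_space A)"
      using nn_integral_bij_count_space[of "from_nat_into UNIV" A UNIV h] inj img by (simp add: bij_betw_def)
    also have "\<dots> = (\<integral>\<^sup>+ i. h (from_nat_into UNIV i) * indicator A i \<partial>count_space UNIV)"
      by (rule nn_integral_count_space_indicator) simp
    also have "\<dots> = (\<Sum>i. h (from_nat_into UNIV i) * indicator A i)"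
      by (rule nn_integral_count_space_nat)
    finally show ?thesis .
  qed
  have "(\<integral>\<^sup>+ w. (\<Sum>i. f (from_nat_into UNIV i) w * indicator A i) \<partial>M) =
      (\<Sum>i. \<integral>\<^sup>+ w. f (from_nat_into UNIV i) w * indicator A i \<partial>M)"
    by (rule nn_integral_suminf) (use f in measurable)
  also have "\<dots> = (\<Sum>i. (\<integral>\<^sup>+ w. f (from_nat_into UNIV i) w \<partial>M) * indicator A i)"
    by (intro suminf_cong nn_integral_multc f)
  finally show ?thesis unfolding * .
qed

lemma nn_integral_count_space_swap':
  fixes f :: "'x \<Rightarrow> 'y \<Rightarrow> ennreal"
  shows "(\<integral>\<^sup>+ x. \<integral>\<^sup>+ y. f x y \<partial>count_space UNIV \<partial>count_space UNIV) =
         (\<integral>\<^sup>+ y. \<integral>\<^sup>+ x. f x y \<partial>count_space UNIV \<partial>count_space UNIV)"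
  using nn_integral_fst_count_space[of "\<lambda>(x, y). f x y"] nn_integral_snd_count_space[of "\<lambda>(x, y). f x y"] by simp

lemma nn_integral_discrete:
  fixes X :: "'w \<Rightarrow> 'x"
  assumes c: "countable (UNIV :: 'x set)" and X: "\<And>x. {w \<in> space M. X w = x} \<in> sets M"
  shows "(\<integral>\<^sup>+ w. f (X w) \<partial>M) = (\<integral>\<^sup>+ x. f x * emeasure M {w \<in> space M. X w = x} \<partial>count_space UNIV)"
proof -
  have "(\<integral>\<^sup>+ w. f (X w) \<partial>M) = (\<integral>\<^sup>+ w. (\<integral>\<^sup>+ x. f x * indicator {w \<in> space M. X w = x} w \<partial>count_space UNIV) \<partial>M)"
  proof (rule nn_integral_cong)
    fix w assume w: "w \<in> space M"
    have "(\<integral>\<^sup>+ x. f x * indicator {w \<in> space M. X w = x} w \<partial>count_space UNIV) =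
        (\<integral>\<^sup>+ x. f x * indicator {X w} x \<partial>count_space UNIV)"
      using w by (intro nn_integral_cong) (auto split: split_indicator)
    also have "\<dots> = f (X w)" by simp
    finally show "f (X w) = (\<integral>\<^sup>+ x. f x * indicator {w \<in> space M. X w = x} w \<partial>count_space UNIV)" ..
  qed
  also have "\<dots> = (\<integral>\<^sup>+ x. (\<integral>\<^sup>+ w. f x * indicator {w \<in> space M. X w = x} w \<partial>M) \<partial>count_space UNIV)"
    by (rule nn_integral_count_space_swap[OF c]) (use X in measurable)
  also have "\<dots> = (\<integral>\<^sup>+ x. f x * emeasure M {w \<in> space M. X w = x} \<partial>count_space UNIV)"
    by (intro nn_integral_cong nn_integral_cmult_indicator X)
  finally show ?thesis .
qed

lemma countable_option_lists:
  assumes "countable (UNIV :: 'x set)"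
  shows "countable (UNIV :: 'x option list set)"
proof -
  have "(UNIV :: 'x option set) = insert None (Some ` UNIV)" by (rule UNIV_option_conv)
  then have "countable (UNIV :: 'x option set)" using assms by (metis countable_image countable_insert)
  then show ?thesis using countable_lists lists_UNIV by metis
qed

text \<open>The inequality \<open>ln t \<le> t - 1\<close>, with all terms moved to the side where they are nonnegative.\<close>

lemma gibbs_term:
  fixes p q s :: real
  assumes "0 \<le> p" "p \<le> s" "s \<le> 1" "0 < p \<Longrightarrow> 0 < q" "0 \<le> q"
  shows "p * (- ln s) + p \<le> p * (- ln q) + q"
proof (cases "p = 0")
  case False
  then have p: "0 < p" and q: "0 < q" using assms by auto
  have "ln p \<le> ln s" using p assms(2) by simp
  have "ln (q / p) \<le> q / p - 1" using p q by (intro ln_le_minus_one) simp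
  then have "p * ln (q / p) \<le> p * (q / p - 1)" using p by (intro mult_left_mono) auto
  moreover have "p * (q / p - 1) = q - p" using p by (simp add: field_simps)
  ultimately have "p * (ln q - ln p) \<le> q - p" using p q by (simp add: ln_div)
  moreover have "p * ln p \<le> p * ln s" using \<open>ln p \<le> ln s\<close> p by (intro mult_left_mono) auto
  ultimately show ?thesis by (simp add: algebra_simps)
qed (use assms in simp)

text \<open>Encode \<open>X\<close> by an optimal code for \<open>Y\<close>, followed by the index of \<open>X\<close> in \<open>cand Y\<close>.\<close>

lemma (in prob_space) entropy_le_code:
  fixes X :: "'a \<Rightarrow> 'x" and Y :: "'a \<Rightarrow> 'y" and q :: "'y pmf"
  assumes cX: "countable (UNIV :: 'x set)" and cY: "countable (UNIV :: 'y set)"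
    and meas: "\<And>x y. {w \<in> space M. X w = x \<and> Y w = y} \<in> sets M"
    and cand: "\<And>y. finite (cand y)" "\<And>y. real (card (cand y)) \<le> N" and N: "1 \<le> N"
    and supp: "\<And>x y. prob {w \<in> space M. X w = x \<and> Y w = y} \<noteq> 0 \<Longrightarrow> x \<in> cand y \<and> 0 < pmf q y"
  shows "(\<integral>\<^sup>+ x. ennreal (let p = prob {w \<in> space M. X w = x} in - p * ln p) \<partial>count_space UNIV)
    \<le> (\<integral>\<^sup>+ x. \<integral>\<^sup>+ y. ennreal (prob {w \<in> space M. X w = x \<and> Y w = y}) * ennreal (- ln (pmf q y) + ln N)
        \<partial>count_space UNIV \<partial>count_space UNIV)" (is "?H \<le> ?R")
proof -
  define P where "P = (\<lambda>x. prob {w \<in> space M. X w = x})"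
  define J where "J = (\<lambda>x y. prob {w \<in> space M. X w = x \<and> Y w = y})"
  \<comment> \<open>Draw \<open>y\<close> from \<open>q\<close>, then choose uniformly in
    \<open>cand y\<close>, with \<open>N\<close> in place of the number of candidates. The total
    mass is at most 1, so this is an admissible code for the pair.\<close>
  define Q where "Q = (\<lambda>x y. pmf q y / N * indicator (cand y) x)"
  have XE: "{w \<in> space M. X w = x} = (\<Union>y. {w \<in> space M. X w = x \<and> Y w = y})" for x by auto
  have measX: "{w \<in> space M. X w = x} \<in> sets M" for x
    unfolding XE using cY meas by (intro sets.countable_UN'') auto
  have sumJ: "ennreal (P x) = (\<integral>\<^sup>+ y. ennreal (J x y) \<partial>count_space UNIV)" for x
  proof -
    have "emeasure M {w \<in> space M. X w = x} = (\<integral>\<^sup>+ y. emeasure M {w \<in> space M. X w = x \<and> Y w = y} \<partial>count_space UNIV)"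
      unfolding XE using cY meas by (intro emeasure_UN_countable) (auto simp: disjoint_family_on_def)
    then show ?thesis by (simp add: P_def J_def emeasure_eq_measure)
  qed
  have sumP: "(\<integral>\<^sup>+ x. ennreal (P x) \<partial>count_space UNIV) = 1"
    using nn_integral_discrete[OF cX measX, of "\<lambda>_. 1"] by (simp add: P_def emeasure_eq_measure emeasure_space_1[simplified emeasure_eq_measure])
  have PJ: "0 \<le> J x y" "J x y \<le> P x" "P x \<le> 1" for x y
    unfolding P_def J_def using measX by (auto intro!: finite_measure_mono)
  have le_term: "ennreal (J x y) * ennreal (- ln (P x)) + ennreal (J x y)
      \<le> ennreal (J x y) * ennreal (- ln (pmf q y) + ln N) + ennreal (Q x y)" for x y
  proof (cases "J x y = 0")
    case False
    then have J: "0 < J x y" using PJ(1)[of x y] by simp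
    have s: "x \<in> cand y" "0 < pmf q y" using supp[of x y] False by (simp_all add: J_def)
    have Q: "Q x y = pmf q y / N" using s by (simp add: Q_def)
    \<comment> \<open>Taking \<open>s = P x\<close>, which dominates \<open>J x y\<close>, includes
      the step from the entropy of \<open>X\<close> to that of the pair.\<close>
    have "J x y * (- ln (P x)) + J x y \<le> J x y * (- ln (Q x y)) + Q x y"
      by (rule gibbs_term) (use PJ s N Q in auto)
    moreover have "- ln (Q x y) = - ln (pmf q y) + ln N" using s N by (simp add: Q ln_div)
    ultimately have le: "J x y * a + J x y \<le> J x y * b + Q x y"
      if "a = - ln (P x)" "b = - ln (pmf q y) + ln N" for a b using that by simp
    have "ennreal (J x y) * ennreal a + ennreal (J x y) \<le> ennreal (J x y) * ennreal b + ennreal (Q x y)"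
      if ab: "a = - ln (P x)" "b = - ln (pmf q y) + ln N" for a b
    proof -
      have "0 \<le> a" using PJ(2)[of x y] PJ(3)[of x] J ab by simp
      moreover have "ln (pmf q y) \<le> 0" "0 \<le> ln N" using s N pmf_le_1[of q y] by simp_all
      then have "0 \<le> b" using ab by simp
      moreover have "0 \<le> Q x y" using s N Q by simp
      moreover have "ennreal (J x y * a + J x y) \<le> ennreal (J x y * b + Q x y)"
        by (rule ennreal_leI[OF le[OF ab]])
      ultimately show ?thesis using PJ(1)[of x y] by (simp add: ennreal_mult)
    qed
    then show ?thesis by blast
  qed simp
  \<comment> \<open>The total mass 1 of \<open>P\<close> on the left and the mass at most 1 of
    \<open>Q\<close> on the right replace a subtraction in \<open>ennreal\<close>; the 1 cancels at
    the end.\<close>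
  have "?H + 1 = (\<integral>\<^sup>+ x. ennreal (P x) * ennreal (- ln (P x)) \<partial>count_space UNIV) + (\<integral>\<^sup>+ x. ennreal (P x) \<partial>count_space UNIV)"
  proof -
    have "ennreal (let p = P x in - p * ln p) = ennreal (P x) * ennreal (- ln (P x))" for x
    proof -
      have "0 \<le> P x" by (simp add: P_def)
      have "(let p = P x in - p * ln p) = P x * (- ln (P x))" by (simp add: Let_def)
      then show ?thesis using \<open>0 \<le> P x\<close> by (simp only: ennreal_mult')
    qed
    then show ?thesis unfolding sumP by (simp only: P_def)
  qed
  also have "\<dots> = (\<integral>\<^sup>+ x. ennreal (P x) * ennreal (- ln (P x)) + ennreal (P x) \<partial>count_space UNIV)"
    by (simp add: nn_integral_add)
  also have "\<dots> = (\<integral>\<^sup>+ x. \<integral>\<^sup>+ y. ennreal (J x y) * ennreal (- ln (P x)) + ennreal (J x y) \<partial>count_space UNIV \<partial>count_space UNIV)"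
    by (simp add: sumJ nn_integral_add nn_integral_multc)
  also have "\<dots> \<le> (\<integral>\<^sup>+ x. \<integral>\<^sup>+ y. ennreal (J x y) * ennreal (- ln (pmf q y) + ln N) + ennreal (Q x y) \<partial>count_space UNIV \<partial>count_space UNIV)"
    by (intro nn_integral_mono le_term)
  also have "\<dots> = ?R + (\<integral>\<^sup>+ x. \<integral>\<^sup>+ y. ennreal (Q x y) \<partial>count_space UNIV \<partial>count_space UNIV)"
    by (simp add: nn_integral_add J_def)
  finally have "?H + 1 \<le> ?R + (\<integral>\<^sup>+ x. \<integral>\<^sup>+ y. ennreal (Q x y) \<partial>count_space UNIV \<partial>count_space UNIV)" .
  moreover have "(\<integral>\<^sup>+ x. \<integral>\<^sup>+ y. ennreal (Q x y) \<partial>count_space UNIV \<partial>count_space UNIV) \<le> 1"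
  proof -
    have "(\<integral>\<^sup>+ x. ennreal (Q x y) \<partial>count_space UNIV) \<le> ennreal (pmf q y)" for y
    proof -
      have "(\<integral>\<^sup>+ x. ennreal (Q x y) \<partial>count_space UNIV) = (\<integral>\<^sup>+ x. ennreal (pmf q y / N) * indicator (cand y) x \<partial>count_space UNIV)"
        by (intro nn_integral_cong) (auto simp: Q_def split: split_indicator)
      also have "\<dots> = ennreal (pmf q y / N) * of_nat (card (cand y))"
        using cand(1) by (simp add: nn_integral_cmult_indicator)
      also have "\<dots> = ennreal (pmf q y / N * real (card (cand y)))"
        using N by (subst ennreal_mult) (simp_all add: ennreal_of_nat_eq_real_of_nat)
      also have "\<dots> \<le> ennreal (pmf q y / N * N)"
        using cand(2)[of y] N by (intro ennreal_leI mult_left_mono) auto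
      finally show ?thesis using N by simp
    qed
    then have "(\<integral>\<^sup>+ y. \<integral>\<^sup>+ x. ennreal (Q x y) \<partial>count_space UNIV \<partial>count_space UNIV) \<le> (\<integral>\<^sup>+ y. ennreal (pmf q y) \<partial>count_space UNIV)"
      by (intro nn_integral_mono)
    also have "\<dots> = 1" by (rule nn_integral_pmf_eq_1)
    finally show ?thesis by (subst nn_integral_count_space_swap')
  qed
  ultimately have "?H + 1 \<le> ?R + 1" by (meson add_left_mono order_trans)
  then show ?thesis by (simp add: add.commute[of _ 1] ennreal_add_left_cancel_le)
qed

lemma pmf_replicate:
  "pmf (replicate_pmf n p) xs = (if length xs = n then prod_list (map (pmf p) xs) else 0)"
proof (induction n arbitrary: xs)
  case 0
  then show ?case by (simp add: indicator_def)
next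
  case (Suc n)
  have eq: "replicate_pmf (Suc n) p = map_pmf (\<lambda>(x, xs). x # xs) (pair_pmf p (replicate_pmf n p))"
    by (simp add: pair_pmf_def map_bind_pmf)
  have inj: "inj (\<lambda>(x, xs). x # xs)" by (auto simp: inj_def)
  show ?case
  proof (cases xs)
    case Nil
    have "[] \<notin> set_pmf (replicate_pmf (Suc n) p)" by (simp add: set_replicate_pmf)
    then show ?thesis using Nil by (simp add: set_pmf_iff del: replicate_pmf.simps)
  next
    case (Cons x ys)
    have "pmf (replicate_pmf (Suc n) p) ((\<lambda>(x, xs). x # xs) (x, ys)) = pmf (pair_pmf p (replicate_pmf n p)) (x, ys)"
      unfolding eq by (rule pmf_map_inj'[OF inj])
    then show ?thesis using Suc.IH[of ys] Cons by (simp add: pmf_pair del: replicate_pmf.simps)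
  qed
qed

text \<open>A code for one entry of the recording. An omitted increment costs
  \<open>- ln (1 - p)\<close>; a recorded one costs \<open>- ln p\<close> on top of its own
  information under \<open>\<theta>\<close>. As only an upper bound is sought, \<open>p\<close> need
  not be the true frequency.\<close>

definition code_pmf :: "real \<Rightarrow> 'x pmf \<Rightarrow> 'x option pmf" where
  "code_pmf p \<theta> = bind_pmf (bernoulli_pmf p) (\<lambda>b. if b then map_pmf Some \<theta> else return_pmf None)"

lemma pmf_code_None: "0 \<le> p \<Longrightarrow> p \<le> 1 \<Longrightarrow> pmf (code_pmf p \<theta>) None = 1 - p"
  by (simp add: code_pmf_def pmf_bind pmf_map vimage_def)

lemma pmf_code_Some: "0 \<le> p \<Longrightarrow> p \<le> 1 \<Longrightarrow> pmf (code_pmf p \<theta>) (Some g) = p * pmf \<theta> g"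
  by (simp add: code_pmf_def pmf_bind pmf_map_inj')

section \<open>Recording the walk outside good steps\<close>

context tight_walk
begin

lemma emeasure_snth: "emeasure (pathsp \<theta>) {\<omega>. \<omega> !! i \<in> A} = emeasure (measure_pmf \<theta>) A"
proof -
  have "emeasure (pathsp \<theta>) {\<omega>. \<omega> !! i \<in> A} = emeasure (pathsp \<theta>) {\<omega>. (\<lambda>l. l ! i \<in> A) (stake (Suc i) \<omega>)}"
    by (simp add: stake_nth del: stake.simps)
  also have "\<dots> = emeasure (measure_pmf (replicate_pmf (Suc i) \<theta>)) {l. l ! i \<in> A}"
    by (rule emeasure_stake)
  also have "\<dots> = (\<integral>\<^sup>+ xs. emeasure (measure_pmf (map_pmf (\<lambda>x. xs @ [x]) \<theta>)) {l. l ! i \<in> A} \<partial>measure_pmf (replicate_pmf i \<theta>))"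
    unfolding replicate_pmf_snoc by (rule emeasure_bind_pmf)
  also have "\<dots> = (\<integral>\<^sup>+ xs. emeasure (measure_pmf \<theta>) A \<partial>measure_pmf (replicate_pmf i \<theta>))"
  proof (rule nn_integral_cong_AE, rule AE_pmfI)
    fix xs assume "xs \<in> set_pmf (replicate_pmf i \<theta>)"
    then have "(\<lambda>x. xs @ [x]) -` {l. l ! i \<in> A} = A"
      by (auto simp: nth_append dest: length_replicate_pmf)
    then show "emeasure (measure_pmf (map_pmf (\<lambda>x. xs @ [x]) \<theta>)) {l. l ! i \<in> A} = emeasure (measure_pmf \<theta>) A"
      by simp
  qed
  finally show ?thesis by simp
qed

lemma measurable_snth': "(\<lambda>\<omega>. \<omega> !! i) \<in> measurable (pathsp \<theta>) (measure_pmf \<theta>)"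
  unfolding pathsp_def by (rule measurable_snth)

lemma nn_integral_snth: "(\<integral>\<^sup>+ \<omega>. f (\<omega> !! i) \<partial>pathsp \<theta>) = (\<integral>\<^sup>+ g. f g \<partial>measure_pmf \<theta>)"
proof -
  have "distr (pathsp \<theta>) (measure_pmf \<theta>) (\<lambda>\<omega>. \<omega> !! i) = measure_pmf \<theta>"
    using measurable_snth' emeasure_snth
    by (intro measure_eqI) (auto simp: emeasure_distr vimage_def)
  then show ?thesis
    using nn_integral_distr[OF measurable_snth', of f i] by simp
qed

definition rec_at :: "real \<Rightarrow> nat \<Rightarrow> nat \<Rightarrow> 'a stream \<Rightarrow> 'a option" where
  "rec_at R M i \<omega> = (if good R i \<omega> \<and> good R (Suc i) \<omega> \<and> len (\<omega> !! i) \<le> M then None else Some (\<omega> !! i))"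

definition recording :: "real \<Rightarrow> nat \<Rightarrow> nat \<Rightarrow> 'a stream \<Rightarrow> 'a option list" where
  "recording R M n \<omega> = map (\<lambda>i. rec_at R M i \<omega>) [0..<n]"

lemma recording_Suc: "recording R M (Suc n) \<omega> = recording R M n \<omega> @ [rec_at R M n \<omega>]"
  by (simp add: recording_def)

lemma sets_rec_None: "{\<omega>. rec_at R M i \<omega> = None} \<in> sets (pathsp \<theta>)"
proof -
  have "{\<omega>. rec_at R M i \<omega> = None} = {\<omega>. good R i \<omega>} \<inter> ({\<omega>. good R (Suc i) \<omega>} \<inter> {\<omega>. \<omega> !! i \<in> {g. len g \<le> M}})"
    by (auto simp: rec_at_def)
  also have "\<dots> \<in> sets (pathsp \<theta>)" by (intro sets.Int sets_good sets_snth)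
  finally show ?thesis .
qed

lemma sets_rec_at: "{\<omega>. rec_at R M i \<omega> = x} \<in> sets (pathsp \<theta>)"
proof (cases x)
  case None
  then show ?thesis using sets_rec_None by simp
next
  case (Some g)
  have "{\<omega>. rec_at R M i \<omega> = x} = - {\<omega>. rec_at R M i \<omega> = None} \<inter> {\<omega>. \<omega> !! i \<in> {g}}"
    using Some by (auto simp: rec_at_def)
  then show ?thesis by (simp only: sets.Int Compl_sets sets_rec_None sets_snth)
qed

lemma sets_walk_recording: "{\<omega>. walk n \<omega> = g \<and> recording R M n \<omega> = r} \<in> sets (pathsp \<theta>)"
proof (cases "length r = n")
  case False
  then have empty: "{\<omega>. walk n \<omega> = g \<and> recording R M n \<omega> = r} = {}" by (auto simp: recording_def)
  show ?thesis unfolding empty by simp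
next
  case True
  have "{\<omega>. walk n \<omega> = g \<and> recording R M n \<omega> = r} =
      {\<omega>. (\<lambda>l. sum_list l = g) (stake n \<omega>)} \<inter> (\<Inter>i\<in>{..<n}. {\<omega>. rec_at R M i \<omega> = r ! i})"
    using True by (auto simp: recording_def walk_def list_eq_iff_nth_eq)
  also have "\<dots> \<in> sets (pathsp \<theta>)"
    by (intro sets.Int sets_stake sets.countable_INT'' sets_rec_at UNIV_sets) simp
  finally show ?thesis .
qed

lemma ln_prod_list_upt:
  assumes "\<And>i. i < n \<Longrightarrow> 0 < f i"
  shows "0 < prod_list (map f [0..<n]) \<and> - ln (prod_list (map f [0..<n])) = (\<Sum>i<n. - ln (f i :: real))"
  using assms
proof (induction n)
  case (Suc n)
  then have "0 < prod_list (map f [0..<n])" "- ln (prod_list (map f [0..<n])) = (\<Sum>i<n. - ln (f i))" "0 < f n"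
    by simp_all
  then show ?case by (simp add: ln_mult_pos)
qed simp

text \<open>The entropy is the integral of the information, so dominated convergence applies to its
  tails. This is the uniform integrability that controls recorded increments without
  independence.\<close>

lemma truncated_information:
  assumes "entropy_pmf \<theta> < \<infinity>" and "0 < e"
  shows "\<exists>\<tau>::nat. (\<integral>\<^sup>+ g. ennreal (- ln (pmf \<theta> g)) * indicator {g. real \<tau> < - ln (pmf \<theta> g)} g \<partial>measure_pmf \<theta>) \<le> ennreal e"
proof -
  let ?I = "\<lambda>g. - ln (pmf \<theta> g)"
  let ?u = "\<lambda>\<tau> g. ennreal (?I g) * indicator {g. real \<tau> < ?I g} g"
  have "(\<integral>\<^sup>+ g. ennreal (?I g) \<partial>measure_pmf \<theta>) = entropy_pmf \<theta>"
    unfolding entropy_pmf_def nn_integral_measure_pmf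
    by (intro nn_integral_cong) (simp flip: ennreal_mult')
  then have fin: "(\<integral>\<^sup>+ g. ennreal (?I g) \<partial>measure_pmf \<theta>) < \<infinity>" using assms(1) by simp
  have "(\<lambda>\<tau>. \<integral>\<^sup>+ g. ?u \<tau> g \<partial>measure_pmf \<theta>) \<longlonglongrightarrow> (\<integral>\<^sup>+ g. 0 \<partial>measure_pmf \<theta>)"
  proof (rule nn_integral_dominated_convergence[where w="\<lambda>g. ennreal (?I g)"])
    show "AE g in measure_pmf \<theta>. (\<lambda>\<tau>. ?u \<tau> g) \<longlonglongrightarrow> 0"
    proof (rule AE_I2)
      fix g
      obtain N :: nat where "?I g \<le> real N" using real_arch_simple by blast
      then have "eventually (\<lambda>\<tau>. ?u \<tau> g = 0) sequentially"
        unfolding eventually_sequentially by (intro exI[of _ N]) (auto split: split_indicator)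
      then show "(\<lambda>\<tau>. ?u \<tau> g) \<longlonglongrightarrow> 0" by (rule tendsto_eventually)
    qed
    show "AE g in measure_pmf \<theta>. ?u \<tau> g \<le> ennreal (?I g)" for \<tau>
      by (rule AE_I2) (auto split: split_indicator)
  qed (use fin in auto)
  then have "(\<lambda>\<tau>. \<integral>\<^sup>+ g. ?u \<tau> g \<partial>measure_pmf \<theta>) \<longlonglongrightarrow> 0" by simp
  then have "eventually (\<lambda>\<tau>. (\<integral>\<^sup>+ g. ?u \<tau> g \<partial>measure_pmf \<theta>) < ennreal e) sequentially"
    by (rule order_tendstoD(2)) (use assms(2) in simp)
  then show ?thesis unfolding eventually_sequentially using less_imp_le by blast
qed

text \<open>Three contributions get \<open>e/3\<close> each: the omission symbol, the flag together
  with information up to \<open>\<tau>\<close> for recorded increments, and information beyond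
  \<open>\<tau>\<close>. The choices are made in the order \<open>\<tau>\<close> and
  \<open>p\<close>, then the admissible probability \<open>\<beta>\<close> of recording, then
  \<open>R\<close> and \<open>M\<close>; none depends on \<open>n\<close>.\<close>

lemma recording_cost:
  assumes ent: "entropy_pmf \<theta> < \<infinity>" and "0 < e"
  shows "\<exists>R\<ge>0. \<exists>M q. \<forall>n. (AE \<omega> in pathsp \<theta>. 0 < pmf (replicate_pmf n q) (recording R M n \<omega>)) \<and>
    (\<integral>\<^sup>+ \<omega>. ennreal (- ln (pmf (replicate_pmf n q) (recording R M n \<omega>))) \<partial>pathsp \<theta>) \<le> ennreal (real n * e)"
proof -
  define I where "I = (\<lambda>g. - ln (pmf \<theta> g))"
  have I_nonneg: "0 \<le> I g" for g
    using pmf_le_1[of \<theta> g] pmf_nonneg[of \<theta> g] by (cases "pmf \<theta> g = 0") (simp_all add: I_def)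
  obtain \<tau> :: nat where \<tau>: "(\<integral>\<^sup>+ g. ennreal (I g) * indicator {g. real \<tau> < I g} g \<partial>measure_pmf \<theta>) \<le> ennreal (e/3)"
    using truncated_information[OF ent, of "e/3"] \<open>0 < e\<close> unfolding I_def by auto
  \<comment> \<open>Makes one omission symbol cost exactly \<open>e/3\<close>.\<close>
  define p where "p = 1 - exp (- (e/3))"
  have p: "0 < p" "p < 1" "- ln (1 - p) = e/3" using \<open>0 < e\<close> by (simp_all add: p_def)
  define c where "c = - ln p + real \<tau>"
  have "ln p \<le> 0" using p by simp
  then have c: "0 \<le> c" unfolding c_def by linarith
  define \<beta> where "\<beta> = (e/3) / (c + 1)"
  have \<beta>: "0 < \<beta>" using c \<open>0 < e\<close> by (simp add: \<beta>_def)
  have "c * (e/3) \<le> (c + 1) * (e/3)" using \<open>0 < e\<close> by (intro mult_right_mono) auto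
  then have c\<beta>: "c * \<beta> \<le> e/3" using c by (simp add: \<beta>_def divide_le_eq field_simps)
  obtain R where R: "0 \<le> R" "\<And>k. measure (pathsp \<theta>) {\<omega>. \<not> good R k \<omega>} \<le> \<beta>/3"
    using prob_not_good[of "\<beta>/3"] \<beta> by auto
  obtain M where M: "measure_pmf.prob \<theta> {g. M < len g} \<le> \<beta>/3"
    using pmf_tail_small[of "\<beta>/3" \<theta> len] \<beta> by auto
  define q where "q = code_pmf p \<theta>"
  have q: "pmf q None = 1 - p" "pmf q (Some g) = p * pmf \<theta> g" for g
    using p by (simp_all add: q_def pmf_code_None pmf_code_Some)
  have bad: "measure (pathsp \<theta>) {\<omega>. rec_at R M i \<omega> \<noteq> None} \<le> \<beta>" for i
  proof -
    let ?A = "{\<omega>. \<not> good R i \<omega>}" and ?B = "{\<omega>. \<not> good R (Suc i) \<omega>}" and ?C = "{\<omega>. \<omega> !! i \<in> {g. M < len g}}"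
    have sets: "?A \<in> sets (pathsp \<theta>)" "?B \<in> sets (pathsp \<theta>)" "?C \<in> sets (pathsp \<theta>)"
      using Compl_sets[OF sets_good[of R i]] Compl_sets[OF sets_good[of R "Suc i"]] sets_snth[of i "{g. M < len g}"]
      by (simp_all add: Collect_neg_eq)
    have "{\<omega>. rec_at R M i \<omega> \<noteq> None} = ?A \<union> (?B \<union> ?C)" by (auto simp: rec_at_def)
    then have "measure (pathsp \<theta>) {\<omega>. rec_at R M i \<omega> \<noteq> None} \<le> measure (pathsp \<theta>) ?A + measure (pathsp \<theta>) (?B \<union> ?C)"
      using measure_Un_le sets by (metis sets.Un)
    also have "measure (pathsp \<theta>) (?B \<union> ?C) \<le> measure (pathsp \<theta>) ?B + measure (pathsp \<theta>) ?C"
      using sets by (intro measure_Un_le)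
    also have "measure (pathsp \<theta>) ?C \<le> \<beta>/3"
      using M emeasure_snth[of i "{g. M < len g}"] by (simp add: measure_def)
    finally show ?thesis using R(2)[of i] R(2)[of "Suc i"] by simp
  qed
  have pos: "AE \<omega> in pathsp \<theta>. \<forall>i. 0 < pmf \<theta> (\<omega> !! i)"
  proof (subst AE_all_countable, rule allI)
    fix i
    have "emeasure (pathsp \<theta>) {\<omega>. \<omega> !! i \<in> - set_pmf \<theta>} = 0"
      unfolding emeasure_snth by (simp add: measure_pmf.emeasure_eq_measure measure_pmf_zero_iff)
    then show "AE \<omega> in pathsp \<theta>. 0 < pmf \<theta> (\<omega> !! i)"
      using sets_snth[of i "- set_pmf \<theta>"]
      by (intro AE_I[where N="{\<omega>. \<omega> !! i \<in> - set_pmf \<theta>}"]) (auto simp: pmf_positive_iff)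
  qed
  have "(AE \<omega> in pathsp \<theta>. 0 < pmf (replicate_pmf n q) (recording R M n \<omega>)) \<and>
    (\<integral>\<^sup>+ \<omega>. ennreal (- ln (pmf (replicate_pmf n q) (recording R M n \<omega>))) \<partial>pathsp \<theta>) \<le> ennreal (real n * e)" for n
  proof
    \<comment> \<open>A pointwise majorant for one entry. The first term is charged at every time;
      the last one counts the full information of an increment whose information exceeds
      \<open>\<tau>\<close>.\<close>
    define cost where "cost = (\<lambda>i \<omega>. ennreal (e/3) + (ennreal c * indicator {\<omega>. rec_at R M i \<omega> \<noteq> None} \<omega> +
        ennreal (I (\<omega> !! i)) * indicator {g. real \<tau> < I g} (\<omega> !! i)))"
    have pmf_eq: "pmf (replicate_pmf n q) (recording R M n \<omega>) = prod_list (map (\<lambda>i. pmf q (rec_at R M i \<omega>)) [0..<n])" for \<omega>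
      by (simp add: pmf_replicate recording_def o_def)
    have q_pos: "0 < pmf q (rec_at R M i \<omega>)" if "\<forall>i. 0 < pmf \<theta> (\<omega> !! i)" for \<omega> i
      using that p by (simp add: rec_at_def q)
    show "AE \<omega> in pathsp \<theta>. 0 < pmf (replicate_pmf n q) (recording R M n \<omega>)"
      using pos by eventually_elim (simp add: pmf_eq ln_prod_list_upt q_pos)
    have le: "ennreal (- ln (pmf (replicate_pmf n q) (recording R M n \<omega>))) \<le> (\<Sum>i<n. cost i \<omega>)"
      if w: "\<forall>i. 0 < pmf \<theta> (\<omega> !! i)" for \<omega>
    proof -
      have "ennreal (- ln (pmf (replicate_pmf n q) (recording R M n \<omega>))) = ennreal (\<Sum>i<n. - ln (pmf q (rec_at R M i \<omega>)))"
        using ln_prod_list_upt[of n "\<lambda>i. pmf q (rec_at R M i \<omega>)"] q_pos[OF w] by (simp add: pmf_eq)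
      also have "\<dots> = (\<Sum>i<n. ennreal (- ln (pmf q (rec_at R M i \<omega>))))"
        using q_pos[OF w] pmf_le_1 by (intro sum_ennreal[symmetric]) simp
      also have "\<dots> \<le> (\<Sum>i<n. cost i \<omega>)"
      proof (rule sum_mono)
        fix i
        show "ennreal (- ln (pmf q (rec_at R M i \<omega>))) \<le> cost i \<omega>"
        proof (cases "rec_at R M i \<omega>")
          case None
          then show ?thesis by (simp add: cost_def q p)
        next
          case (Some g)
          then have g: "g = \<omega> !! i" by (auto simp: rec_at_def split: if_splits)
          have "- ln (pmf q (rec_at R M i \<omega>)) = - ln p + I (\<omega> !! i)"
            using spec[OF w, of i] p Some g by (simp add: q I_def ln_mult_pos)
          also have "\<dots> \<le> c + I (\<omega> !! i) * indicator {g. real \<tau> < I g} (\<omega> !! i)"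
            by (auto simp: c_def split: split_indicator)
          finally have "ennreal (- ln (pmf q (rec_at R M i \<omega>))) \<le> ennreal (c + I (\<omega> !! i) * indicator {g. real \<tau> < I g} (\<omega> !! i))"
            by (rule ennreal_leI)
          also have "\<dots> = ennreal c + ennreal (I (\<omega> !! i)) * indicator {g. real \<tau> < I g} (\<omega> !! i)"
            using c I_nonneg by (auto split: split_indicator)
          also have "\<dots> \<le> cost i \<omega>" using Some by (simp add: cost_def)
          finally show ?thesis .
        qed
      qed
      finally show ?thesis .
    qed
    have meas: "cost i \<in> borel_measurable (pathsp \<theta>)" for i
    proof -
      have "{\<omega>. rec_at R M i \<omega> \<noteq> None} \<in> sets (pathsp \<theta>)"
        using Compl_sets[OF sets_rec_None[of R M i]] unfolding Collect_neg_eq[symmetric] .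
      moreover have "(\<lambda>\<omega>. ennreal (I (\<omega> !! i)) * indicator {g. real \<tau> < I g} (\<omega> !! i)) \<in> borel_measurable (pathsp \<theta>)"
        by (rule measurable_compose[OF measurable_snth']) simp
      ultimately show ?thesis unfolding cost_def by measurable
    qed
    have int: "(\<integral>\<^sup>+ \<omega>. cost i \<omega> \<partial>pathsp \<theta>) \<le> ennreal e" for i
    proof -
      have bset: "{\<omega>. rec_at R M i \<omega> \<noteq> None} \<in> sets (pathsp \<theta>)"
        using Compl_sets[OF sets_rec_None[of R M i]] unfolding Collect_neg_eq[symmetric] .
      have m2: "(\<lambda>\<omega>. ennreal (I (\<omega> !! i)) * indicator {g. real \<tau> < I g} (\<omega> !! i)) \<in> borel_measurable (pathsp \<theta>)"
        by (rule measurable_compose[OF measurable_snth']) simp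
      have "(\<integral>\<^sup>+ \<omega>. cost i \<omega> \<partial>pathsp \<theta>) = ennreal (e/3) + (ennreal c * emeasure (pathsp \<theta>) {\<omega>. rec_at R M i \<omega> \<noteq> None} +
          (\<integral>\<^sup>+ g. ennreal (I g) * indicator {g. real \<tau> < I g} g \<partial>measure_pmf \<theta>))"
        unfolding cost_def using bset m2 path.emeasure_space_1
        by (simp add: nn_integral_add nn_integral_cmult_indicator nn_integral_snth[of "\<lambda>g. ennreal (I g) * indicator {g. real \<tau> < I g} g"])
      also have "\<dots> \<le> ennreal (e/3) + (ennreal (e/3) + ennreal (e/3))"
      proof (intro add_mono \<tau> order_refl)
        have "ennreal c * emeasure (pathsp \<theta>) {\<omega>. rec_at R M i \<omega> \<noteq> None} \<le> ennreal c * ennreal \<beta>"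
          unfolding path.emeasure_eq_measure using bad by (intro mult_left_mono ennreal_leI) auto
        also have "\<dots> = ennreal (c * \<beta>)" using c \<beta> by (simp add: ennreal_mult)
        also have "\<dots> \<le> ennreal (e/3)" using c\<beta> by (rule ennreal_leI)
        finally show "ennreal c * emeasure (pathsp \<theta>) {\<omega>. rec_at R M i \<omega> \<noteq> None} \<le> ennreal (e/3)" .
      qed
      also have "\<dots> = ennreal e" using \<open>0 < e\<close> by (simp flip: ennreal_plus)
      finally show ?thesis .
    qed
    have "(\<integral>\<^sup>+ \<omega>. ennreal (- ln (pmf (replicate_pmf n q) (recording R M n \<omega>))) \<partial>pathsp \<theta>) \<le> (\<integral>\<^sup>+ \<omega>. (\<Sum>i<n. cost i \<omega>) \<partial>pathsp \<theta>)"
    proof (rule nn_integral_mono_AE)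
      show "AE \<omega> in pathsp \<theta>. ennreal (- ln (pmf (replicate_pmf n q) (recording R M n \<omega>))) \<le> (\<Sum>i<n. cost i \<omega>)"
        using pos by eventually_elim (rule le)
    qed
    also have "\<dots> = (\<Sum>i<n. \<integral>\<^sup>+ \<omega>. cost i \<omega> \<partial>pathsp \<theta>)"
      using meas by (intro nn_integral_sum)
    also have "\<dots> \<le> (\<Sum>i<n. ennreal e)" by (intro sum_mono int)
    also have "\<dots> = ennreal (real n * e)" using \<open>0 < e\<close> by (simp add: ennreal_mult ennreal_of_nat_eq_real_of_nat)
    finally show "(\<integral>\<^sup>+ \<omega>. ennreal (- ln (pmf (replicate_pmf n q) (recording R M n \<omega>))) \<partial>pathsp \<theta>) \<le> ennreal (real n * e)" .
  qed
  then show ?thesis using R(1) by blast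
qed

end

section \<open>Decoding from the limit point\<close>

context tight_walk
begin

text \<open>The state is a pair \<open>(D, h)\<close>: the walk is at \<open>w + h\<close> for an earlier good position \<open>w\<close> whose
length is approximately \<open>D\<close>.\<close>

definition decode_step :: "nat \<times> 'a \<Rightarrow> 'a option \<Rightarrow> nat \<times> 'a" where
  "decode_step s x = (case x of None \<Rightarrow> (fst s + len (snd s), 0) | Some g \<Rightarrow> (fst s, snd s + g))"

definition decode :: "'a option list \<Rightarrow> nat \<times> 'a" where
  "decode r = foldl decode_step (0, 0) r"

lemma walk_Suc: "walk (Suc n) \<omega> = walk n \<omega> + \<omega> !! n"
  by (simp add: walk_def stake_Suc del: stake.simps)

text \<open>A recorded increment keeps the base \<open>w_k\<close> and extends the known
  displacement \<open>h\<close>. At an omitted one the base moves to the good time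
  \<open>n + 1\<close>: goodness of \<open>k\<close> gives the length of \<open>w_n\<close> as
  \<open>D + len h\<close> up to \<open>2 * R\<close>, and the omitted increment changes it by at
  most \<open>M\<close>. The error thus grows by at most \<open>M + 2 * R\<close> per step.\<close>

lemma decode_recording:
  assumes "0 \<le> R"
  shows "\<exists>k\<le>n. good R k \<omega> \<and> walk n \<omega> = walk k \<omega> + snd (decode (recording R M n \<omega>)) \<and>
    \<bar>real (len (walk k \<omega>)) - real (fst (decode (recording R M n \<omega>)))\<bar> \<le> real n * (real M + 2 * R)"
proof (induction n)
  case 0
  \<comment> \<open>Time 0 is good for every nonnegative \<open>R\<close>, because the product at
    the origin with the origin itself is 0.\<close>
  show ?case using assms by (auto simp: good_def walk_def recording_def decode_def gp_def d_commute)
next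
  case (Suc n)
  define D h where "D = fst (decode (recording R M n \<omega>))" and "h = snd (decode (recording R M n \<omega>))"
  have dec: "decode (recording R M (Suc n) \<omega>) = decode_step (D, h) (rec_at R M n \<omega>)"
    by (simp add: recording_Suc decode_def D_def h_def)
  obtain k where k: "k \<le> n" "good R k \<omega>" "walk n \<omega> = walk k \<omega> + h"
    "\<bar>real (len (walk k \<omega>)) - real D\<bar> \<le> real n * (real M + 2 * R)"
    using Suc.IH unfolding D_def h_def by blast
  show ?case
  proof (cases "rec_at R M n \<omega>")
    case (Some g)
    then have "g = \<omega> !! n" by (auto simp: rec_at_def split: if_splits)
    then have "walk (Suc n) \<omega> = walk k \<omega> + snd (decode (recording R M (Suc n) \<omega>))"
      and "fst (decode (recording R M (Suc n) \<omega>)) = D"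
      using Some k(3) by (simp_all add: dec decode_step_def walk_Suc add.assoc)
    moreover have "real n * (real M + 2 * R) \<le> real (Suc n) * (real M + 2 * R)"
      using assms by (intro mult_right_mono) auto
    ultimately show ?thesis using k by (intro exI[of _ k]) auto
  next
    case None
    then have g: "good R (Suc n) \<omega>" "len (\<omega> !! n) \<le> M" by (auto simp: rec_at_def split: if_splits)
    have "gp (walk k \<omega>) 0 (walk n \<omega>) \<le> R" using k(1,2) by (simp add: good_def)
    moreover have "d (walk n \<omega>) (walk k \<omega>) = len h"
      using d_commute[of "walk n \<omega>" "walk k \<omega>"] by (simp add: k(3) dG_def)
    ultimately have "\<bar>real (len (walk n \<omega>)) - (real (len (walk k \<omega>)) + real (len h))\<bar> \<le> 2 * R"
      using gp_nonneg[of "walk k \<omega>" 0 "walk n \<omega>"] by (simp add: gp_def)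
    moreover have "\<bar>real (len (walk (Suc n) \<omega>)) - real (len (walk n \<omega>))\<bar> \<le> real M"
      using len_add[of "walk n \<omega>" "\<omega> !! n"] len_add[of "walk (Suc n) \<omega>" "- (\<omega> !! n)"] g(2)
      by (simp add: walk_Suc add.assoc)
    ultimately have "\<bar>real (len (walk (Suc n) \<omega>)) - real (D + len h)\<bar> \<le> real (Suc n) * (real M + 2 * R)"
      using k(4) by (simp add: algebra_simps)
    then show ?thesis using g None
      by (intro exI[of _ "Suc n"]) (simp add: dec decode_step_def)
  qed
qed

text \<open>Here \<open>g - snd (decode r)\<close> is the good base position from which
  \<open>g\<close> is reached by the recorded displacement; \<open>B\<close> is an integer bound for
  \<open>M + 2 * R\<close>. The open shadow makes the dependence on \<open>\<xi>\<close>
  measurable.\<close>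

definition candidates :: "real \<Rightarrow> nat \<Rightarrow> nat \<Rightarrow> 'a option list \<Rightarrow> (nat \<Rightarrow> 'a) set \<Rightarrow> 'a set" where
  "candidates R B n r \<xi> = {g. \<bar>real (len (g - snd (decode r))) - real (fst (decode r))\<bar> \<le> real (n * B) \<and>
     \<xi> \<in> open_shadow (g - snd (decode r)) (R + \<delta>)}"

lemma candidates_card:
  fixes R :: real
  defines "b \<equiv> card {h. len h \<le> nat \<lfloor>2 * (R + \<delta>) + 4 * \<delta>\<rfloor>}"
  shows "finite (candidates R B n r \<xi>) \<and> real (card (candidates R B n r \<xi>)) \<le> real ((2 * n * B + 1) * b)"
proof -
  define D h where "D = fst (decode r)" and "h = snd (decode r)"
  define L where "L = {D - n * B..D + n * B}"
  define G where "G = (\<lambda>l. {g. len g = l \<and> \<xi> \<in> shadow g (R + \<delta>)})"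
  have G: "finite (G l)" "card (G l) \<le> b" for l
    using shadow_count[of l \<xi> "R + \<delta>"] by (simp_all add: G_def b_def)
  have sub: "(\<lambda>g. g - h) ` candidates R B n r \<xi> \<subseteq> (\<Union>l\<in>L. G l)"
  proof
    fix g assume "g \<in> (\<lambda>g. g - h) ` candidates R B n r \<xi>"
    then have g: "\<bar>real (len g) - real D\<bar> \<le> real (n * B)" "\<xi> \<in> shadow g (R + \<delta>)"
      using open_shadow_subset by (auto simp: candidates_def D_def h_def)
    then have "len g \<in> L" unfolding L_def atLeastAtMost_iff by linarith
    then show "g \<in> (\<Union>l\<in>L. G l)" using g(2) by (auto simp: G_def)
  qed
  have inj: "inj_on (\<lambda>g. g - h) (candidates R B n r \<xi>)" by (auto simp: inj_on_def)
  have fin: "finite (\<Union>l\<in>L. G l)" using G by (simp add: L_def)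
  have "card (candidates R B n r \<xi>) \<le> card (\<Union>l\<in>L. G l)"
    by (rule card_inj_on_le[OF inj sub fin])
  also have "\<dots> \<le> (\<Sum>l\<in>L. card (G l))" by (rule card_UN_le) (simp add: L_def)
  also have "\<dots> \<le> (\<Sum>l\<in>L. b)" by (intro sum_mono G)
  also have "\<dots> = card L * b" by simp
  also have "\<dots> \<le> (2 * n * B + 1) * b" by (intro mult_right_mono) (auto simp: L_def)
  finally have "card (candidates R B n r \<xi>) \<le> (2 * n * B + 1) * b" .
  then show ?thesis using inj_on_finite[OF inj sub fin] of_nat_mono by blast
qed

lemma walk_in_candidates:
  assumes "0 \<le> R" "real M + 2 * R \<le> real B" "conv_infty \<Sigma> (\<lambda>n. walk n \<omega>)"
  shows "walk n \<omega> \<in> candidates R B n (recording R M n \<omega>) (bnd_lim \<Sigma> \<omega>)"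
proof -
  obtain k where k: "k \<le> n" "good R k \<omega>" "walk n \<omega> = walk k \<omega> + snd (decode (recording R M n \<omega>))"
    "\<bar>real (len (walk k \<omega>)) - real (fst (decode (recording R M n \<omega>)))\<bar> \<le> real n * (real M + 2 * R)"
    using decode_recording[OF assms(1)] by blast
  \<comment> \<open>Goodness of \<open>k\<close> is exactly the shadow condition, with the walk
    itself as the sequence representing the limit point.\<close>
  have "bnd_lim \<Sigma> \<omega> \<in> shadow (walk k \<omega>) R"
    unfolding shadow_def mem_Collect_eq
    by (intro conjI bexI[of _ "\<lambda>n. walk n \<omega>"] exI[of _ k])
      (use bnd_lim_conv[OF assms(3)] k(2) in \<open>simp_all add: good_def\<close>)
  then have "bnd_lim \<Sigma> \<omega> \<in> open_shadow (walk k \<omega>) (R + \<delta>)" using shadow_subset_open_shadow by blast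
  moreover have "real n * (real M + 2 * R) \<le> real (n * B)" using assms(2) by (simp add: mult_left_mono)
  moreover have "walk n \<omega> - snd (decode (recording R M n \<omega>)) = walk k \<omega>" using k(3) by simp
  ultimately show ?thesis using k(4) by (simp add: candidates_def)
qed

text \<open>The default value in \<open>bnd_lim\<close> lies in the boundary only if the boundary is
  nonempty; almost sure convergence provides a point.\<close>

lemma bnd_lim_in_bndry: "bnd_lim \<Sigma> \<omega> \<in> bndry \<Sigma>"
proof -
  have "\<exists>\<omega>. conv_infty \<Sigma> (\<lambda>n. walk n \<omega>)"
  proof (rule ccontr)
    assume "\<not> ?thesis"
    then have "AE \<omega> in pathsp \<theta>. False" using AE_conv_infty by simp
    then show False by simp
  qed
  then have ne: "\<exists>\<xi>. \<xi> \<in> bndry \<Sigma>" using bnd_lim_conv(1) by blast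
  show ?thesis
  proof (cases "\<exists>\<xi>. \<xi> \<in> bndry \<Sigma> \<and> (\<lambda>n. walk n \<omega>) \<in> \<xi>")
    case True
    then have "bnd_lim \<Sigma> \<omega> = (SOME \<xi>. \<xi> \<in> bndry \<Sigma> \<and> (\<lambda>n. walk n \<omega>) \<in> \<xi>)" unfolding bnd_lim_def by auto
    then show ?thesis using someI_ex[OF True] by auto
  next
    case False
    then have "bnd_lim \<Sigma> \<omega> = (SOME \<xi>. \<xi> \<in> bndry \<Sigma>)" unfolding bnd_lim_def by auto
    then show ?thesis using someI_ex[OF ne] by auto
  qed
qed

section \<open>Conditional measures given the limit point\<close>

lemma space_hitting [simp]: "space (hitting \<Sigma> \<theta>) = bndry \<Sigma>"
  by (simp add: hitting_def)

lemma sets_hitting [measurable_cong, simp]: "sets (hitting \<Sigma> \<theta>) = sets (Bnd \<Sigma>)"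
  by (simp add: hitting_def)

lemma disintegration_integral:
  assumes "is_disintegration \<Sigma> \<theta> Pc" "A \<in> sets (pathsp \<theta>)"
  shows "(\<integral>\<^sup>+ \<xi>. emeasure (Pc \<xi>) A \<partial>hitting \<Sigma> \<theta>) = emeasure (pathsp \<theta>) A"
proof -
  have "bndry \<Sigma> \<in> sets (Bnd \<Sigma>)" using sets.top[of "Bnd \<Sigma>"] by simp
  then have "emeasure (pathsp \<theta>) (A \<inter> bnd_lim \<Sigma> -` bndry \<Sigma>) =
      (\<integral>\<^sup>+ \<xi>. emeasure (Pc \<xi>) A * indicator (bndry \<Sigma>) \<xi> \<partial>hitting \<Sigma> \<theta>)"
    using assms unfolding is_disintegration_def by blast
  moreover have "A \<inter> bnd_lim \<Sigma> -` bndry \<Sigma> = A" using bnd_lim_in_bndry by auto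
  moreover have "(\<integral>\<^sup>+ \<xi>. emeasure (Pc \<xi>) A * indicator (bndry \<Sigma>) \<xi> \<partial>hitting \<Sigma> \<theta>) =
      (\<integral>\<^sup>+ \<xi>. emeasure (Pc \<xi>) A \<partial>hitting \<Sigma> \<theta>)"
    by (rule nn_integral_cong) simp
  ultimately show ?thesis by simp
qed

lemma disintegration_measurable:
  assumes "is_disintegration \<Sigma> \<theta> Pc" "A \<in> sets (pathsp \<theta>)"
  shows "(\<lambda>\<xi>. emeasure (Pc \<xi>) A) \<in> borel_measurable (hitting \<Sigma> \<theta>)"
  using assms unfolding is_disintegration_def by (simp cong: measurable_cong_sets)

text \<open>The disintegration identity turns a null joint event into a vanishing integral of a
  nonnegative function of \<open>\<xi>\<close>.\<close>

lemma conditional_null: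
  assumes dis: "is_disintegration \<Sigma> \<theta> Pc" and A: "A \<in> sets (pathsp \<theta>)" and B: "B \<in> sets (Bnd \<Sigma>)"
    and null: "AE \<omega> in pathsp \<theta>. \<omega> \<in> A \<longrightarrow> bnd_lim \<Sigma> \<omega> \<notin> B"
  shows "AE \<xi> in hitting \<Sigma> \<theta>. \<xi> \<in> B \<longrightarrow> emeasure (Pc \<xi>) A = 0"
proof -
  obtain N where N: "{\<omega> \<in> space (pathsp \<theta>). \<not> (\<omega> \<in> A \<longrightarrow> bnd_lim \<Sigma> \<omega> \<notin> B)} \<subseteq> N"
    "emeasure (pathsp \<theta>) N = 0" "N \<in> sets (pathsp \<theta>)"
    using null by (rule AE_E)
  \<comment> \<open>The set lies inside the null set \<open>N\<close>, and \<open>emeasure\<close>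
    vanishes on it whether or not the set itself is measurable.\<close>
  have "emeasure (pathsp \<theta>) (A \<inter> bnd_lim \<Sigma> -` B) = 0"
    by (rule emeasure_eq_0[OF N(3,2)]) (use N(1) in auto)
  moreover have "emeasure (pathsp \<theta>) (A \<inter> bnd_lim \<Sigma> -` B) =
      (\<integral>\<^sup>+ \<xi>. emeasure (Pc \<xi>) A * indicator B \<xi> \<partial>hitting \<Sigma> \<theta>)"
    using dis A B unfolding is_disintegration_def by blast
  ultimately have "(\<integral>\<^sup>+ \<xi>. emeasure (Pc \<xi>) A * indicator B \<xi> \<partial>hitting \<Sigma> \<theta>) = 0" by simp
  moreover have "(\<lambda>\<xi>. emeasure (Pc \<xi>) A * indicator B \<xi>) \<in> borel_measurable (hitting \<Sigma> \<theta>)"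
    using disintegration_measurable[OF dis A] B by (intro borel_measurable_times_ennreal borel_measurable_indicator) auto
  ultimately have "AE \<xi> in hitting \<Sigma> \<theta>. emeasure (Pc \<xi>) A * indicator B \<xi> = 0"
    by (simp add: nn_integral_0_iff_AE)
  then show ?thesis by eventually_elim (auto split: split_indicator_asm)
qed

text \<open>Almost surely the walk is a candidate for its own limit point. For fixed
  \<open>g\<close> and \<open>r\<close> this passes to the conditional measures, since the condition
  on \<open>\<xi>\<close> is an open shadow or empty; countably many pairs \<open>(g, r)\<close>
  then leave a single null set of boundary points.\<close>

lemma conditional_support:
  assumes dis: "is_disintegration \<Sigma> \<theta> Pc" and R: "0 \<le> R" and B: "real M + 2 * R \<le> real B"
    and q: "AE \<omega> in pathsp \<theta>. 0 < pmf q (recording R M n \<omega>)"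
  shows "AE \<xi> in hitting \<Sigma> \<theta>. \<forall>g r. emeasure (Pc \<xi>) {\<omega>. walk n \<omega> = g \<and> recording R M n \<omega> = r} \<noteq> 0 \<longrightarrow>
      g \<in> candidates R B n r \<xi> \<and> 0 < pmf q r"
proof -
  have "AE \<xi> in hitting \<Sigma> \<theta>. emeasure (Pc \<xi>) {\<omega>. walk n \<omega> = g \<and> recording R M n \<omega> = r} \<noteq> 0 \<longrightarrow>
      g \<in> candidates R B n r \<xi> \<and> 0 < pmf q r" for g r
  proof -
    define U where "U = {\<xi>\<in>bndry \<Sigma>. g \<in> candidates R B n r \<xi> \<and> 0 < pmf q r}"
    have "U = (if \<bar>real (len (g - snd (decode r))) - real (fst (decode r))\<bar> \<le> real (n * B) \<and> 0 < pmf q r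
        then open_shadow (g - snd (decode r)) (R + \<delta>) else {})"
      by (auto simp: U_def candidates_def open_shadow_def)
    then have "U \<in> sets (Bnd \<Sigma>)" using sets_open_shadow by simp
    then have "bndry \<Sigma> - U \<in> sets (Bnd \<Sigma>)" using sets.compl_sets[of U "Bnd \<Sigma>"] by simp
    moreover have "AE \<omega> in pathsp \<theta>. \<omega> \<in> {\<omega>. walk n \<omega> = g \<and> recording R M n \<omega> = r} \<longrightarrow> bnd_lim \<Sigma> \<omega> \<notin> bndry \<Sigma> - U"
      using q AE_conv_infty
    proof eventually_elim
      fix \<omega> assume "0 < pmf q (recording R M n \<omega>)" "conv_infty \<Sigma> (\<lambda>n. walk n \<omega>)"
      then show "\<omega> \<in> {\<omega>. walk n \<omega> = g \<and> recording R M n \<omega> = r} \<longrightarrow> bnd_lim \<Sigma> \<omega> \<notin> bndry \<Sigma> - U"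
        using walk_in_candidates[OF R B, of \<omega> n] bnd_lim_in_bndry by (auto simp: U_def)
    qed
    ultimately have "AE \<xi> in hitting \<Sigma> \<theta>. \<xi> \<in> bndry \<Sigma> - U \<longrightarrow>
        emeasure (Pc \<xi>) {\<omega>. walk n \<omega> = g \<and> recording R M n \<omega> = r} = 0"
      by (rule conditional_null[OF dis sets_walk_recording])
    moreover have "AE \<xi> in hitting \<Sigma> \<theta>. \<xi> \<in> bndry \<Sigma>" by (rule AE_I2) simp
    ultimately show ?thesis by eventually_elim (auto simp: U_def)
  qed
  then have "AE \<xi> in hitting \<Sigma> \<theta>. \<forall>g\<in>UNIV. \<forall>r\<in>UNIV. emeasure (Pc \<xi>) {\<omega>. walk n \<omega> = g \<and> recording R M n \<omega> = r} \<noteq> 0 \<longrightarrow>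
      g \<in> candidates R B n r \<xi> \<and> 0 < pmf q r"
    using countable_group countable_option_lists[OF countable_group]
    by (intro AE_ball_countable')
  then show ?thesis by simp
qed

text \<open>For almost every \<open>\<xi>\<close> the position is coded by its recording under
  \<open>q\<close> and its index among the candidates. The price depends on the recording and not on
  \<open>\<xi>\<close>, so after summation and integration are interchanged, the conditional
  measures average back to the path measure and the unconditional cost appears.\<close>

lemma H_bnd_le:
  fixes R c :: real
  assumes dis: "is_disintegration \<Sigma> \<theta> Pc" and R: "0 \<le> R" and B: "real M + 2 * R \<le> real B"
    and q: "AE \<omega> in pathsp \<theta>. 0 < pmf q (recording R M n \<omega>)"
    and cost: "(\<integral>\<^sup>+ \<omega>. ennreal (- ln (pmf q (recording R M n \<omega>))) \<partial>pathsp \<theta>) \<le> ennreal c" and "0 \<le> c"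
  defines "b \<equiv> card {h. len h \<le> nat \<lfloor>2 * (R + \<delta>) + 4 * \<delta>\<rfloor>}"
  shows "H_bnd \<Sigma> \<theta> Pc n \<le> ennreal (c + ln (real ((2 * n * B + 1) * b)))"
proof -
  define N where "N = real ((2 * n * B + 1) * b)"
  define A where "A = (\<lambda>g r. {\<omega>. walk n \<omega> = g \<and> recording R M n \<omega> = r})"
  have "0 \<in> {h. len h \<le> nat \<lfloor>2 * (R + \<delta>) + 4 * \<delta>\<rfloor>}" by simp
  then have "0 < b" unfolding b_def using finite_ball card_gt_0_iff by blast
  then have "1 \<le> (2 * n * B + 1) * b" by simp
  then have N: "1 \<le> N" unfolding N_def by (metis of_nat_1 of_nat_mono)
  have cP: "countable (UNIV :: ('a \<times> 'a option list) set)"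
    using countable_SIGMA[of "UNIV :: 'a set" "\<lambda>_. UNIV :: 'a option list set"] countable_group
      countable_option_lists[OF countable_group] by simp
  have "AE \<xi> in hitting \<Sigma> \<theta>. H_xi \<theta> Pc \<xi> n \<le>
      (\<integral>\<^sup>+ x. ennreal (- ln (pmf q (snd x)) + ln N) * emeasure (Pc \<xi>) (A (fst x) (snd x)) \<partial>count_space UNIV)"
    using conditional_support[OF dis R B q] AE_space[of "hitting \<Sigma> \<theta>"]
  proof eventually_elim
    fix \<xi> assume supp: "\<forall>g r. emeasure (Pc \<xi>) {\<omega>. walk n \<omega> = g \<and> recording R M n \<omega> = r} \<noteq> 0 \<longrightarrow>
        g \<in> candidates R B n r \<xi> \<and> 0 < pmf q r" and "\<xi> \<in> space (hitting \<Sigma> \<theta>)"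
    then have Pc: "prob_space (Pc \<xi>)" "sets (Pc \<xi>) = sets (pathsp \<theta>)"
      using dis by (simp_all add: is_disintegration_def)
    interpret Pc: prob_space "Pc \<xi>" by (rule Pc(1))
    have space: "space (Pc \<xi>) = UNIV" using sets_eq_imp_space_eq[OF Pc(2)] by simp
    have "H_xi \<theta> Pc \<xi> n = (\<integral>\<^sup>+ g. ennreal (let p = measure (Pc \<xi>) {\<omega> \<in> space (Pc \<xi>). walk n \<omega> = g} in - p * ln p) \<partial>count_space UNIV)"
      by (simp add: H_xi_def space)
    also have "\<dots> \<le> (\<integral>\<^sup>+ g. \<integral>\<^sup>+ r. ennreal (measure (Pc \<xi>) {\<omega> \<in> space (Pc \<xi>). walk n \<omega> = g \<and> recording R M n \<omega> = r}) *
        ennreal (- ln (pmf q r) + ln N) \<partial>count_space UNIV \<partial>count_space UNIV)"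
    proof (rule Pc.entropy_le_code[where cand="\<lambda>r. candidates R B n r \<xi>"])
      show "finite (candidates R B n r \<xi>)" "real (card (candidates R B n r \<xi>)) \<le> N" for r
        using candidates_card by (auto simp: N_def b_def)
      show "{\<omega> \<in> space (Pc \<xi>). walk n \<omega> = g \<and> recording R M n \<omega> = r} \<in> sets (Pc \<xi>)" for g r
        using sets_walk_recording by (simp add: space Pc(2))
      show "g \<in> candidates R B n r \<xi> \<and> 0 < pmf q r"
        if "measure (Pc \<xi>) {\<omega> \<in> space (Pc \<xi>). walk n \<omega> = g \<and> recording R M n \<omega> = r} \<noteq> 0" for g r
        using that supp by (simp add: space measure_def) (metis enn2real_0)
    qed (use N countable_group countable_option_lists[OF countable_group] in auto)
    also have "\<dots> = (\<integral>\<^sup>+ g. \<integral>\<^sup>+ r. (\<lambda>x. ennreal (- ln (pmf q (snd x)) + ln N) * emeasure (Pc \<xi>) (A (fst x) (snd x))) (g, r)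
        \<partial>count_space UNIV \<partial>count_space UNIV)"
      by (simp add: A_def space Pc.emeasure_eq_measure mult.commute)
    also have "\<dots> = (\<integral>\<^sup>+ x. ennreal (- ln (pmf q (snd x)) + ln N) * emeasure (Pc \<xi>) (A (fst x) (snd x)) \<partial>count_space UNIV)"
      by (rule nn_integral_fst_count_space)
    finally show "H_xi \<theta> Pc \<xi> n \<le>
      (\<integral>\<^sup>+ x. ennreal (- ln (pmf q (snd x)) + ln N) * emeasure (Pc \<xi>) (A (fst x) (snd x)) \<partial>count_space UNIV)" .
  qed
  then have "H_bnd \<Sigma> \<theta> Pc n \<le> (\<integral>\<^sup>+ \<xi>. (\<integral>\<^sup>+ x. ennreal (- ln (pmf q (snd x)) + ln N) * emeasure (Pc \<xi>) (A (fst x) (snd x))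
      \<partial>count_space UNIV) \<partial>hitting \<Sigma> \<theta>)"
    unfolding H_bnd_def by (rule nn_integral_mono_AE)
  also have "\<dots> = (\<integral>\<^sup>+ x. (\<integral>\<^sup>+ \<xi>. ennreal (- ln (pmf q (snd x)) + ln N) * emeasure (Pc \<xi>) (A (fst x) (snd x)) \<partial>hitting \<Sigma> \<theta>)
      \<partial>count_space UNIV)"
    by (rule nn_integral_count_space_swap[OF cP])
      (intro borel_measurable_times_ennreal borel_measurable_const disintegration_measurable[OF dis], simp add: A_def sets_walk_recording)
  also have "\<dots> = (\<integral>\<^sup>+ x. ennreal (- ln (pmf q (snd x)) + ln N) * emeasure (pathsp \<theta>) (A (fst x) (snd x)) \<partial>count_space UNIV)"
    by (intro nn_integral_cong)
      (simp add: nn_integral_cmult disintegration_measurable[OF dis] disintegration_integral[OF dis] A_def sets_walk_recording)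
  also have "\<dots> = (\<integral>\<^sup>+ x. ennreal (- ln (pmf q (snd x)) + ln N) *
      emeasure (pathsp \<theta>) {\<omega> \<in> space (pathsp \<theta>). (walk n \<omega>, recording R M n \<omega>) = x} \<partial>count_space UNIV)"
    by (intro nn_integral_cong) (simp add: A_def prod_eq_iff)
  also have "\<dots> = (\<integral>\<^sup>+ \<omega>. ennreal (- ln (pmf q (snd (walk n \<omega>, recording R M n \<omega>))) + ln N) \<partial>pathsp \<theta>)"
    by (rule nn_integral_discrete[OF cP, symmetric]) (simp add: prod_eq_iff sets_walk_recording)
  also have "\<dots> = (\<integral>\<^sup>+ \<omega>. ennreal (- ln (pmf q (recording R M n \<omega>))) + ennreal (ln N) \<partial>pathsp \<theta>)"
  proof (rule nn_integral_cong)
    fix \<omega>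
    have "0 \<le> - ln (pmf q (recording R M n \<omega>))"
      using pmf_le_1[of q "recording R M n \<omega>"] pmf_nonneg[of q "recording R M n \<omega>"]
      by (cases "pmf q (recording R M n \<omega>) = 0") auto
    then show "ennreal (- ln (pmf q (snd (walk n \<omega>, recording R M n \<omega>))) + ln N) =
        ennreal (- ln (pmf q (recording R M n \<omega>))) + ennreal (ln N)"
      unfolding snd_conv using N by (intro ennreal_plus) auto
  qed
  also have "\<dots> \<le> ennreal c + ennreal (ln N)"
  proof -
    have "(\<lambda>\<omega>. ennreal (- ln (pmf q (recording R M n \<omega>)))) \<in> borel_measurable (pathsp \<theta>)"
    proof (rule measurable_compose_countable'[where I="UNIV :: 'a option list set" and g="recording R M n" and f="\<lambda>r _. ennreal (- ln (pmf q r))"])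
      have "{\<omega>. recording R M n \<omega> = r} = (\<Union>g. {\<omega>. walk n \<omega> = g \<and> recording R M n \<omega> = r})" for r by auto
      then have "{\<omega>. recording R M n \<omega> = r} \<in> sets (pathsp \<theta>)" for r
        using countable_group sets_walk_recording by (auto intro!: sets.countable_UN'')
      then show "recording R M n \<in> measurable (pathsp \<theta>) (count_space UNIV)"
        using countable_option_lists[OF countable_group]
        by (subst measurable_count_space_eq_countable) (auto simp: vimage_def)
    qed (use countable_option_lists[OF countable_group] in auto)
    then show ?thesis
      using cost path.emeasure_space_1 by (simp add: nn_integral_add add_right_mono)
  qed
  also have "\<dots> = ennreal (c + ln N)" using N \<open>0 \<le> c\<close> by simp
  finally show ?thesis by (simp add: N_def)
qed

theorem H_bnd_sublinear:
  assumes dis: "is_disintegration \<Sigma> \<theta> Pc" and ent: "entropy_pmf \<theta> < \<infinity>"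
  shows "(\<lambda>n. H_bnd \<Sigma> \<theta> Pc n / ennreal (real n)) \<longlonglongrightarrow> 0"
proof (rule order_tendstoI)
  fix a :: ennreal assume "0 < a"
  then obtain x where x: "0 < x" "x < a" using dense by blast
  then obtain e where e: "x = ennreal e" "0 < e" by (cases x) auto
  obtain R M q where R: "0 \<le> R"
    and q: "\<And>n. AE \<omega> in pathsp \<theta>. 0 < pmf (replicate_pmf n q) (recording R M n \<omega>)"
    "\<And>n. (\<integral>\<^sup>+ \<omega>. ennreal (- ln (pmf (replicate_pmf n q) (recording R M n \<omega>))) \<partial>pathsp \<theta>) \<le> ennreal (real n * (e/2))"
    using recording_cost[OF ent, of "e/2"] e(2) by auto
  define B where "B = nat \<lceil>real M + 2 * R\<rceil>"
  have B: "real M + 2 * R \<le> real B" unfolding B_def by linarith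
  define b where "b = card {h. len h \<le> nat \<lfloor>2 * (R + \<delta>) + 4 * \<delta>\<rfloor>}"
  have "0 \<in> {h. len h \<le> nat \<lfloor>2 * (R + \<delta>) + 4 * \<delta>\<rfloor>}" by simp
  then have "0 < b" unfolding b_def using finite_ball card_gt_0_iff by blast
  \<comment> \<open>For \<open>n\<close> at least 1 the number of candidates is at most
    \<open>n * K\<close>, with \<open>K\<close> depending on \<open>e\<close> only, so its logarithm
    is \<open>n * s n\<close>.\<close>
  define K where "K = real ((2 * B + 1) * b)"
  have "0 < K" using \<open>0 < b\<close> by (simp add: K_def del: of_nat_mult)
  define s where "s = (\<lambda>n. ln (real n) / real n + ln K / real n)"
  have "s \<longlonglongrightarrow> 0 + 0"
    unfolding s_def by (intro tendsto_add lim_ln_over_n lim_const_over_n)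
  then have "eventually (\<lambda>n. s n < e/2) sequentially"
    by (intro order_tendstoD) (use e in auto)
  then show "eventually (\<lambda>n. H_bnd \<Sigma> \<theta> Pc n / ennreal (real n) < a) sequentially"
    using eventually_gt_at_top[of 0]
  proof eventually_elim
    fix n :: nat assume n: "s n < e/2" "0 < n"
    have "(2 * n * B + 1) * b \<le> n * ((2 * B + 1) * b)" using n(2) by (simp add: algebra_simps)
    then have "real ((2 * n * B + 1) * b) \<le> real n * K"
      unfolding K_def by (metis of_nat_mono of_nat_mult)
    moreover have "0 < real ((2 * n * B + 1) * b)" using \<open>0 < b\<close> by (simp del: of_nat_mult)
    ultimately have "ln (real ((2 * n * B + 1) * b)) \<le> ln (real n * K)"
      by (intro ln_mono) auto
    also have "\<dots> = real n * s n"
      using \<open>0 < K\<close> n(2) by (simp add: s_def ln_mult distrib_left)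
    also have "\<dots> \<le> real n * (e/2)" using n by (intro mult_left_mono) auto
    finally have ln: "ln (real ((2 * n * B + 1) * b)) \<le> real n * (e/2)" .
    have "H_bnd \<Sigma> \<theta> Pc n \<le> ennreal (real n * (e/2) + ln (real ((2 * n * B + 1) * b)))"
      unfolding b_def by (rule H_bnd_le[OF dis R B q]) (use e in simp)
    also have "\<dots> \<le> ennreal (real n * e)" using ln by (intro ennreal_leI) (simp add: field_simps)
    finally have "H_bnd \<Sigma> \<theta> Pc n / ennreal (real n) \<le> ennreal (real n * e) / ennreal (real n)"
      by (rule divide_right_mono_ennreal)
    also have "\<dots> = ennreal e" using n(2) e(2) by (simp add: divide_ennreal)
    finally show "H_bnd \<Sigma> \<theta> Pc n / ennreal (real n) < a" using x e by simp
  qed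
qed simp

end

sublocale schottky_group \<subseteq> walk: tight_walk \<Sigma> \<delta> "step_pmf \<kappa>" for \<kappa>
  using walk_tight walk_growth by unfold_locales

theorem theorem4p7:
  fixes \<Sigma> S :: "'g::group_add set"
    and \<delta> \<epsilon> C D :: real
    and \<kappa> :: "'g pmf"
    and Pc :: "(nat \<Rightarrow> 'g) set \<Rightarrow> 'g stream measure"
  assumes "finite \<Sigma>" and "generates \<Sigma>"
    and "non_elementary TYPE('g)"
    and "delta_hyperbolic \<Sigma> \<delta>"
    and "S \<noteq> {}" and "schottky \<Sigma> S \<epsilon> C D"
    and "\<epsilon> \<le> 1/100" and "D > 100 * C + 100 * \<delta> + 1"
    and "\<theta> = conv_pmf \<kappa> (conv_pmf (pmf_of_set S) (pmf_of_set S))"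
    and "entropy_pmf \<theta> < \<infinity>"
    and "is_disintegration \<Sigma> \<theta> Pc"
  shows "(\<lambda>n. H_bnd \<Sigma> \<theta> Pc n / ennreal (real n)) \<longlonglongrightarrow> 0"
proof -
  \<comment> \<open>Vertices are encoded as starting points of edges, which requires a generator. An
    empty generating set would make the group trivial and thus virtually cyclic.\<close>
  have "\<Sigma> \<noteq> {}"
  proof
    assume "\<Sigma> = {}"
    have "g = 0" for g :: 'g
    proof -
      obtain l where "set l \<subseteq> gens \<Sigma>" "sum_list l = g"
        using assms(2) unfolding generates_def by blast
      then show ?thesis using \<open>\<Sigma> = {}\<close> by (simp add: gens_def)
    qed
    then have "finite (UNIV :: 'g set)" by (metis finite.emptyI finite_insert finite_subset insertI1 subsetI)
    then have "finite (UNIV :: 'g set set)" by (simp add: Finite_Set.finite_set)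
    then have "virtually_cyclic TYPE('g)" unfolding virtually_cyclic_def using finite_subset subset_UNIV by blast
    then show False using assms(3) by (simp add: non_elementary_def)
  qed
  interpret hyperbolic_group \<Sigma> \<delta>
    by unfold_locales (fact assms \<open>\<Sigma> \<noteq> {}\<close>)+
  have S: "finite S" using assms(6) by (simp add: schottky_def)
  have card: "99/100 * real (card S) \<le> (1 - \<epsilon>) * real (card S)"
    using assms(7) by (intro mult_right_mono) auto
  have left: "99/100 * real (card S) \<le> real (card {s\<in>S. gp 0 x s \<le> C})" for x
  proof -
    have "(1 - \<epsilon>) * real (card S) \<le> real (card {s\<in>S. gprod \<Sigma> (vert \<Sigma> x) (act s (vert \<Sigma> 0)) \<le> C})"
      using assms(6) vert_in[of x] vert_in[of 0] unfolding schottky_def by blast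
    then show ?thesis using card by (simp add: gprod_vert)
  qed
  have right: "99/100 * real (card S) \<le> real (card {s\<in>S. gp 0 x (- s) \<le> C})" for x
  proof -
    have "(1 - \<epsilon>) * real (card S) \<le> real (card {s\<in>S. gprod \<Sigma> (vert \<Sigma> x) (act (- s) (vert \<Sigma> 0)) \<le> C})"
      using assms(6) vert_in[of x] vert_in[of 0] unfolding schottky_def by blast
    then show ?thesis using card by (simp add: gprod_vert)
  qed
  have "0 < card S" using S assms(5) by (simp add: card_gt_0_iff)
  \<comment> \<open>The sign of \<open>C\<close> is read off from the Schottky condition: some
    Gromov product, a nonnegative number, is at most \<open>C\<close>.\<close>
  then have "{s\<in>S. gp 0 0 s \<le> C} \<noteq> {}" using left[of 0] by force
  then obtain s where "gp 0 0 s \<le> C" by blast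
  then have C: "0 \<le> C" using gp_nonneg[of 0 0 s] by linarith
  interpret schottky_group \<Sigma> \<delta> S C
  proof
    show "100 * C + 100 * \<delta> + 1 \<le> real (len s)" if "s \<in> S" for s
      using assms(6,8) that by (force simp: schottky_def)
  qed (use S assms(5) C left right in auto)
  show ?thesis
    using walk.H_bnd_sublinear[of \<kappa> Pc] assms(9,10,11) by (simp add: step_pmf_eq)
qed

end
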